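(* Let $\mathcal{G}$ be a species of graphs and let $\mathcal{N}$ be a symmetric species of networks. Then the Walsh index series of the species $\mathcal{G}\uparrow\mathcal{N}$ is given by $$W_{\mathcal{G}\uparrow\mathcal{N}}(\mathbf{a};\mathbf{b};\mathbf{c}) = W_{\mathcal{G}}\big(a_1,a_2,\ldots;\ (W^+_{\mathcal{N}})_1,(W^+_{\mathcal{N}})_2,\ldots;\ (W^-_{\mathcal{N}})_1,(W^-_{\mathcal{N}})_2,\ldots\big).$$
   Context: All graphs are finite and simple. $K_2$ is considered 2-connected. A species of graphs is a class of (labelled) graphs closed under isomorphism; the underlying set of a graph is its vertex set. A (2-pole) network is a connected graph $N$ with two distinguished vertices $0,1$ (the poles) such that the graph $N\cup 01$, obtained by adding the edge $01$ if it is not already there, is 2-connected; the other vertices are internal. The underlying set of a network is its set $U$ of internal vertices, and $\hat N$ denotes the corresponding graph on $U\cup\{0,1\}$. Isomorphisms of networks are graph isomorphisms fixing $0$ and $1$. A species of networks is a class of networks closed under isomorphism. The opposite network $\tau\cdot N$ is obtained from $N$ by interchanging the poles $0$ and $1$; $\mathcal{N}$ is symmetric if $N\in\mathcal{N}\Rightarrow\tau\cdot N\in\mathcal{N}$. $\mathcal{N}_\tau$ is the subclass of those $N\in\mathcal{N}$ with $\tau\cdot N$ isomorphic to $N$. The class $\mathcal{G}\uparrow\mathcal{N}$ consists of the pairs of graphs $(G,G_0)$ such that: $G_0\in\mathcal{G}$ (the core); $V(G_0)\subseteq V(G)$; and there is a family $\{N_e: e\in E(G_0)\}$ of networks in $\mathcal{N}$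 such that $G$ is obtained from $G_0$ by substituting $N_e$ for each edge $e$ of $G_0$, identifying the poles of $N_e$ with the extremities of $e$ according to some orientation (the internal vertex sets of the $N_e$ being pairwise disjoint and disjoint from $V(G_0)$). The underlying set of $(G,G_0)$ is $V(G)$; isomorphisms of such pairs are core-preserving graph isomorphisms. Edge cycles: an automorphism $\sigma$ of a graph $G$ induces a permutation of $E(G)$. A cycle of length $l$ of this permutation is cylindrical if $\sigma^l(a)=a$, $\sigma^l(b)=b$ for each edge $ab$ of the cycle, and Möbius if $\sigma^l(a)=b$, $\sigma^l(b)=a$ for each edge $ab$ of the cycle. Let $\sigma_k$ be the number of cycles of length $k$ of $\sigma$ (on vertices), and $\mathrm{cyl}_k(G,\sigma)$, $\mathrm{m\ddot{o}b}_k(G,\sigma)$ the numbers of cylindrical and Möbius edge cycles of length $k$. Put $$w(G,\sigma)=\prod_{k\ge1}a_k^{\sigma_k}\,b_k^{\mathrm{cyl}_k(G,\sigma)}\,c_k^{\mathrm{m\ddot{o}b}_k(G,\sigma)}.$$ The Walsh index series, in the variables $\mathbf a=(a_1,a_2,\ldots)$, $\mathbf b=(b_1,b_2,\ldots)$, $\mathbf c=(c_1,c_2,\ldots)$, of a species of graphs $\mathcal{G}$ is $$W_{\mathcal{G}}(\mathbf{a};\mathbf{b};\mathbf{c})=\sum_{G}\frac{1}{|\mathrm{Aut}(G)|}\sum_{\sigma\in\mathrm{Aut}(G)}w(G,\sigma),$$ where $G$ runs over a set of representatives of the isomorphism classes of graphs in $\mathcal{G}$. For $\mathcal{G}\uparrow\mathcal{N}$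 the same formula is used, with the sum over representatives $(G,G_0)$ of isomorphism classes of pairs, $\mathrm{Aut}$ the group of core-preserving automorphisms $\sigma$ of $G$, and weight $w(G,\sigma)$. For a network $N$ with internal vertex set $U$ and a permutation $\sigma$ of $U$, let $\sigma^+=(0)(1)\sigma$ and $\sigma^-=(0,1)\sigma$, as permutations of $U\cup\{0,1\}$. Let $\mathrm{Aut}^{\pm}(N)$ be the set of permutations $\sigma$ of $U$ with $\sigma^{\pm}\in\mathrm{Aut}(\hat N)$. The weight of $(N,\sigma)$ is $w(N,\sigma)=w(\hat N,\sigma^+)/a_1^2$ when $\sigma$ is regarded in $\mathrm{Aut}^+(N)$ and $w(N,\sigma)=w(\hat N,\sigma^-)/a_2$ when $\sigma$ is regarded in $\mathrm{Aut}^-(N)$. Then $$W^+_{\mathcal{N}}=\sum_{N}\frac{1}{|\mathrm{Aut}^+(N)|}\sum_{\sigma\in\mathrm{Aut}^+(N)}w(N,\sigma),\qquad W^-_{\mathcal{N}}=\sum_{N}\frac{1}{|\mathrm{Aut}^-(N)|}\sum_{\sigma\in\mathrm{Aut}^-(N)}w(N,\sigma),$$ where $N$ runs over representatives of the isomorphism classes of networks in $\mathcal{N}$ for $W^+_{\mathcal N}$, and in $\mathcal{N}_\tau$ for $W^-_{\mathcal N}$. Finally $(W^{\pm}_{\mathcal{N}})_k=W^{\pm}_{\mathcal{N}}(a_k,a_{2k},\ldots;b_k,b_{2k},\ldots;c_k,c_{2k},\ldots)$. *)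

theory Defs
  imports
    Complex_Main
    "HOL-Library.Poly_Mapping"
    "HOL-Library.Disjoint_Sets"
    "HOL-Library.Infinite_Typeclass"
    "HOL-Combinatorics.Permutations"
    "HOL-Combinatorics.Orbits"
begin

section \<open>Formal power series in arbitrarily many variables\<close>

text \<open>
  A monomial in the variables of type \<^typ>\<open>'x\<close> is a finitely supported exponent function
  of type \<^typ>\<open>'x \<Rightarrow>\<^sub>0 nat\<close>; a formal power series is an arbitrary family of coefficients
  indexed by the monomials.
\<close>

typedef ('x, 'a) mps = "UNIV :: (('x \<Rightarrow>\<^sub>0 nat) \<Rightarrow> 'a) set"
  morphisms mps_coeff Abs_mps ..

setup_lifting type_definition_mps

lemma mps_eqI: "(\<And>m. mps_coeff f m = mps_coeff g m) \<Longrightarrow> f = g"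
  by (metis ext mps_coeff_inject)

lemma mps_coeff_Abs [simp]: "mps_coeff (Abs_mps c) = c"
  by (simp add: Abs_mps_inverse)

lemma finite_monomial_splits: "finite {(u, v). u + v = (m :: 'x \<Rightarrow>\<^sub>0 nat)}"
proof -
  let ?K = "Poly_Mapping.keys m"
  let ?F = "Pi\<^sub>E ?K (\<lambda>x. {..Poly_Mapping.lookup m x})"
  have inj: "inj_on (\<lambda>(u, v). restrict (Poly_Mapping.lookup u) ?K) {(u, v). u + v = m}"
  proof (rule inj_onI, clarify)
    fix u v u' v'
    assume m': "u' + v' = u + v" and m: "m = u + v"
      and eq: "restrict (Poly_Mapping.lookup u) (Poly_Mapping.keys (u + v))
             = restrict (Poly_Mapping.lookup u') (Poly_Mapping.keys (u + v))"
    have "Poly_Mapping.lookup u x = Poly_Mapping.lookup u' x" for x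
    proof (cases "x \<in> Poly_Mapping.keys (u + v)")
      case True
      then show ?thesis using fun_cong[OF eq, of x] by simp
    next
      case False
      then have "Poly_Mapping.lookup (u + v) x = 0" "Poly_Mapping.lookup (u' + v') x = 0"
        using m' by (simp_all add: in_keys_iff)
      then show ?thesis by (simp add: lookup_add)
    qed
    then have "u = u'" by (rule poly_mapping_eqI)
    with m' show "u = u' \<and> v = v'" by simp
  qed
  have "(\<lambda>(u, v). restrict (Poly_Mapping.lookup u) ?K) ` {(u, v). u + v = m} \<subseteq> ?F"
    by (auto simp: lookup_add)
  moreover have "finite ?F" by (intro finite_PiE) auto
  ultimately show ?thesis using inj by (meson finite_imageD finite_subset)
qed

instantiation mps :: (type, comm_ring_1) comm_ring_1
begin

lift_definition zero_mps :: "('a, 'b) mps" is "\<lambda>m. 0" .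
lift_definition one_mps :: "('a, 'b) mps" is "\<lambda>m. if m = 0 then 1 else 0" .
lift_definition plus_mps :: "('a, 'b) mps \<Rightarrow> ('a, 'b) mps \<Rightarrow> ('a, 'b) mps"
  is "\<lambda>f g m. f m + g m" .
lift_definition minus_mps :: "('a, 'b) mps \<Rightarrow> ('a, 'b) mps \<Rightarrow> ('a, 'b) mps"
  is "\<lambda>f g m. f m - g m" .
lift_definition uminus_mps :: "('a, 'b) mps \<Rightarrow> ('a, 'b) mps"
  is "\<lambda>f m. - f m" .
lift_definition times_mps :: "('a, 'b) mps \<Rightarrow> ('a, 'b) mps \<Rightarrow> ('a, 'b) mps"
  is "\<lambda>f g m. \<Sum>(u, v) \<in> {(u, v). u + v = m}. f u * g v" .

instance
proof
  fix f g h :: "('a, 'b) mps"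
  show "f * g * h = f * (g * h)"
  proof (rule mps_eqI)
    fix m
    let ?S = "\<lambda>m. {(u, v). u + v = (m :: 'a \<Rightarrow>\<^sub>0 nat)}"
    have "mps_coeff (f * g * h) m =
      (\<Sum>x\<in>?S m. \<Sum>y\<in>?S (fst x). mps_coeff f (fst y) * mps_coeff g (snd y) * mps_coeff h (snd x))"
      by (simp add: times_mps.rep_eq sum_distrib_right case_prod_beta)
    also have "\<dots> = (\<Sum>z\<in>(SIGMA x:?S m. ?S (fst x)).
        mps_coeff f (fst (snd z)) * mps_coeff g (snd (snd z)) * mps_coeff h (snd (fst z)))"
      by (subst sum.Sigma) (auto simp: finite_monomial_splits case_prod_beta)
    also have "\<dots> = (\<Sum>z\<in>(SIGMA x:?S m. ?S (snd x)).
        mps_coeff f (fst (fst z)) * (mps_coeff g (fst (snd z)) * mps_coeff h (snd (snd z))))"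
      by (rule sum.reindex_bij_witness[where
            i = "\<lambda>((a, b), (c, d)). ((a + c, d), (a, c))" and
            j = "\<lambda>((a, b), (c, d)). ((c, d + b), (d, b))"])
        (auto simp: algebra_simps)
    also have "\<dots> =
      (\<Sum>x\<in>?S m. \<Sum>y\<in>?S (snd x). mps_coeff f (fst x) * (mps_coeff g (fst y) * mps_coeff h (snd y)))"
      by (subst sum.Sigma) (auto simp: finite_monomial_splits case_prod_beta)
    also have "\<dots> = mps_coeff (f * (g * h)) m"
      by (simp add: times_mps.rep_eq sum_distrib_left case_prod_beta)
    finally show "mps_coeff (f * g * h) m = mps_coeff (f * (g * h)) m" .
  qed
  show "f * g = g * f"
  proof (rule mps_eqI)
    fix m
    show "mps_coeff (f * g) m = mps_coeff (g * f) m"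
      unfolding times_mps.rep_eq
      by (rule sum.reindex_bij_witness[where i = prod.swap and j = prod.swap])
        (auto simp: algebra_simps)
  qed
  show "1 * f = f"
  proof (rule mps_eqI)
    fix m
    have "mps_coeff (1 * f) m
        = (\<Sum>x\<in>{(u, v). u + v = m}. if x = (0, m) then mps_coeff f m else 0)"
      unfolding times_mps.rep_eq one_mps.rep_eq by (rule sum.cong) (auto split: if_splits)
    also have "\<dots> = mps_coeff f m"
      by (subst sum.delta) (auto simp: finite_monomial_splits)
    finally show "mps_coeff (1 * f) m = mps_coeff f m" .
  qed
  show "(f + g) * h = f * h + g * h"
    by (rule mps_eqI)
      (simp add: times_mps.rep_eq plus_mps.rep_eq case_prod_beta algebra_simps sum.distrib)
  show "(0 :: ('a, 'b) mps) \<noteq> 1"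
    by (metis one_mps.rep_eq zero_mps.rep_eq zero_neq_one)
qed (rule mps_eqI; simp add: plus_mps.rep_eq minus_mps.rep_eq uminus_mps.rep_eq zero_mps.rep_eq
      algebra_simps)+

end

definition mps_term :: "'a \<Rightarrow> ('x \<Rightarrow>\<^sub>0 nat) \<Rightarrow> ('x, 'a :: comm_ring_1) mps" where
  "mps_term c m = Abs_mps (\<lambda>u. if u = m then c else 0)"

abbreviation mps_var :: "'x \<Rightarrow> ('x, 'a :: comm_ring_1) mps" where
  "mps_var x \<equiv> mps_term 1 (Poly_Mapping.single x 1)"

text \<open>
  Coefficientwise sum of a possibly infinite family of series.  It has its intended meaning
  whenever the family is locally finite, i.e. every monomial has a nonzero coefficient in only
  finitely many members.  This is so for the families used below: the exponents of the vertex
  variables in the weight of a structure determine the number of its vertices (for networks: of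
  its internal vertices), and only finitely many isomorphism classes, hence only finitely many
  weights, belong to a given number of vertices.
\<close>

definition mps_sum :: "('i \<Rightarrow> ('x, 'a :: comm_ring_1) mps) \<Rightarrow> 'i set \<Rightarrow> ('x, 'a) mps" where
  "mps_sum f I = Abs_mps (\<lambda>m. \<Sum>i | i \<in> I \<and> mps_coeff (f i) m \<noteq> 0. mps_coeff (f i) m)"

definition mps_subst ::
    "('x, 'a :: comm_ring_1) mps \<Rightarrow> ('x \<Rightarrow> ('y, 'a) mps) \<Rightarrow> ('y, 'a) mps" where
  "mps_subst W f =
     mps_sum (\<lambda>p. mps_term (mps_coeff W p) 0 *
                  (\<Prod>x\<in>Poly_Mapping.keys p. f x ^ Poly_Mapping.lookup p x)) UNIV"


section \<open>Graphs and networks\<close>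

text \<open>Edges are two-element sets of vertices, so that $ab$ and $ba$ are the same edge.\<close>

record 'v graph =
  verts :: "'v set"
  edges :: "'v set set"

definition simple_graph :: "'v graph \<Rightarrow> bool" where
  "simple_graph G \<longleftrightarrow> finite (verts G) \<and> (\<forall>e\<in>edges G. e \<subseteq> verts G \<and> card e = 2)"

definition graph_connected :: "'v graph \<Rightarrow> bool" where
  "graph_connected G \<longleftrightarrow> verts G \<noteq> {} \<and>
     (\<forall>u\<in>verts G. \<forall>v\<in>verts G. (u, v) \<in> {(x, y). {x, y} \<in> edges G}\<^sup>*)"

definition delete_vertex :: "'v graph \<Rightarrow> 'v \<Rightarrow> 'v graph" where
  "delete_vertex G v = \<lparr>verts = verts G - {v}, edges = {e \<in> edges G. v \<notin> e}\<rparr>"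

definition add_edge :: "'v graph \<Rightarrow> 'v \<Rightarrow> 'v \<Rightarrow> 'v graph" where
  "add_edge G u v = \<lparr>verts = verts G, edges = insert {u, v} (edges G)\<rparr>"

text \<open>The bound on the number of vertices is 2 rather than 3, so that $K_2$ is 2-connected.\<close>

definition two_connected :: "'v graph \<Rightarrow> bool" where
  "two_connected G \<longleftrightarrow> card (verts G) \<ge> 2 \<and> graph_connected G \<and>
     (\<forall>v\<in>verts G. graph_connected (delete_vertex G v))"

definition graph_iso :: "('v \<Rightarrow> 'w) \<Rightarrow> 'v graph \<Rightarrow> 'w graph \<Rightarrow> bool" where
  "graph_iso f G H \<longleftrightarrow> bij_betw f (verts G) (verts H) \<and> (image f) ` edges G = edges H"

definition graphs_isomorphic :: "'v graph \<Rightarrow> 'v graph \<Rightarrow> bool" where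
  "graphs_isomorphic G H \<longleftrightarrow> (\<exists>f. graph_iso f G H)"

definition graph_species :: "'v graph set \<Rightarrow> bool" where
  "graph_species \<G> \<longleftrightarrow> (\<forall>G\<in>\<G>. simple_graph G) \<and>
     (\<forall>G\<in>\<G>. \<forall>H. simple_graph H \<and> graphs_isomorphic G H \<longrightarrow> H \<in> \<G>)"

text \<open>
  The poles may be any two distinct vertices; all notions below treat networks up to isomorphisms
  preserving each pole.  The field \<open>hat\<close> is the underlying graph including the poles.
\<close>

record 'v network =
  hat :: "'v graph"
  pole0 :: 'v
  pole1 :: 'v

definition is_network :: "'v network \<Rightarrow> bool" where
  "is_network N \<longleftrightarrow> simple_graph (hat N) \<and> graph_connected (hat N) \<and>
     pole0 N \<in> verts (hat N) \<and> pole1 N \<in> verts (hat N) \<and> pole0 N \<noteq> pole1 N \<and>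
     two_connected (add_edge (hat N) (pole0 N) (pole1 N))"

definition internal :: "'v network \<Rightarrow> 'v set" where
  "internal N = verts (hat N) - {pole0 N, pole1 N}"

definition network_iso :: "('v \<Rightarrow> 'w) \<Rightarrow> 'v network \<Rightarrow> 'w network \<Rightarrow> bool" where
  "network_iso f N M \<longleftrightarrow>
     graph_iso f (hat N) (hat M) \<and> f (pole0 N) = pole0 M \<and> f (pole1 N) = pole1 M"

definition networks_isomorphic :: "'v network \<Rightarrow> 'v network \<Rightarrow> bool" where
  "networks_isomorphic N M \<longleftrightarrow> (\<exists>f. network_iso f N M)"

definition network_species :: "'v network set \<Rightarrow> bool" where
  "network_species \<N> \<longleftrightarrow> (\<forall>N\<in>\<N>. is_network N) \<and>
     (\<forall>N\<in>\<N>. \<forall>M. is_network M \<and> networks_isomorphic N M \<longrightarrow> M \<in> \<N>)"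

definition opposite :: "'v network \<Rightarrow> 'v network" where
  "opposite N = \<lparr>hat = hat N, pole0 = pole1 N, pole1 = pole0 N\<rparr>"

definition symmetric_species :: "'v network set \<Rightarrow> bool" where
  "symmetric_species \<N> \<longleftrightarrow> (\<forall>N\<in>\<N>. opposite N \<in> \<N>)"

definition tau_part :: "'v network set \<Rightarrow> 'v network set" where
  "tau_part \<N> = {N \<in> \<N>. networks_isomorphic (opposite N) N}"


section \<open>Substitution of networks for the edges of a core\<close>

text \<open>
  The members of the family are already placed in the resulting graph: the poles of \<open>Ns e\<close> are the
  ends of \<open>e\<close>, in one of the two orders.  Since a species is closed under isomorphism, this is the
  same as gluing in arbitrary networks of the species.
\<close>

definition edge_substitution ::
    "'v graph set \<Rightarrow> 'v network set \<Rightarrow> ('v graph \<times> 'v graph) set" (infix \<open>\<up>\<close> 70) where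
  "\<G> \<up> \<N> = {(G, G\<^sub>0). G\<^sub>0 \<in> \<G> \<and> verts G\<^sub>0 \<subseteq> verts G \<and>
     (\<exists>Ns. (\<forall>e\<in>edges G\<^sub>0. Ns e \<in> \<N> \<and> {pole0 (Ns e), pole1 (Ns e)} = e \<and>
                          internal (Ns e) \<inter> verts G\<^sub>0 = {}) \<and>
           disjoint_family_on (\<lambda>e. internal (Ns e)) (edges G\<^sub>0) \<and>
           G = \<lparr>verts = verts G\<^sub>0 \<union> (\<Union>e\<in>edges G\<^sub>0. internal (Ns e)),
                edges = (\<Union>e\<in>edges G\<^sub>0. edges (hat (Ns e)))\<rparr>)}"

definition pairs_isomorphic :: "'v graph \<times> 'v graph \<Rightarrow> 'v graph \<times> 'v graph \<Rightarrow> bool" where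
  "pairs_isomorphic P Q \<longleftrightarrow>
     (\<exists>f. graph_iso f (fst P) (fst Q) \<and> graph_iso f (snd P) (snd Q))"


section \<open>Automorphisms and weights\<close>

definition graph_Aut :: "'v graph \<Rightarrow> ('v \<Rightarrow> 'v) set" where
  "graph_Aut G = {\<sigma>. \<sigma> permutes verts G \<and> graph_iso \<sigma> G G}"

definition pair_Aut :: "'v graph \<times> 'v graph \<Rightarrow> ('v \<Rightarrow> 'v) set" where
  "pair_Aut P = {\<sigma> \<in> graph_Aut (fst P). graph_iso \<sigma> (snd P) (snd P)}"

text \<open>
  A permutation of the internal vertices is, by \<^const>\<open>permutes\<close>, the identity elsewhere; so it
  already is its own extension fixing both poles.
\<close>

definition sigma_plus :: "'v network \<Rightarrow> ('v \<Rightarrow> 'v) \<Rightarrow> 'v \<Rightarrow> 'v" where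
  "sigma_plus N \<sigma> = \<sigma>"

definition sigma_minus :: "'v network \<Rightarrow> ('v \<Rightarrow> 'v) \<Rightarrow> 'v \<Rightarrow> 'v" where
  "sigma_minus N \<sigma> = transpose (pole0 N) (pole1 N) \<circ> \<sigma>"

definition Aut_plus :: "'v network \<Rightarrow> ('v \<Rightarrow> 'v) set" where
  "Aut_plus N = {\<sigma>. \<sigma> permutes internal N \<and> sigma_plus N \<sigma> \<in> graph_Aut (hat N)}"

definition Aut_minus :: "'v network \<Rightarrow> ('v \<Rightarrow> 'v) set" where
  "Aut_minus N = {\<sigma>. \<sigma> permutes internal N \<and> sigma_minus N \<sigma> \<in> graph_Aut (hat N)}"

definition vertex_cycles :: "'v graph \<Rightarrow> ('v \<Rightarrow> 'v) \<Rightarrow> 'v set set" where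
  "vertex_cycles G \<sigma> = orbit \<sigma> ` verts G"

definition edge_cycles :: "'v graph \<Rightarrow> ('v \<Rightarrow> 'v) \<Rightarrow> 'v set set set" where
  "edge_cycles G \<sigma> = orbit (image \<sigma>) ` edges G"

definition cylindrical :: "('v \<Rightarrow> 'v) \<Rightarrow> 'v set set \<Rightarrow> bool" where
  "cylindrical \<sigma> C \<longleftrightarrow>
     (\<forall>a b. {a, b} \<in> C \<longrightarrow> (\<sigma> ^^ card C) a = a \<and> (\<sigma> ^^ card C) b = b)"

definition moebius :: "('v \<Rightarrow> 'v) \<Rightarrow> 'v set set \<Rightarrow> bool" where
  "moebius \<sigma> C \<longleftrightarrow>
     (\<forall>a b. {a, b} \<in> C \<longrightarrow> (\<sigma> ^^ card C) a = b \<and> (\<sigma> ^^ card C) b = a)"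

text \<open>The variables $a_k$, $b_k$, $c_k$; those with index 0 never occur in the series below.\<close>

datatype wvar = VA nat | VB nat | VC nat

text \<open>The exponents of the monomial $w(G, \sigma)$; their support is finite for a finite graph.\<close>

definition weight :: "'v graph \<Rightarrow> ('v \<Rightarrow> 'v) \<Rightarrow> wvar \<Rightarrow>\<^sub>0 nat" where
  "weight G \<sigma> = Abs_poly_mapping (\<lambda>x. case x of
       VA k \<Rightarrow> card {C \<in> vertex_cycles G \<sigma>. card C = k}
     | VB k \<Rightarrow> card {C \<in> edge_cycles G \<sigma>. card C = k \<and> cylindrical \<sigma> C}
     | VC k \<Rightarrow> card {C \<in> edge_cycles G \<sigma>. card C = k \<and> moebius \<sigma> C})"

lemma lookup_weight:
  assumes "simple_graph G"
  shows "Poly_Mapping.lookup (weight G \<sigma>) (VA k) = card {C \<in> vertex_cycles G \<sigma>. card C = k}"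
    and "Poly_Mapping.lookup (weight G \<sigma>) (VB k) =
           card {C \<in> edge_cycles G \<sigma>. card C = k \<and> cylindrical \<sigma> C}"
    and "Poly_Mapping.lookup (weight G \<sigma>) (VC k) =
           card {C \<in> edge_cycles G \<sigma>. card C = k \<and> moebius \<sigma> C}"
proof -
  let ?w = "\<lambda>x. case x of
       VA k \<Rightarrow> card {C \<in> vertex_cycles G \<sigma>. card C = k}
     | VB k \<Rightarrow> card {C \<in> edge_cycles G \<sigma>. card C = k \<and> cylindrical \<sigma> C}
     | VC k \<Rightarrow> card {C \<in> edge_cycles G \<sigma>. card C = k \<and> moebius \<sigma> C}"
  have "finite (edges G)"
    using assms unfolding simple_graph_def
    by (meson Pow_iff finite_Pow_iff finite_subset subsetI)
  then have fin: "finite (vertex_cycles G \<sigma>)" "finite (edge_cycles G \<sigma>)"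
    using assms by (auto simp: simple_graph_def vertex_cycles_def edge_cycles_def)
  have "x \<in> VA ` card ` vertex_cycles G \<sigma> \<union> VB ` card ` edge_cycles G \<sigma> \<union>
      VC ` card ` edge_cycles G \<sigma>" if "?w x \<noteq> 0" for x
    using that by (cases x) (auto dest!: card_gt_0_iff[THEN iffD1])
  then have "{x. ?w x \<noteq> 0} \<subseteq> VA ` card ` vertex_cycles G \<sigma> \<union>
      VB ` card ` edge_cycles G \<sigma> \<union> VC ` card ` edge_cycles G \<sigma>"
    by blast
  then have "finite {x. ?w x \<noteq> 0}"
    by (rule finite_subset) (use fin in simp)
  then have "Poly_Mapping.lookup (weight G \<sigma>) = ?w"
    unfolding weight_def by (simp add: Abs_poly_mapping_inverse)
  then show "Poly_Mapping.lookup (weight G \<sigma>) (VA k) = card {C \<in> vertex_cycles G \<sigma>. card C = k}"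
    and "Poly_Mapping.lookup (weight G \<sigma>) (VB k) =
           card {C \<in> edge_cycles G \<sigma>. card C = k \<and> cylindrical \<sigma> C}"
    and "Poly_Mapping.lookup (weight G \<sigma>) (VC k) =
           card {C \<in> edge_cycles G \<sigma>. card C = k \<and> moebius \<sigma> C}"
    by simp_all
qed

text \<open>
  Division by $a_1^2$ (the two fixed poles) and by $a_2$ (the exchanged poles) is subtraction of
  exponents.
\<close>

definition weight_plus :: "'v network \<Rightarrow> ('v \<Rightarrow> 'v) \<Rightarrow> wvar \<Rightarrow>\<^sub>0 nat" where
  "weight_plus N \<sigma> = weight (hat N) (sigma_plus N \<sigma>) - Poly_Mapping.single (VA 1) 2"

definition weight_minus :: "'v network \<Rightarrow> ('v \<Rightarrow> 'v) \<Rightarrow> wvar \<Rightarrow>\<^sub>0 nat" where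
  "weight_minus N \<sigma> = weight (hat N) (sigma_minus N \<sigma>) - Poly_Mapping.single (VA 2) 1"


section \<open>Walsh index series\<close>

definition representatives :: "('s \<Rightarrow> 's \<Rightarrow> bool) \<Rightarrow> 's set \<Rightarrow> 's set" where
  "representatives eqv S = (\<lambda>X. SOME x. x \<in> X) ` (S // {(x, y). x \<in> S \<and> y \<in> S \<and> eqv x y})"

definition index_series ::
    "('s \<Rightarrow> 's \<Rightarrow> bool) \<Rightarrow> ('s \<Rightarrow> 'p set) \<Rightarrow> ('s \<Rightarrow> 'p \<Rightarrow> wvar \<Rightarrow>\<^sub>0 nat) \<Rightarrow> 's set \<Rightarrow> (wvar, rat) mps"
  where
  "index_series eqv Aut w S =
     mps_sum (\<lambda>x. mps_term (1 / of_nat (card (Aut x))) 0 * (\<Sum>\<sigma>\<in>Aut x. mps_term 1 (w x \<sigma>)))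
       (representatives eqv S)"

definition Walsh :: "'v graph set \<Rightarrow> (wvar, rat) mps" where
  "Walsh \<G> = index_series graphs_isomorphic graph_Aut weight \<G>"

definition Walsh_pairs :: "('v graph \<times> 'v graph) set \<Rightarrow> (wvar, rat) mps" where
  "Walsh_pairs \<P> = index_series pairs_isomorphic pair_Aut (\<lambda>P. weight (fst P)) \<P>"

definition Walsh_plus :: "'v network set \<Rightarrow> (wvar, rat) mps" where
  "Walsh_plus \<N> = index_series networks_isomorphic Aut_plus weight_plus \<N>"

definition Walsh_minus :: "'v network set \<Rightarrow> (wvar, rat) mps" where
  "Walsh_minus \<N> = index_series networks_isomorphic Aut_minus weight_minus (tau_part \<N>)"

text \<open>The series $(W)_k$, obtained by multiplying all indices of variables by $k \<ge> 1$.\<close>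

definition dilate :: "nat \<Rightarrow> (wvar, rat) mps \<Rightarrow> (wvar, rat) mps" where
  "dilate k W = mps_subst W (\<lambda>x. case x of
       VA i \<Rightarrow> mps_var (VA (k * i))
     | VB i \<Rightarrow> mps_var (VB (k * i))
     | VC i \<Rightarrow> mps_var (VC (k * i)))"

end

theory Submission
  imports Defs
begin

text \<open>
  Both sides are sums over structures with an automorphism, and they are compared by a double count.
  Expanding the right-hand side gives one term for every core \<open>G\<close> with an automorphism \<open>\<sigma>\<close> and every
  choice, for each edge cycle of \<open>\<sigma>\<close>, of one network with a symmetry that fixes the poles if the
  cycle is cylindrical and exchanges them if it is a Moebius cycle.  Placing copies of the chosen
  network on all edges of its cycle yields a graph with core \<open>G\<close> and an automorphism (the twist)
  that extends \<open>\<sigma>\<close> and has the weight of the term.  Counted with the weights \<open>1 / card Aut\<close>, each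
  term is realized by exactly one pair with an automorphism, up to isomorphism: the isomorphisms
  onto the representative form a torsor.  Conversely, as \<open>N \<union> 01\<close> is 2-connected, the network on
  each core edge can be recovered from the pair alone, hence is permuted by every automorphism of
  the pair; so each pair with an automorphism arises from exactly one term, again counted with
  weights.
\<close>

section \<open>Power series given by weighted families of monomials\<close>

text \<open>The index shift of \<open>dilate\<close> reflects iteration. On a core cycle of length
  k, the k-th power of the automorphism acts on one network as its chosen symmetry, so a cycle of
  length j of that symmetry opens up into one of length jk, and an edge cycle keeps its type.
  Orientation is the obstacle: the ends of a core edge cannot be told apart, and around a Moebius
  cycle no orientation is compatible with the automorphism. Hence each cycle gets a root edge with a
  chosen order of its ends, carried along until the cycle closes, where a Moebius cycle reverses it.
  The networks of a pair are recovered only up to \<open>opposite\<close>, which is where symmetry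
  of the species enters. Representatives are arbitrary choices, so pairs and terms are linked
  through the matrix of the numbers of \<open>realizations\<close>: both sides agree because its two
  weighted marginals are 1, for a fixed term with weights 1/|Aut P| over the pairs, for a fixed pair
  with the coefficients of the terms. The denominators |Aut^-| fit since a nonempty Aut^- has the
  size of Aut^+.\<close>

definition series_of ::
    "'i set \<Rightarrow> ('i \<Rightarrow> 'a) \<Rightarrow> ('i \<Rightarrow> 'x \<Rightarrow>\<^sub>0 nat) \<Rightarrow> ('x, 'a :: comm_ring_1) mps" where
  "series_of I c w = Abs_mps (\<lambda>m. \<Sum>i | i \<in> I \<and> w i = m. c i)"

text \<open>An infinite fibre {i. w i = m} would silently contribute \<open>0\<close> to
  \<open>series_of\<close>, since \<open>sum\<close> over an infinite set is \<open>0\<close>. This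
  condition excludes such fibres.\<close>

definition locally_finite :: "'i set \<Rightarrow> ('i \<Rightarrow> 'x \<Rightarrow>\<^sub>0 nat) \<Rightarrow> bool" where
  "locally_finite I w \<longleftrightarrow> (\<forall>m. finite {i \<in> I. w i = m})"

lemma coeff_series_of [simp]:
  "mps_coeff (series_of I c w) m = (\<Sum>i | i \<in> I \<and> w i = m. c i)"
  by (simp add: series_of_def)

lemma locally_finiteD: "locally_finite I w \<Longrightarrow> finite {i \<in> I. w i = m}"
  by (simp add: locally_finite_def)

lemma locally_finite_finite: "finite I \<Longrightarrow> locally_finite I w"
  by (simp add: locally_finite_def)

lemma series_of_cong:
  assumes "I = I'" "\<And>i. i \<in> I' \<Longrightarrow> c i = c' i" "\<And>i. i \<in> I' \<Longrightarrow> w i = w' i"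
  shows "series_of I c w = series_of I' c' w'"
  by (rule mps_eqI) (auto intro!: sum.cong simp: assms)

lemma series_of_reindex:
  assumes "bij_betw h I I'"
  shows "series_of I' c w = series_of I (c \<circ> h) (w \<circ> h)"
proof (rule mps_eqI)
  fix m
  have "bij_betw h {i \<in> I. w (h i) = m} {i \<in> I'. w i = m}"
    using assms by (auto simp: bij_betw_def inj_on_def)
  from sum.reindex_bij_betw[OF this, of c]
  show "mps_coeff (series_of I' c w) m = mps_coeff (series_of I (c \<circ> h) (w \<circ> h)) m"
    by simp
qed

lemma locally_finite_reindex:
  assumes "bij_betw h I I'"
  shows "locally_finite I' w \<longleftrightarrow> locally_finite I (w \<circ> h)"
proof -
  have "bij_betw h {i \<in> I. w (h i) = m} {i \<in> I'. w i = m}" for m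
    using assms by (auto simp: bij_betw_def inj_on_def)
  then show ?thesis
    by (auto simp: locally_finite_def dest: bij_betw_finite)
qed

text \<open>Flattens a sum of series into one series over pairs of indices. \<open>mps_sum\<close>
  adds only the members with a nonzero coefficient at m; these lie among the first components of the
  finitely many pairs of weight m, and the remaining first components add 0.\<close>

lemma mps_sum_series_of:
  assumes lf: "locally_finite (Sigma R J) (\<lambda>(x, j). w x j)"
    and f: "\<And>x. x \<in> R \<Longrightarrow> f x = series_of (J x) (c x) (w x)"
  shows "mps_sum f R = series_of (Sigma R J) (\<lambda>(x, j). c x j) (\<lambda>(x, j). w x j)"
proof (rule mps_eqI)
  fix m
  let ?T = "{z \<in> Sigma R J. (\<lambda>(x, j). w x j) z = m}"
  have T: "finite ?T" using lf by (rule locally_finiteD)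
  have fin: "finite (fst ` ?T)" using T by simp
  have coeff: "mps_coeff (f x) m = (\<Sum>j | j \<in> J x \<and> w x j = m. c x j)" if "x \<in> R" for x
    using f[OF that] by simp
  have sub: "{x \<in> R. mps_coeff (f x) m \<noteq> 0} \<subseteq> fst ` ?T"
  proof safe
    fix x assume x: "x \<in> R" "mps_coeff (f x) m \<noteq> 0"
    then obtain j where "j \<in> J x" "w x j = m"
      by (metis (mono_tags, lifting) coeff mem_Collect_eq sum.not_neutral_contains_not_neutral)
    with x show "x \<in> fst ` ?T" by (force intro!: image_eqI[of _ _ "(x, j)"])
  qed
  have fJ: "finite {j. j \<in> J x \<and> w x j = m}" if "x \<in> R" for x
  proof -
    have "{j. j \<in> J x \<and> w x j = m} \<subseteq> snd ` ?T" using that by force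
    then show ?thesis using T by (meson finite_imageI finite_subset)
  qed
  have "mps_coeff (mps_sum f R) m = (\<Sum>x | x \<in> R \<and> mps_coeff (f x) m \<noteq> 0. mps_coeff (f x) m)"
    by (simp add: mps_sum_def)
  also have "\<dots> = (\<Sum>x\<in>fst ` ?T. mps_coeff (f x) m)"
    by (rule sum.mono_neutral_left[OF fin sub]) auto
  also have "\<dots> = (\<Sum>x\<in>fst ` ?T. \<Sum>j | j \<in> J x \<and> w x j = m. c x j)"
    by (intro sum.cong refl coeff) auto
  also have "\<dots> = (\<Sum>(x, j)\<in>Sigma (fst ` ?T) (\<lambda>x. {j. j \<in> J x \<and> w x j = m}). c x j)"
    by (rule sum.Sigma[OF fin]) (use fJ in auto)
  also have "Sigma (fst ` ?T) (\<lambda>x. {j. j \<in> J x \<and> w x j = m}) = ?T"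
    by force
  finally show "mps_coeff (mps_sum f R) m
      = mps_coeff (series_of (Sigma R J) (\<lambda>(x, j). c x j) (\<lambda>(x, j). w x j)) m"
    by (simp add: case_prod_beta)
qed

lemma locally_finite_times:
  assumes "locally_finite I w" "locally_finite J v"
  shows "locally_finite (I \<times> J) (\<lambda>(i, j). w i + v j)"
  unfolding locally_finite_def
proof
  fix m
  have "{z \<in> I \<times> J. (\<lambda>(i, j). w i + v j) z = m}
      = (\<Union>(p, q)\<in>{(p, q). p + q = m}. {i \<in> I. w i = p} \<times> {j \<in> J. v j = q})"
    by auto
  then show "finite {z \<in> I \<times> J. (\<lambda>(i, j). w i + v j) z = m}"
    using assms by (auto simp: finite_monomial_splits locally_finite_def)
qed

text \<open>A monomial m has finitely many splittings into two monomials, and each splitting has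
  finite fibres in I and J. These products of fibres are disjoint, so the double sum becomes one sum
  over pairs of indices.\<close>

lemma series_of_times:
  assumes "locally_finite I w" "locally_finite J v"
  shows "series_of I c w * series_of J d v
    = series_of (I \<times> J) (\<lambda>(i, j). c i * d j) (\<lambda>(i, j). w i + v j)"
proof (rule mps_eqI)
  fix m :: "'b \<Rightarrow>\<^sub>0 nat"
  let ?S = "{(p, q). p + q = m}"
  have "mps_coeff (series_of I c w * series_of J d v) m
      = (\<Sum>(p, q)\<in>?S. \<Sum>z\<in>{i \<in> I. w i = p} \<times> {j \<in> J. v j = q}. c (fst z) * d (snd z))"
    by (simp add: times_mps.rep_eq sum_product sum.cartesian_product case_prod_beta)
  also have "\<dots> = (\<Sum>z\<in>(\<Union>(p, q)\<in>?S. {i \<in> I. w i = p} \<times> {j \<in> J. v j = q}). c (fst z) * d (snd z))"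
    using assms unfolding case_prod_beta
    by (subst sum.UNION_disjoint)
      (use finite_monomial_splits[of m] in \<open>auto simp: locally_finite_def case_prod_unfold\<close>)
  also have "(\<Union>(p, q)\<in>?S. {i \<in> I. w i = p} \<times> {j \<in> J. v j = q})
      = {z. z \<in> I \<times> J \<and> (case z of (i, j) \<Rightarrow> w i + v j) = m}"
    by auto
  finally show "mps_coeff (series_of I c w * series_of J d v) m
      = mps_coeff (series_of (I \<times> J) (\<lambda>(i, j). c i * d j) (\<lambda>(i, j). w i + v j)) m"
    by (simp add: case_prod_beta)
qed

lemma bij_betw_PiE_insert:
  assumes "a \<notin> K"
  shows "bij_betw (\<lambda>(j, \<nu>). \<nu>(a := j)) (J a \<times> PiE K J) (PiE (insert a K) J)"
  unfolding bij_betw_def PiE_insert_eq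
  by (intro conjI inj_combinator assms) (auto simp: case_prod_beta)

text \<open>Distributivity: expanding the product chooses one term in every factor, so the index set
  consists of dependent functions. Local finiteness is part of the conclusion because the induction
  step multiplies by the product already formed.\<close>

lemma prod_series_of:
  fixes J :: "'k \<Rightarrow> 'i set" and c :: "'k \<Rightarrow> 'i \<Rightarrow> 'a :: comm_ring_1"
    and w :: "'k \<Rightarrow> 'i \<Rightarrow> 'x \<Rightarrow>\<^sub>0 nat"
  assumes "finite K" "\<And>k. k \<in> K \<Longrightarrow> locally_finite (J k) (w k)"
  shows "(\<Prod>k\<in>K. series_of (J k) (c k) (w k))
      = series_of (PiE K J) (\<lambda>\<nu>. \<Prod>k\<in>K. c k (\<nu> k)) (\<lambda>\<nu>. \<Sum>k\<in>K. w k (\<nu> k))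
    \<and> locally_finite (PiE K J) (\<lambda>\<nu>. \<Sum>k\<in>K. w k (\<nu> k))"
  using assms
proof (induction K rule: finite_induct)
  case empty
  have "(1 :: ('x, 'a) mps) = series_of (PiE {} J) (\<lambda>\<nu>. 1) (\<lambda>\<nu>. 0)"
  proof (rule mps_eqI)
    fix m :: "'x \<Rightarrow>\<^sub>0 nat"
    have "{i. i \<in> PiE {} J \<and> 0 = m} = (if m = 0 then {\<lambda>_. undefined} else {})"
      by auto
    then show "mps_coeff (1 :: ('x, 'a) mps) m = mps_coeff (series_of (PiE {} J) (\<lambda>\<nu>. 1) (\<lambda>\<nu>. 0)) m"
      by (simp add: one_mps.rep_eq)
  qed
  then show ?case by (simp add: locally_finite_finite)
next
  case (insert a K)
  let ?h = "\<lambda>(j, \<nu>). \<nu>(a := j)"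
  let ?c = "\<lambda>\<nu>. \<Prod>k\<in>insert a K. c k (\<nu> k)" and ?w = "\<lambda>\<nu>. \<Sum>k\<in>insert a K. w k (\<nu> k)"
  have IH: "(\<Prod>k\<in>K. series_of (J k) (c k) (w k))
      = series_of (PiE K J) (\<lambda>\<nu>. \<Prod>k\<in>K. c k (\<nu> k)) (\<lambda>\<nu>. \<Sum>k\<in>K. w k (\<nu> k))"
    "locally_finite (PiE K J) (\<lambda>\<nu>. \<Sum>k\<in>K. w k (\<nu> k))" "locally_finite (J a) (w a)"
    using insert by auto
  note bij = bij_betw_PiE_insert[OF insert.hyps(2), of J]
  have cw: "?c (?h z) = (case z of (j, \<nu>) \<Rightarrow> c a j * (\<Prod>k\<in>K. c k (\<nu> k)))"
    "?w (?h z) = (case z of (j, \<nu>) \<Rightarrow> w a j + (\<Sum>k\<in>K. w k (\<nu> k)))" for z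
    using insert.hyps by (auto simp: case_prod_beta intro!: prod.cong sum.cong arg_cong[of _ _ "times _"]
        arg_cong[of _ _ "plus _"])
  have "(\<Prod>k\<in>insert a K. series_of (J k) (c k) (w k))
      = series_of (J a) (c a) (w a) * series_of (PiE K J) (\<lambda>\<nu>. \<Prod>k\<in>K. c k (\<nu> k)) (\<lambda>\<nu>. \<Sum>k\<in>K. w k (\<nu> k))"
    using insert.hyps IH by simp
  also have "\<dots> = series_of (J a \<times> PiE K J) (?c \<circ> ?h) (?w \<circ> ?h)"
    unfolding series_of_times[OF IH(3,2)] by (rule series_of_cong) (simp_all only: cw o_apply)
  also have "\<dots> = series_of (PiE (insert a K) J) ?c ?w"
    by (rule series_of_reindex[OF bij, symmetric])
  finally have "(\<Prod>k\<in>insert a K. series_of (J k) (c k) (w k)) = series_of (PiE (insert a K) J) ?c ?w" .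
  moreover have "locally_finite (PiE (insert a K) J) ?w"
    using locally_finite_times[OF IH(3,2)]
    unfolding locally_finite_reindex[OF bij] o_def cw .
  ultimately show ?case by blast
qed

section \<open>Substitution into a series, monomial by monomial\<close>

definition eval_monomial :: "('x \<Rightarrow> ('y, 'a :: comm_ring_1) mps) \<Rightarrow> ('x \<Rightarrow>\<^sub>0 nat) \<Rightarrow> ('y, 'a) mps" where
  "eval_monomial f p = (\<Prod>x\<in>Poly_Mapping.keys p. f x ^ Poly_Mapping.lookup p x)"

lemma coeff_mps_term [simp]: "mps_coeff (mps_term a p) m = (if m = p then a else 0)"
  by (simp add: mps_term_def)

lemma coeff_mps_term_times [simp]: "mps_coeff (mps_term a 0 * f) m = a * mps_coeff f m"
proof -
  have "mps_coeff (mps_term a 0 * f) m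
      = (\<Sum>z\<in>{(u, v). u + v = m}. if z = (0, m) then a * mps_coeff f m else 0)"
    unfolding times_mps.rep_eq by (rule sum.cong) (auto split: if_splits)
  also have "\<dots> = a * mps_coeff f m"
    by (subst sum.delta) (auto simp: finite_monomial_splits)
  finally show ?thesis .
qed

lemma mps_term_eq_series_of: "mps_term a p = series_of {()} (\<lambda>_. a) (\<lambda>_. p)"
proof (rule mps_eqI)
  fix m
  have "{i. i = () \<and> p = m} = (if m = p then {()} else {})" by auto
  then show "mps_coeff (mps_term a p) m = mps_coeff (series_of {()} (\<lambda>_. a) (\<lambda>_. p)) m" by simp
qed

lemma mps_term_times_series_of:
  assumes "locally_finite I w"
  shows "mps_term a p * series_of I c w = series_of I (\<lambda>i. a * c i) (\<lambda>i. p + w i)"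
    and "locally_finite I (\<lambda>i. p + w i)"
proof -
  have bij: "bij_betw (\<lambda>i. ((), i)) I ({()} \<times> I)" by (auto simp: bij_betw_def inj_on_def)
  show "mps_term a p * series_of I c w = series_of I (\<lambda>i. a * c i) (\<lambda>i. p + w i)"
    unfolding mps_term_eq_series_of
    by (subst series_of_times) (simp_all add: assms locally_finite_finite series_of_reindex[OF bij] o_def)
  show "locally_finite I (\<lambda>i. p + w i)"
    using locally_finite_times[OF locally_finite_finite assms, of "{()}" "\<lambda>_. p"]
    unfolding locally_finite_reindex[OF bij] by (simp add: o_def)
qed

lemma mps_term_times: "mps_term a p * mps_term b q = mps_term (a * b) (p + q)"
  unfolding mps_term_eq_series_of[of b]
  by (subst mps_term_times_series_of) (simp_all add: locally_finite_finite mps_term_eq_series_of)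

lemma mps_term_1_0: "mps_term 1 0 = (1 :: ('x, 'a :: comm_ring_1) mps)"
  by (rule mps_eqI) (simp add: one_mps.rep_eq)

lemma prod_mps_term: "(\<Prod>i\<in>A. mps_term 1 (p i)) = mps_term (1 :: 'a :: comm_ring_1) (\<Sum>i\<in>A. p i)"
  by (induction A rule: infinite_finite_induct) (simp_all add: mps_term_1_0 mps_term_times)

lemma mps_var_power: "mps_term 1 (Poly_Mapping.single x 1) ^ n
    = mps_term (1 :: 'a :: comm_ring_1) (Poly_Mapping.single x n)"
  by (induction n) (simp_all add: mps_term_1_0 mps_term_times flip: single_add)

lemma eval_monomial_superset:
  assumes "finite A" "Poly_Mapping.keys p \<subseteq> A"
  shows "eval_monomial f p = (\<Prod>x\<in>A. f x ^ Poly_Mapping.lookup p x)"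
  unfolding eval_monomial_def
  by (rule prod.mono_neutral_left) (use assms in \<open>auto simp: in_keys_iff\<close>)

lemma eval_monomial_0 [simp]: "eval_monomial f 0 = 1"
  by (simp add: eval_monomial_def)

lemma eval_monomial_single [simp]: "eval_monomial f (Poly_Mapping.single x 1) = f x"
  by (simp add: eval_monomial_def)

lemma eval_monomial_add: "eval_monomial f (p + q) = eval_monomial f p * eval_monomial f q"
proof -
  let ?A = "Poly_Mapping.keys p \<union> Poly_Mapping.keys q"
  have "eval_monomial f r = (\<Prod>x\<in>?A. f x ^ Poly_Mapping.lookup r x)" if "Poly_Mapping.keys r \<subseteq> ?A" for r
    by (rule eval_monomial_superset) (use that in auto)
  moreover have "Poly_Mapping.keys (p + q) \<subseteq> ?A" by (rule Poly_Mapping.keys_add)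
  ultimately show ?thesis
    by (simp add: lookup_add power_add prod.distrib)
qed

lemma eval_monomial_sum: "eval_monomial f (\<Sum>i\<in>A. p i) = (\<Prod>i\<in>A. eval_monomial f (p i))"
  by (induction A rule: infinite_finite_induct) (simp_all add: eval_monomial_add)

text \<open>\<open>mps_subst\<close> runs over all monomials p, the given series over indices i;
  grouping \<open>Sigma I J\<close> by p = w i reconciles the two. A monomial that is no w i has
  coefficient 0 and an empty group, so the values of F need to be known only on the monomials w
  i.\<close>

lemma mps_subst_series_of:
  assumes lfI: "locally_finite I w"
    and lf: "locally_finite (Sigma I J) (\<lambda>(i, j). v i j)"
    and F: "\<And>i. i \<in> I \<Longrightarrow> eval_monomial F (w i) = series_of (J i) (d i) (v i)"
  shows "mps_subst (series_of I c w) F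
    = series_of (Sigma I J) (\<lambda>(i, j). c i * d i j) (\<lambda>(i, j). v i j)"
proof -
  define J' where "J' p = Sigma {i \<in> I. w i = p} J" for p
  define c' where "c' p = (\<lambda>(i, j). c i * d i j)" for p :: "'b \<Rightarrow>\<^sub>0 nat"
  define v' where "v' p = (\<lambda>(i, j). v i j)" for p :: "'b \<Rightarrow>\<^sub>0 nat"
  have bij: "bij_betw (\<lambda>(i, j). (w i, (i, j))) (Sigma I J) (Sigma UNIV J')"
    by (auto simp: bij_betw_def inj_on_def J'_def)
  have lf': "locally_finite (Sigma UNIV J') (\<lambda>(p, z). v' p z)"
    unfolding locally_finite_reindex[OF bij] using lf by (simp add: v'_def o_def case_prod_unfold)
  have fJ: "finite {j \<in> J i. v i j = m}" if "i \<in> I" for i m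
  proof -
    have "{j \<in> J i. v i j = m} \<subseteq> snd ` {z \<in> Sigma I J. (\<lambda>(i, j). v i j) z = m}" using that by force
    then show ?thesis using locally_finiteD[OF lf] by (meson finite_imageI finite_subset)
  qed
  have "mps_subst (series_of I c w) F
      = mps_sum (\<lambda>p. mps_term (mps_coeff (series_of I c w) p) 0 * eval_monomial F p) UNIV"
    by (simp add: mps_subst_def eval_monomial_def)
  also have "\<dots> = series_of (Sigma UNIV J') (\<lambda>(p, z). c' p z) (\<lambda>(p, z). v' p z)"
  proof (rule mps_sum_series_of[OF lf'])
    fix p
    show "mps_term (mps_coeff (series_of I c w) p) 0 * eval_monomial F p = series_of (J' p) (c' p) (v' p)"
    proof (rule mps_eqI)
      fix m
      have "mps_coeff (mps_term (mps_coeff (series_of I c w) p) 0 * eval_monomial F p) m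
          = (\<Sum>i | i \<in> I \<and> w i = p. c i * mps_coeff (eval_monomial F p) m)"
        by (simp add: sum_distrib_right)
      also have "\<dots> = (\<Sum>i | i \<in> I \<and> w i = p. \<Sum>j | j \<in> J i \<and> v i j = m. c i * d i j)"
        by (rule sum.cong) (use F in \<open>auto simp: sum_distrib_left\<close>)
      also have "\<dots> = (\<Sum>(i, j)\<in>(SIGMA i:{i. i \<in> I \<and> w i = p}. {j. j \<in> J i \<and> v i j = m}). c i * d i j)"
        by (rule sum.Sigma) (use locally_finiteD[OF lfI] fJ in auto)
      also have "(SIGMA i:{i. i \<in> I \<and> w i = p}. {j. j \<in> J i \<and> v i j = m}) = {z. z \<in> J' p \<and> v' p z = m}"
        by (auto simp: J'_def v'_def)
      finally show "mps_coeff (mps_term (mps_coeff (series_of I c w) p) 0 * eval_monomial F p) m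
          = mps_coeff (series_of (J' p) (c' p) (v' p)) m"
        by (simp add: c'_def)
    qed
  qed
  also have "\<dots> = series_of (Sigma I J) (\<lambda>(i, j). c i * d i j) (\<lambda>(i, j). v i j)"
    by (subst series_of_reindex[OF bij]) (simp add: o_def c'_def v'_def case_prod_unfold)
  finally show ?thesis .
qed

lemma mps_coeff_sum: "mps_coeff (\<Sum>i\<in>A. f i) m = (\<Sum>i\<in>A. mps_coeff (f i) m)"
  by (induction A rule: infinite_finite_induct) (simp_all add: plus_mps.rep_eq zero_mps.rep_eq)

text \<open>The factor 1/|Aut| of a structure is distributed over its automorphisms, so that an
  index series becomes one series indexed by structures with an automorphism.\<close>

lemma index_series_eq_series_of:
  assumes fin: "\<And>x. x \<in> representatives eqv S \<Longrightarrow> finite (Aut x)"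
    and lf: "locally_finite (Sigma (representatives eqv S) Aut) (\<lambda>(x, \<sigma>). w x \<sigma>)"
  shows "index_series eqv Aut w S = series_of (Sigma (representatives eqv S) Aut)
      (\<lambda>(x, \<sigma>). 1 / of_nat (card (Aut x))) (\<lambda>(x, \<sigma>). w x \<sigma>)"
  unfolding index_series_def
proof (rule mps_sum_series_of[OF lf])
  fix x assume x: "x \<in> representatives eqv S"
  show "mps_term (1 / of_nat (card (Aut x))) 0 * (\<Sum>\<sigma>\<in>Aut x. mps_term 1 (w x \<sigma>))
      = series_of (Aut x) (\<lambda>\<sigma>. 1 / of_nat (card (Aut x)) :: rat) (w x)"
  proof (rule mps_eqI)
    fix m
    have "(\<Sum>\<sigma>\<in>Aut x. if m = w x \<sigma> then 1 else (0::rat)) = (\<Sum>\<sigma> | \<sigma> \<in> Aut x \<and> w x \<sigma> = m. 1)"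
      using fin[OF x] by (subst sum.inter_filter[symmetric]) (auto intro!: arg_cong[of _ _ card])
    then show "mps_coeff (mps_term (1 / of_nat (card (Aut x)) :: rat) 0 * (\<Sum>\<sigma>\<in>Aut x. mps_term 1 (w x \<sigma>))) m
      = mps_coeff (series_of (Aut x) (\<lambda>\<sigma>. 1 / of_nat (card (Aut x)) :: rat) (w x)) m"
      by (simp add: mps_coeff_sum)
  qed
qed

section \<open>Dilation and vertex degree of Walsh monomials\<close>

fun scale_var :: "nat \<Rightarrow> wvar \<Rightarrow> wvar" where
  "scale_var k (VA i) = VA (k * i)"
| "scale_var k (VB i) = VB (k * i)"
| "scale_var k (VC i) = VC (k * i)"

definition dilate_monomial :: "nat \<Rightarrow> (wvar \<Rightarrow>\<^sub>0 nat) \<Rightarrow> (wvar \<Rightarrow>\<^sub>0 nat)" where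
  "dilate_monomial k p =
     (\<Sum>x\<in>Poly_Mapping.keys p. Poly_Mapping.single (scale_var k x) (Poly_Mapping.lookup p x))"

text \<open>The grading with a_k in degree k and the edge variables in degree 0: the degree of a
  weight is then the number of vertices, and finitely many isomorphism classes share that
  number.\<close>

fun var_degree :: "wvar \<Rightarrow> nat" where
  "var_degree (VA k) = k"
| "var_degree _ = 0"

definition vertex_degree :: "(wvar \<Rightarrow>\<^sub>0 nat) \<Rightarrow> nat" where
  "vertex_degree p = (\<Sum>x\<in>Poly_Mapping.keys p. Poly_Mapping.lookup p x * var_degree x)"

lemma sum_keys_superset:
  assumes "finite A" "Poly_Mapping.keys p \<subseteq> A" "\<And>x. g x 0 = 0"
  shows "(\<Sum>x\<in>Poly_Mapping.keys p. g x (Poly_Mapping.lookup p x)) = (\<Sum>x\<in>A. g x (Poly_Mapping.lookup p x))"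
  by (rule sum.mono_neutral_left) (use assms in \<open>auto simp: in_keys_iff\<close>)

lemma sum_keys_add:
  fixes p q :: "'x \<Rightarrow>\<^sub>0 nat"
  assumes "\<And>x. g x 0 = 0" "\<And>x a b. g x (a + b) = g x a + g x b"
  shows "(\<Sum>x\<in>Poly_Mapping.keys (p + q). g x (Poly_Mapping.lookup (p + q) x))
    = (\<Sum>x\<in>Poly_Mapping.keys p. g x (Poly_Mapping.lookup p x))
      + (\<Sum>x\<in>Poly_Mapping.keys q. g x (Poly_Mapping.lookup q x))"
proof -
  let ?A = "Poly_Mapping.keys p \<union> Poly_Mapping.keys q"
  have "(\<Sum>x\<in>Poly_Mapping.keys r. g x (Poly_Mapping.lookup r x)) = (\<Sum>x\<in>?A. g x (Poly_Mapping.lookup r x))"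
    if "Poly_Mapping.keys r \<subseteq> ?A" for r
    by (rule sum_keys_superset) (use that assms in auto)
  moreover have "Poly_Mapping.keys (p + q) \<subseteq> ?A" by (rule Poly_Mapping.keys_add)
  ultimately have "(\<Sum>x\<in>Poly_Mapping.keys (p + q). g x (Poly_Mapping.lookup (p + q) x))
      = (\<Sum>x\<in>?A. g x (Poly_Mapping.lookup (p + q) x))"
    and "(\<Sum>x\<in>Poly_Mapping.keys p. g x (Poly_Mapping.lookup p x)) = (\<Sum>x\<in>?A. g x (Poly_Mapping.lookup p x))"
    and "(\<Sum>x\<in>Poly_Mapping.keys q. g x (Poly_Mapping.lookup q x)) = (\<Sum>x\<in>?A. g x (Poly_Mapping.lookup q x))"
    by simp_all
  then show ?thesis
    by (simp only: lookup_add assms sum.distrib)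
qed

lemma dilate_monomial_add: "dilate_monomial k (p + q) = dilate_monomial k p + dilate_monomial k q"
  unfolding dilate_monomial_def by (rule sum_keys_add) (simp_all add: single_add)

lemma dilate_monomial_0 [simp]: "dilate_monomial k 0 = 0"
  by (simp add: dilate_monomial_def)

lemma dilate_monomial_sum: "dilate_monomial k (\<Sum>i\<in>A. p i) = (\<Sum>i\<in>A. dilate_monomial k (p i))"
  by (induction A rule: infinite_finite_induct) (simp_all add: dilate_monomial_add)

lemma dilate_monomial_single [simp]:
  "dilate_monomial k (Poly_Mapping.single x n) = Poly_Mapping.single (scale_var k x) n"
  by (simp add: dilate_monomial_def)

lemma vertex_degree_add: "vertex_degree (p + q) = vertex_degree p + vertex_degree q"
  unfolding vertex_degree_def by (rule sum_keys_add) (simp_all add: algebra_simps)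

lemma vertex_degree_0 [simp]: "vertex_degree 0 = 0"
  by (simp add: vertex_degree_def)

lemma vertex_degree_sum: "vertex_degree (\<Sum>i\<in>A. p i) = (\<Sum>i\<in>A. vertex_degree (p i))"
  by (induction A rule: infinite_finite_induct) (simp_all add: vertex_degree_add)

lemma vertex_degree_single [simp]:
  "vertex_degree (Poly_Mapping.single x n) = n * var_degree x"
  by (simp add: vertex_degree_def)

lemma var_degree_scale_var [simp]: "var_degree (scale_var k x) = k * var_degree x"
  by (cases x) simp_all

lemma vertex_degree_dilate_monomial [simp]:
  "vertex_degree (dilate_monomial k p) = k * vertex_degree p"
  by (simp add: dilate_monomial_def vertex_degree_sum vertex_degree_def[of p] sum_distrib_left
      algebra_simps)

text \<open>Stronger than local finiteness, and passed on to dilated monomials for k > 0 simply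
  because dilation multiplies the degree by k; injectivity of dilation on monomials never has to be
  discussed.\<close>

definition degreewise_finite :: "'i set \<Rightarrow> ('i \<Rightarrow> wvar \<Rightarrow>\<^sub>0 nat) \<Rightarrow> bool" where
  "degreewise_finite I w \<longleftrightarrow> (\<forall>n. finite {i \<in> I. vertex_degree (w i) = n})"

lemma degreewise_finite_imp_locally_finite: "degreewise_finite I w \<Longrightarrow> locally_finite I w"
  unfolding degreewise_finite_def locally_finite_def
proof
  fix m
  assume "\<forall>n. finite {i \<in> I. vertex_degree (w i) = n}"
  then have "finite {i \<in> I. vertex_degree (w i) = vertex_degree m}" by blast
  then show "finite {i \<in> I. w i = m}" by (rule rev_finite_subset) auto
qed

lemma degreewise_finite_dilate:
  assumes "degreewise_finite I w" "k > 0"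
  shows "degreewise_finite I (\<lambda>i. dilate_monomial k (w i))"
  unfolding degreewise_finite_def
proof
  fix n
  have "{i \<in> I. vertex_degree (dilate_monomial k (w i)) = n} \<subseteq> {i \<in> I. vertex_degree (w i) = n div k}"
    using assms(2) by auto
  then show "finite {i \<in> I. vertex_degree (dilate_monomial k (w i)) = n}"
    using assms(1) by (auto simp: degreewise_finite_def intro: finite_subset)
qed

text \<open>The substitution sends each monomial to a single monomial, so every inner index set is a
  singleton. The condition k > 0 keeps the result locally finite; for k = 0 all variables of one
  kind would collapse into one.\<close>

lemma dilate_series_of:
  assumes "degreewise_finite I w" "k > 0"
  shows "dilate k (series_of I c w) = series_of I c (\<lambda>i. dilate_monomial k (w i))"
proof -
  let ?F = "\<lambda>x. case x of
       VA i \<Rightarrow> mps_var (VA (k * i))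
     | VB i \<Rightarrow> mps_var (VB (k * i))
     | VC i \<Rightarrow> mps_var (VC (k * i))"
  have F: "?F x = mps_term 1 (Poly_Mapping.single (scale_var k x) 1)" for x
    by (cases x) simp_all
  have ev: "eval_monomial ?F p = series_of {()} (\<lambda>_. 1) (\<lambda>_. dilate_monomial k p)" for p
    unfolding eval_monomial_def F mps_var_power prod_mps_term dilate_monomial_def
    by (rule mps_term_eq_series_of)
  have lf: "locally_finite I (\<lambda>i. dilate_monomial k (w i))"
    by (intro degreewise_finite_imp_locally_finite degreewise_finite_dilate assms)
  have bij: "bij_betw (\<lambda>i. (i, ())) I (I \<times> {()})" by (auto simp: bij_betw_def inj_on_def)
  have "dilate k (series_of I c w)
      = series_of (I \<times> {()}) (\<lambda>(i, j). c i * 1) (\<lambda>(i, j). dilate_monomial k (w i))"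
    unfolding dilate_def
    by (rule mps_subst_series_of[OF degreewise_finite_imp_locally_finite[OF assms(1)] _ ev])
      (use lf in \<open>simp add: locally_finite_reindex[OF bij] o_def\<close>)
  then show ?thesis by (simp add: series_of_reindex[OF bij] o_def)
qed

section \<open>Cycles of permutations\<close>

lemma funpow_image: "(image (f :: 'a \<Rightarrow> 'a) ^^ n) A = (f ^^ n) ` A"
  by (induction n) (simp_all add: image_comp)

lemma funpow_in: "(f :: 'a \<Rightarrow> 'a) ` A \<subseteq> A \<Longrightarrow> x \<in> A \<Longrightarrow> (f ^^ n) x \<in> A"
  by (induction n) auto

lemma funpow_funpow: "(f ^^ m) ((f ^^ n) x) = (f ^^ (m + n)) x" for f :: "'a \<Rightarrow> 'a"
  by (simp add: funpow_add)

lemma inj_on_funpow: "bij_betw (f :: 'a \<Rightarrow> 'a) A A \<Longrightarrow> inj_on (f ^^ n) A"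
  using bij_betw_funpow bij_betw_def by blast

lemma orbit_subset_invariant: "f ` A \<subseteq> A \<Longrightarrow> x \<in> A \<Longrightarrow> orbit f x \<subseteq> A"
  by (auto simp: orbit_altdef funpow_in)

text \<open>Induction on q: h intertwines \<tau> with the l-th power of f on B, hence also their
  powers.\<close>

lemma funpow_return:
  fixes f :: "'a \<Rightarrow> 'a" and \<tau> :: "'b \<Rightarrow> 'b"
  assumes ret: "\<And>u. u \<in> B \<Longrightarrow> (f ^^ l) (h u) = h (\<tau> u)" and "\<tau> ` B \<subseteq> B" "u \<in> B"
  shows "(f ^^ (l * q)) (h u) = h ((\<tau> ^^ q) u)"
  using assms(3)
proof (induction q arbitrary: u)
  case (Suc q)
  have "(f ^^ (l * Suc q)) (h u) = (f ^^ (l * q)) (h (\<tau> u))"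
    using Suc.prems by (simp add: funpow_add ret add.commute[of l] del: funpow.simps)
  also have "\<dots> = h ((\<tau> ^^ q) (\<tau> u))" using Suc assms(2) by blast
  finally show ?case by (simp add: funpow_swap1)
qed simp

text \<open>\<open>orbit f x\<close> collects the iterates with positive exponent only, so x itself
  has to return. By the pigeonhole principle two iterates coincide, and injectivity cancels the
  smaller exponent.\<close>

lemma self_in_orbit_bij:
  assumes "finite A" "bij_betw f A A" "x \<in> A"
  shows "x \<in> orbit f x"
proof -
  have fA: "f ` A \<subseteq> A" using assms(2) by (simp add: bij_betw_def)
  have "\<not> inj (\<lambda>n. (f ^^ n) x)"
  proof
    assume "inj (\<lambda>n. (f ^^ n) x)"
    moreover have "range (\<lambda>n. (f ^^ n) x) \<subseteq> A" using funpow_in[OF fA assms(3)] by auto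
    ultimately show False using assms(1) by (meson finite_subset infinite_UNIV_nat finite_imageD)
  qed
  then obtain n m where nm: "n < m" "(f ^^ n) x = (f ^^ m) x"
    unfolding inj_def by (metis linorder_neqE_nat)
  then have "(f ^^ n) x = (f ^^ n) ((f ^^ (m - n)) x)"
    by (metis add_diff_inverse_nat comp_apply funpow_add less_imp_le not_le)
  then have "x = (f ^^ (m - n)) x"
    using inj_on_funpow[OF assms(2)] assms(3) funpow_in[OF fA assms(3)] by (meson inj_onD)
  then show ?thesis using nm(1) by (auto simp: orbit_altdef intro!: exI[of _ "m - n"])
qed

lemma orbit_eq_if_mem: "x \<in> orbit f x \<Longrightarrow> y \<in> orbit f x \<Longrightarrow> orbit f y = orbit f x"
  by (metis cyclic_on_singleI orbit_cyclic_eq3)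

lemma card_orbit_funpow:
  assumes "x \<in> orbit f x"
  shows "(f ^^ card (orbit f x)) x = x"
    and "orbit f x = (\<lambda>i. (f ^^ i) x) ` {..<card (orbit f x)}"
    and "inj_on (\<lambda>i. (f ^^ i) x) {..<card (orbit f x)}"
    and "card (orbit f x) > 0"
proof -
  have "card (orbit f x) = funpow_dist1 f x x"
    using card_image[OF inj_on_funpow_dist1[OF assms]] orbit_conv_funpow_dist1[OF assms] by simp
  then show "(f ^^ card (orbit f x)) x = x"
    "orbit f x = (\<lambda>i. (f ^^ i) x) ` {..<card (orbit f x)}"
    "inj_on (\<lambda>i. (f ^^ i) x) {..<card (orbit f x)}" "card (orbit f x) > 0"
    using funpow_dist1_prop[OF assms] orbit_conv_funpow_dist1[OF assms] inj_on_funpow_dist1[OF assms]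
    by (simp_all only: atLeast0LessThan)
qed

text \<open>Invariance keeps every cycle inside its piece, so cycles from disjoint pieces are
  different and a sum over cycles splits. The weight of a glued graph is cut up this way.\<close>

lemma sum_orbits_UN:
  assumes "finite K" "\<And>k. k \<in> K \<Longrightarrow> finite (A k)"
    and "\<And>k. k \<in> K \<Longrightarrow> f ` A k \<subseteq> A k"
    and "\<And>k x. k \<in> K \<Longrightarrow> x \<in> A k \<Longrightarrow> x \<in> orbit f x"
    and "\<And>k k'. k \<in> K \<Longrightarrow> k' \<in> K \<Longrightarrow> k \<noteq> k' \<Longrightarrow> A k \<inter> A k' = {}"
  shows "sum F (orbit f ` (\<Union>k\<in>K. A k)) = (\<Sum>k\<in>K. sum F (orbit f ` A k))"
  unfolding image_UN
proof (rule sum.UNION_disjoint)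
  show "\<forall>k\<in>K. \<forall>k'\<in>K. k \<noteq> k' \<longrightarrow> orbit f ` A k \<inter> orbit f ` A k' = {}"
  proof (intro ballI impI, rule ccontr)
    fix k k' assume k: "k \<in> K" "k' \<in> K" "k \<noteq> k'" "orbit f ` A k \<inter> orbit f ` A k' \<noteq> {}"
    then obtain x y where xy: "x \<in> A k" "y \<in> A k'" "orbit f x = orbit f y" by auto
    have "x \<in> orbit f y" using assms(4)[OF k(1) xy(1)] xy(3) by simp
    then have "x \<in> A k'" using orbit_subset_invariant[OF assms(3)[OF k(2)] xy(2)] by auto
    then show False using assms(5)[OF k(1-3)] xy(1) by auto
  qed
qed (use assms in auto)

lemma sum_orbits_Un:
  assumes "finite A" "finite B" "f ` A \<subseteq> A" "f ` B \<subseteq> B" "\<And>x. x \<in> A \<union> B \<Longrightarrow> x \<in> orbit f x" "A \<inter> B = {}"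
  shows "sum F (orbit f ` (A \<union> B)) = sum F (orbit f ` A) + sum F (orbit f ` B)"
proof -
  have "sum F (orbit f ` (\<Union>b\<in>UNIV. if b then A else B))
      = (\<Sum>b\<in>UNIV. sum F (orbit f ` (if b then A else B)))"
    by (rule sum_orbits_UN) (use assms in \<open>auto split: if_splits\<close>)
  then show ?thesis by (simp add: UNIV_bool add.commute Un_commute)
qed

text \<open>The permutation \<open>f\<close> moves the copy \<open>h ` B\<close> of \<open>B\<close> through \<open>l\<close> disjoint places before it
  returns with the twist \<open>\<tau>\<close>; so each cycle of \<open>\<tau>\<close> unfolds into a cycle of \<open>f\<close> that is
  \<open>l\<close> times as long.\<close>

definition unfold_cycle :: "('a \<Rightarrow> 'a) \<Rightarrow> ('b \<Rightarrow> 'a) \<Rightarrow> nat \<Rightarrow> 'b set \<Rightarrow> 'a set" where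
  "unfold_cycle f h l Z = (\<Union>i<l. (f ^^ i) ` h ` Z)"

locale cycle_unfolding =
  fixes f :: "'a \<Rightarrow> 'a" and h :: "'b \<Rightarrow> 'a" and l :: nat and B :: "'b set" and \<tau> :: "'b \<Rightarrow> 'b"
  assumes l: "l > 0" and fin: "finite B" and inj: "inj_on h B" and bij: "bij_betw \<tau> B B"
    and ret: "u \<in> B \<Longrightarrow> (f ^^ l) (h u) = h (\<tau> u)"
    and disj: "\<lbrakk>i < l; j < l; u \<in> B; v \<in> B; (f ^^ i) (h u) = (f ^^ j) (h v)\<rbrakk> \<Longrightarrow> i = j"
begin

lemma tau_B: "\<tau> ` B \<subseteq> B" using bij by (simp add: bij_betw_def)

lemma ret_funpow: "u \<in> B \<Longrightarrow> (f ^^ (l * q)) (h u) = h ((\<tau> ^^ q) u)"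
  by (rule funpow_return[where B = B]) (simp_all add: ret tau_B)

text \<open>Completing the round with l - i further steps brings both points home, where
  \<open>ret\<close> and the injectivity of h and \<tau> apply.\<close>

lemma inj_step: "\<lbrakk>i < l; u \<in> B; v \<in> B; (f ^^ i) (h u) = (f ^^ i) (h v)\<rbrakk> \<Longrightarrow> u = v"
proof -
  assume a: "i < l" "u \<in> B" "v \<in> B" "(f ^^ i) (h u) = (f ^^ i) (h v)"
  have "(f ^^ l) (h w) = (f ^^ (l - i)) ((f ^^ i) (h w))" for w
    using a(1) by (simp add: funpow_funpow)
  then have "h (\<tau> u) = h (\<tau> v)" using a by (metis ret)
  then have "\<tau> u = \<tau> v" using a tau_B inj by (blast dest: inj_onD)
  then show "u = v" using a bij by (blast dest: inj_onD bij_betw_imp_inj_on)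
qed

lemma self_in_orbit: "u \<in> B \<Longrightarrow> u \<in> orbit \<tau> u"
  using self_in_orbit_bij[OF fin bij] .

text \<open>Division with remainder: n + i = l * q + r means q full rounds, which act as the q-th
  power of \<tau>, followed by r steps within a round.\<close>

lemma orbit_unfold:
  assumes u: "u \<in> B" and i: "i < l"
  shows "orbit f ((f ^^ i) (h u)) = unfold_cycle f h l (orbit \<tau> u)"
proof -
  obtain p where p: "p > 0" "(\<tau> ^^ p) u = u"
    using self_in_orbit[OF u] by (auto simp: orbit_altdef)
  show ?thesis
  proof (intro equalityI subsetI)
    fix x assume "x \<in> orbit f ((f ^^ i) (h u))"
    then obtain n where "x = (f ^^ n) ((f ^^ i) (h u))" by (auto simp: orbit_altdef)
    then have "x = (f ^^ (n + i)) (h u)" by (simp add: funpow_add)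
    also have "\<dots> = (f ^^ ((n + i) mod l)) ((f ^^ (l * ((n + i) div l))) (h u))"
      by (simp add: funpow_funpow)
    finally have x: "x = (f ^^ ((n + i) mod l)) (h ((\<tau> ^^ ((n + i) div l)) u))"
      by (simp add: ret_funpow u)
    have "(\<tau> ^^ ((n + i) div l)) u \<in> orbit \<tau> u"
      using self_in_orbit[OF u] funpow_in_orbit by metis
    with x show "x \<in> unfold_cycle f h l (orbit \<tau> u)"
      using l mod_less_divisor unfolding unfold_cycle_def by blast
  next
    fix x assume "x \<in> unfold_cycle f h l (orbit \<tau> u)"
    then obtain r q where rq: "r < l" "x = (f ^^ r) (h ((\<tau> ^^ q) u))"
      by (auto simp: unfold_cycle_def orbit_altdef)
    \<comment> \<open>Adding one return time p of u under \<tau> makes the exponent exceed i, so the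
      point is reached from place i with a positive exponent, as \<open>orbit\<close>
      demands.\<close>
    have "(\<tau> ^^ q) u = (\<tau> ^^ (q + p)) u" by (simp add: funpow_add p)
    then have "x = (f ^^ r) ((f ^^ (l * (q + p))) (h u))" by (simp add: rq ret_funpow u)
    also have "\<dots> = (f ^^ (r + l * (q + p) - i + i)) (h u)"
    proof -
      have "i \<le> r + l * (q + p)" using i p(1) by (cases p) (simp_all add: algebra_simps)
      then show ?thesis by (simp add: funpow_add)
    qed
    also have "\<dots> = (f ^^ (r + l * (q + p) - i)) ((f ^^ i) (h u))"
      by (simp add: funpow_add)
    finally have x: "x = (f ^^ (r + l * (q + p) - i)) ((f ^^ i) (h u))" .
    moreover have "r + l * (q + p) - i > 0" using i p(1) by (cases p) (simp_all add: algebra_simps)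
    ultimately show "x \<in> orbit f ((f ^^ i) (h u))" unfolding orbit_altdef by blast
  qed
qed

lemma card_unfold_cycle:
  assumes "S \<subseteq> B"
  shows "card (unfold_cycle f h l S) = l * card S"
proof -
  have "finite S" using assms fin finite_subset by blast
  have "card (unfold_cycle f h l S) = (\<Sum>i<l. card ((f ^^ i) ` h ` S))"
    unfolding unfold_cycle_def
  proof (rule card_UN_disjoint)
    show "\<forall>i\<in>{..<l}. \<forall>j\<in>{..<l}. i \<noteq> j \<longrightarrow> (f ^^ i) ` h ` S \<inter> (f ^^ j) ` h ` S = {}"
    proof (intro ballI impI, rule ccontr)
      fix i j assume ij: "i \<in> {..<l}" "j \<in> {..<l}" "i \<noteq> j" "(f ^^ i) ` h ` S \<inter> (f ^^ j) ` h ` S \<noteq> {}"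
      then obtain u v where "u \<in> S" "v \<in> S" "(f ^^ i) (h u) = (f ^^ j) (h v)" by blast
      then show False using disj[of i j u v] ij assms by auto
    qed
  qed (use \<open>finite S\<close> in auto)
  also have "\<dots> = (\<Sum>i<l. card S)"
  proof (rule sum.cong)
    fix i assume "i \<in> {..<l}"
    then have "inj_on (\<lambda>u. (f ^^ i) (h u)) S"
      using inj_step assms by (auto simp: inj_on_def)
    then show "card ((f ^^ i) ` h ` S) = card S"
      by (simp add: image_image card_image)
  qed simp
  finally show ?thesis by simp
qed

text \<open>Place 0 holds a copy of the set itself, and by \<open>disj\<close> no other place can
  meet it; so the set can be read off its unfolding.\<close>

lemma unfold_cycle_inj:
  assumes "S \<subseteq> B" "S' \<subseteq> B" "unfold_cycle f h l S = unfold_cycle f h l S'"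
  shows "S = S'"
proof -
  have "S \<subseteq> S'" if sub: "S \<subseteq> B" "S' \<subseteq> B" "unfold_cycle f h l S = unfold_cycle f h l S'" for S S'
  proof
    fix u assume u: "u \<in> S"
    have "(f ^^ 0) (h u) \<in> unfold_cycle f h l S" using l u unfolding unfold_cycle_def by blast
    then obtain i v where iv: "i < l" "v \<in> S'" "(f ^^ 0) (h u) = (f ^^ i) (h v)"
      using sub(3) unfolding unfold_cycle_def by blast
    then have "i = 0" using disj[of 0 i u v] l u sub by auto
    then show "u \<in> S'" using iv u sub inj_onD[OF inj, of u v] by auto
  qed
  then show ?thesis using assms by (metis subset_antisym)
qed

lemma orbits_unfold:
  "orbit f ` unfold_cycle f h l B = unfold_cycle f h l ` (orbit \<tau> ` B)"
proof (intro equalityI subsetI)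
  fix X assume "X \<in> orbit f ` unfold_cycle f h l B"
  then obtain i u where "i < l" "u \<in> B" "X = orbit f ((f ^^ i) (h u))"
    unfolding unfold_cycle_def by blast
  then show "X \<in> unfold_cycle f h l ` (orbit \<tau> ` B)" using orbit_unfold by blast
next
  fix X assume "X \<in> unfold_cycle f h l ` (orbit \<tau> ` B)"
  then obtain u where "u \<in> B" "X = orbit f ((f ^^ 0) (h u))" using orbit_unfold l by blast
  then show "X \<in> orbit f ` unfold_cycle f h l B" using l unfolding unfold_cycle_def by blast
qed

lemma sum_orbits_unfold:
  "sum F (orbit f ` unfold_cycle f h l B) = (\<Sum>Z\<in>orbit \<tau> ` B. F (unfold_cycle f h l Z))"
  unfolding orbits_unfold
proof (rule sum.reindex_cong[OF _ refl refl])
  show "inj_on (unfold_cycle f h l) (orbit \<tau> ` B)"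
  proof (rule inj_onI)
    fix X Y assume "X \<in> orbit \<tau> ` B" "Y \<in> orbit \<tau> ` B" "unfold_cycle f h l X = unfold_cycle f h l Y"
    then show "X = Y" using unfold_cycle_inj[of X Y] orbit_subset_invariant[OF tau_B] by blast
  qed
qed

lemma self_in_orbit_unfold: "x \<in> unfold_cycle f h l B \<Longrightarrow> x \<in> orbit f x"
proof -
  assume "x \<in> unfold_cycle f h l B"
  then obtain i u where iu: "i < l" "u \<in> B" "x = (f ^^ i) (h u)"
    unfolding unfold_cycle_def by blast
  then show ?thesis using orbit_unfold[OF iu(2,1)] self_in_orbit[OF iu(2)]
      unfolding unfold_cycle_def by blast
qed

lemma unfold_invariant: "f ` unfold_cycle f h l B \<subseteq> unfold_cycle f h l B"
proof safe
  fix x assume "x \<in> unfold_cycle f h l B"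
  then obtain i u where iu: "i < l" "u \<in> B" "x = (f ^^ i) (h u)"
    unfolding unfold_cycle_def by blast
  have "f x \<in> orbit f x" by (rule orbit.base)
  also have "\<dots> = unfold_cycle f h l (orbit \<tau> u)" using orbit_unfold iu by simp
  also have "\<dots> \<subseteq> unfold_cycle f h l B"
    using orbit_subset_invariant[OF tau_B iu(2)] unfolding unfold_cycle_def by blast
  finally show "f x \<in> unfold_cycle f h l B" .
qed

lemma finite_unfold: "finite (unfold_cycle f h l B)"
  using fin by (simp add: unfold_cycle_def)

end

section \<open>Weights as sums over cycles\<close>

definition vertex_monomial :: "'v set \<Rightarrow> ('v \<Rightarrow> 'v) \<Rightarrow> wvar \<Rightarrow>\<^sub>0 nat" where
  "vertex_monomial S \<sigma> = (\<Sum>Z\<in>orbit \<sigma> ` S. Poly_Mapping.single (VA (card Z)) 1)"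

text \<open>Two cases suffice: for an edge cycle of a graph automorphism, not cylindrical means
  Moebius, by \<open>cylindrical_iff\<close>.\<close>

definition edge_var :: "('v \<Rightarrow> 'v) \<Rightarrow> 'v set set \<Rightarrow> wvar" where
  "edge_var \<sigma> C = (if cylindrical \<sigma> C then VB (card C) else VC (card C))"

definition edge_monomial :: "'v set set \<Rightarrow> ('v \<Rightarrow> 'v) \<Rightarrow> wvar \<Rightarrow>\<^sub>0 nat" where
  "edge_monomial E \<sigma> = (\<Sum>C\<in>orbit (image \<sigma>) ` E. Poly_Mapping.single (edge_var \<sigma> C) 1)"

text \<open>After one full round the edge {a, b} is back, so its ends are either both fixed or
  exchanged. That power commutes with \<sigma>, so all edges of the cycle behave alike; hence
  exactly one of the two types holds, and one end of one edge decides which.\<close>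

lemma cylindrical_iff:
  assumes "inj \<sigma>" "a \<noteq> b" and e: "{a, b} \<in> orbit (image \<sigma>) {a, b}"
  defines "C \<equiv> orbit (image \<sigma>) {a, b}"
  shows "cylindrical \<sigma> C \<longleftrightarrow> (\<sigma> ^^ card C) a = a"
    and "moebius \<sigma> C \<longleftrightarrow> \<not> cylindrical \<sigma> C"
    and "cylindrical \<sigma> C \<longleftrightarrow> (\<sigma> ^^ card C) b = b"
    and "\<not> cylindrical \<sigma> C \<longleftrightarrow> (\<sigma> ^^ card C) a = b"
    and "\<not> cylindrical \<sigma> C \<longleftrightarrow> (\<sigma> ^^ card C) b = a"
proof -
  let ?s = "\<sigma> ^^ card C"
  have "?s ` {a, b} = {a, b}"
    using card_orbit_funpow(1)[OF e] by (simp only: funpow_image C_def)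
  then have im: "{?s a, ?s b} = {a, b}" by simp
  have injn: "inj (\<sigma> ^^ n)" for n using assms(1) by (rule inj_fn)
  have edge: "\<exists>n. {c, d} = {(\<sigma> ^^ n) a, (\<sigma> ^^ n) b}" if "{c, d} \<in> C" for c d
    using that unfolding C_def by (auto simp: orbit_altdef funpow_image)
  have comm: "?s ((\<sigma> ^^ n) x) = (\<sigma> ^^ n) (?s x)" for n x
    by (metis add.commute comp_apply funpow_add)
  have cases: "(?s a = a \<and> ?s b = b) \<or> (?s a = b \<and> ?s b = a)"
    using im assms(2) by (auto simp: doubleton_eq_iff)
  have self: "{a, b} \<in> C" using e by (simp add: C_def)
  have "cylindrical \<sigma> C" if "?s a = a \<and> ?s b = b"
    unfolding cylindrical_def
  proof (intro allI impI)
    fix c d assume "{c, d} \<in> C"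
    then obtain n where "{c, d} = {(\<sigma> ^^ n) a, (\<sigma> ^^ n) b}" using edge by blast
    then show "?s c = c \<and> ?s d = d" using that comm[of n] by (auto simp: doubleton_eq_iff)
  qed
  moreover have "?s a = a \<and> ?s b = b" if "cylindrical \<sigma> C"
    using that self by (auto simp: cylindrical_def)
  ultimately have cyl: "cylindrical \<sigma> C \<longleftrightarrow> ?s a = a \<and> ?s b = b" by blast
  have "moebius \<sigma> C" if "?s a = b \<and> ?s b = a"
    unfolding moebius_def
  proof (intro allI impI)
    fix c d assume "{c, d} \<in> C"
    then obtain n where "{c, d} = {(\<sigma> ^^ n) a, (\<sigma> ^^ n) b}" using edge by blast
    then show "?s c = d \<and> ?s d = c" using that comm[of n] by (auto simp: doubleton_eq_iff)
  qed
  moreover have "?s a = b \<and> ?s b = a" if "moebius \<sigma> C"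
    using that self by (auto simp: moebius_def)
  ultimately have moeb: "moebius \<sigma> C \<longleftrightarrow> ?s a = b \<and> ?s b = a" by blast
  show "cylindrical \<sigma> C \<longleftrightarrow> (\<sigma> ^^ card C) a = a" "moebius \<sigma> C \<longleftrightarrow> \<not> cylindrical \<sigma> C"
    "cylindrical \<sigma> C \<longleftrightarrow> (\<sigma> ^^ card C) b = b"
    "\<not> cylindrical \<sigma> C \<longleftrightarrow> (\<sigma> ^^ card C) a = b" "\<not> cylindrical \<sigma> C \<longleftrightarrow> (\<sigma> ^^ card C) b = a"
    using cyl moeb cases assms(2) by auto
qed

lemma lookup_sum_single:
  assumes "finite A"
  shows "Poly_Mapping.lookup (\<Sum>i\<in>A. Poly_Mapping.single (x i) 1) y = card {i \<in> A. x i = y}"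
proof -
  have "Poly_Mapping.lookup (\<Sum>i\<in>A. Poly_Mapping.single (x i) (1::nat)) y = (\<Sum>i\<in>A. if x i = y then 1 else 0)"
    by (auto simp: lookup_sum lookup_single when_def intro!: sum.cong)
  also have "\<dots> = card {i \<in> A. x i = y}"
    using assms by (subst sum.inter_filter[symmetric]) simp_all
  finally show ?thesis .
qed

lemma simple_graph_finite: "simple_graph G \<Longrightarrow> finite (verts G) \<and> finite (edges G)"
  unfolding simple_graph_def by (meson Pow_iff finite_Pow_iff finite_subset subsetI)

lemma simple_graph_edgeE:
  assumes "simple_graph G" "e \<in> edges G"
  obtains a b where "e = {a, b}" "a \<noteq> b" "a \<in> verts G" "b \<in> verts G"
  using assms unfolding simple_graph_def card_2_iff by (metis insert_subset)

lemma graph_AutD: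
  assumes "\<sigma> \<in> graph_Aut G"
  shows "\<sigma> permutes verts G" "inj \<sigma>" "image \<sigma> ` edges G = edges G"
    "bij_betw (image \<sigma>) (edges G) (edges G)" "bij_betw \<sigma> (verts G) (verts G)"
proof -
  show p: "\<sigma> permutes verts G" and e: "image \<sigma> ` edges G = edges G"
    and "bij_betw \<sigma> (verts G) (verts G)"
    using assms by (auto simp: graph_Aut_def graph_iso_def)
  show i: "inj \<sigma>" using p by (rule permutes_inj)
  then have "inj (image \<sigma>)" by (simp add: inj_image_eq_iff inj_def)
  then show "bij_betw (image \<sigma>) (edges G) (edges G)"
    unfolding bij_betw_def using e by (metis inj_on_subset subset_UNIV)
qed

text \<open>Turns the exponents counted by \<open>weight\<close> into a sum of one variable per
  cycle, the form that splits over invariant pieces and can be unfolded. For an automorphism every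
  edge cycle carries exactly one of the two types, so each contributes exactly one variable.\<close>

lemma weight_eq:
  assumes G: "simple_graph G" and \<sigma>: "\<sigma> \<in> graph_Aut G"
  shows "weight G \<sigma> = vertex_monomial (verts G) \<sigma> + edge_monomial (edges G) \<sigma>"
proof (rule poly_mapping_eqI)
  fix x
  have fin: "finite (orbit \<sigma> ` verts G)" "finite (orbit (image \<sigma>) ` edges G)"
    using simple_graph_finite[OF G] by auto
  have moeb: "moebius \<sigma> C \<longleftrightarrow> \<not> cylindrical \<sigma> C" if C: "C \<in> orbit (image \<sigma>) ` edges G" for C
  proof -
    obtain e where e: "e \<in> edges G" "C = orbit (image \<sigma>) e" using C by blast
    obtain a b where ab: "e = {a, b}" "a \<noteq> b" using simple_graph_edgeE[OF G e(1)] by metis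
    have "e \<in> orbit (image \<sigma>) e"
      by (rule self_in_orbit_bij[OF _ graph_AutD(4)[OF \<sigma>] e(1)]) (simp add: simple_graph_finite G)
    then show ?thesis using cylindrical_iff(2)[OF graph_AutD(2)[OF \<sigma>] ab(2)] ab e by simp
  qed
  show "Poly_Mapping.lookup (weight G \<sigma>) x
      = Poly_Mapping.lookup (vertex_monomial (verts G) \<sigma> + edge_monomial (edges G) \<sigma>) x"
    unfolding vertex_monomial_def edge_monomial_def lookup_add
      lookup_sum_single[OF fin(1)] lookup_sum_single[OF fin(2)]
    by (cases x)
      (auto simp: lookup_weight[OF G] vertex_cycles_def edge_cycles_def edge_var_def moeb
        intro!: arg_cong[of _ _ card])
qed

lemma vertex_degree_edge_monomial [simp]: "vertex_degree (edge_monomial E \<sigma>) = 0"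
  by (auto simp: edge_monomial_def vertex_degree_sum edge_var_def intro!: sum.neutral)

text \<open>The cycles partition S, and a cycle of length k contributes a_k, which has degree
  k.\<close>

lemma vertex_degree_vertex_monomial:
  assumes "finite S" "bij_betw \<sigma> S S"
  shows "vertex_degree (vertex_monomial S \<sigma>) = card S"
proof -
  have sub: "\<sigma> ` S \<subseteq> S" using assms(2) by (simp add: bij_betw_def)
  have self: "x \<in> orbit \<sigma> x" if "x \<in> S" for x using self_in_orbit_bij[OF assms that] .
  have orb: "orbit \<sigma> x \<subseteq> S" if "x \<in> S" for x using orbit_subset_invariant[OF sub that] .
  have "card (\<Union>(orbit \<sigma> ` S)) = (\<Sum>Z\<in>orbit \<sigma> ` S. card Z)"
  proof (rule card_Union_disjoint)
    show "pairwise disjnt (orbit \<sigma> ` S)"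
      unfolding pairwise_def disjnt_def
    proof (intro ballI impI, rule ccontr)
      fix X Y assume XY: "X \<in> orbit \<sigma> ` S" "Y \<in> orbit \<sigma> ` S" "X \<noteq> Y" "X \<inter> Y \<noteq> {}"
      then obtain x y z where "x \<in> S" "y \<in> S" "X = orbit \<sigma> x" "Y = orbit \<sigma> y" "z \<in> X" "z \<in> Y"
        by blast
      then show False using orbit_eq_if_mem[OF self] XY(3) by metis
    qed
    fix X assume "X \<in> orbit \<sigma> ` S"
    then show "finite X" using finite_subset[OF orb assms(1)] by auto
  qed
  moreover have "\<Union>(orbit \<sigma> ` S) = S" using self orb by blast
  ultimately show ?thesis
    unfolding vertex_monomial_def vertex_degree_sum by simp
qed

lemma vertex_degree_weight:
  assumes "simple_graph G" "\<sigma> \<in> graph_Aut G"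
  shows "vertex_degree (weight G \<sigma>) = card (verts G)"
  unfolding weight_eq[OF assms] vertex_degree_add
  by (simp add: vertex_degree_vertex_monomial simple_graph_finite[OF assms(1)] graph_AutD(5)[OF assms(2)])

text \<open>A cycle that becomes l times as long turns a_k into a_(lk); this is where the dilated
  series of the formula come from.\<close>

lemma (in cycle_unfolding) vertex_monomial_unfold:
  "vertex_monomial (unfold_cycle f h l B) f = dilate_monomial l (vertex_monomial B \<tau>)"
  unfolding vertex_monomial_def sum_orbits_unfold dilate_monomial_sum
  by (rule sum.cong) (auto simp: card_unfold_cycle orbit_subset_invariant[OF tau_B])

text \<open>Besides the length, the type of a cycle has to survive. Once round the long cycle
  applies the power l * card C of \<sigma> to h a, which gives h applied to the power card C of
  \<tau> at a, and h is injective on V. The type is read off at the ends of an edge, hence the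
  hypotheses about the vertex set V.\<close>

lemma edge_monomial_unfold:
  fixes \<sigma> :: "'a \<Rightarrow> 'a" and \<tau> :: "'b \<Rightarrow> 'b"
  assumes u: "cycle_unfolding (image \<sigma>) (image h) l E (image \<tau>)"
    and injs: "inj \<sigma>" "inj \<tau>" "inj_on h V"
    and E: "\<And>e. e \<in> E \<Longrightarrow> e \<subseteq> V \<and> card e = 2" and \<tau>V: "\<tau> ` V \<subseteq> V"
    and retV: "\<And>v. v \<in> V \<Longrightarrow> (\<sigma> ^^ l) (h v) = h (\<tau> v)"
  shows "edge_monomial (unfold_cycle (image \<sigma>) (image h) l E) \<sigma> = dilate_monomial l (edge_monomial E \<tau>)"
proof -
  interpret cycle_unfolding "image \<sigma>" "image h" l E "image \<tau>" by (rule u)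
  have retf: "(\<sigma> ^^ (l * q)) (h v) = h ((\<tau> ^^ q) v)" if "v \<in> V" for q v
    by (rule funpow_return[where B = V]) (simp_all add: retV \<tau>V that)
  have "edge_var \<sigma> (unfold_cycle (image \<sigma>) (image h) l C) = scale_var l (edge_var \<tau> C)"
    if C: "C \<in> orbit (image \<tau>) ` E" for C
  proof -
    obtain e where e: "e \<in> E" "C = orbit (image \<tau>) e" using C by blast
    obtain a b where ab: "e = {a, b}" "a \<noteq> b" using E[OF e(1)] by (auto simp: card_2_iff)
    have V: "a \<in> V" "b \<in> V" using E[OF e(1)] ab by auto
    let ?C = "unfold_cycle (image \<sigma>) (image h) l C"
    have C': "?C = orbit (image \<sigma>) {h a, h b}"
      using orbit_unfold[OF e(1) l] e ab by simp
    have hab: "h a \<noteq> h b" using V ab(2) injs(3) by (auto simp: inj_on_def)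
    have "image h e \<in> unfold_cycle (image \<sigma>) (image h) l E"
      using l e(1) unfolding unfold_cycle_def by (auto intro!: bexI[of _ 0])
    from self_in_orbit_unfold[OF this]
    have self: "{h a, h b} \<in> orbit (image \<sigma>) {h a, h b}" by (simp add: ab)
    have card: "card ?C = l * card C"
      by (rule card_unfold_cycle) (use e orbit_subset_invariant[OF tau_B] in blast)
    have "cylindrical \<sigma> ?C \<longleftrightarrow> (\<sigma> ^^ (l * card C)) (h a) = h a"
      using cylindrical_iff(1)[OF injs(1) hab self] C' card by metis
    also have "\<dots> \<longleftrightarrow> h ((\<tau> ^^ card C) a) = h a" by (simp add: retf V)
    also have "\<dots> \<longleftrightarrow> (\<tau> ^^ card C) a = a"
      using injs(3) V funpow_in[OF \<tau>V V(1)] by (auto simp: inj_on_def)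
    also have "\<dots> \<longleftrightarrow> cylindrical \<tau> C"
      using cylindrical_iff(1)[OF injs(2) ab(2)] self_in_orbit[OF e(1)] e ab by simp
    finally show ?thesis using card by (simp add: edge_var_def)
  qed
  then show ?thesis
    unfolding edge_monomial_def sum_orbits_unfold dilate_monomial_sum
    by (intro sum.cong) auto
qed

section \<open>Isomorphisms\<close>

definition graph_map :: "('v \<Rightarrow> 'w) \<Rightarrow> 'v graph \<Rightarrow> 'w graph" where
  "graph_map f G = \<lparr>verts = f ` verts G, edges = image f ` edges G\<rparr>"

definition network_map :: "('v \<Rightarrow> 'w) \<Rightarrow> 'v network \<Rightarrow> 'w network" where
  "network_map f N = \<lparr>hat = graph_map f (hat N), pole0 = f (pole0 N), pole1 = f (pole1 N)\<rparr>"

lemma graph_map_simps [simp]: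
  "verts (graph_map f G) = f ` verts G" "edges (graph_map f G) = image f ` edges G"
  by (simp_all add: graph_map_def)

lemma network_map_simps [simp]:
  "hat (network_map f N) = graph_map f (hat N)" "pole0 (network_map f N) = f (pole0 N)"
  "pole1 (network_map f N) = f (pole1 N)"
  by (simp_all add: network_map_def)

lemma edges_subset: "simple_graph G \<Longrightarrow> e \<in> edges G \<Longrightarrow> e \<subseteq> verts G"
  by (simp add: simple_graph_def)

lemma graph_iso_graph_map: "inj_on f (verts G) \<Longrightarrow> graph_iso f G (graph_map f G)"
  by (simp add: graph_iso_def bij_betw_def)

lemma graph_iso_comp: "graph_iso f G H \<Longrightarrow> graph_iso g H K \<Longrightarrow> graph_iso (g \<circ> f) G K"
proof -
  assume f: "graph_iso f G H" and g: "graph_iso g H K"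
  have "image (g \<circ> f) ` edges G = image g ` image f ` edges G"
    by (simp add: image_image image_comp)
  then show ?thesis using f g unfolding graph_iso_def by (auto intro: bij_betw_trans)
qed

text \<open>Edges lie inside the vertex set, so only the values there matter: isomorphisms can be
  made extensional for counting, or extended by the identity to satisfy
  \<open>permutes\<close>.\<close>

lemma graph_iso_cong:
  assumes "simple_graph G" "\<And>v. v \<in> verts G \<Longrightarrow> f v = g v" "graph_iso f G H"
  shows "graph_iso g G H"
proof -
  have "bij_betw g (verts G) (verts H)"
    using assms by (auto simp: graph_iso_def cong: bij_betw_cong)
  moreover have "image f ` edges G = image g ` edges G"
    by (intro image_cong refl assms(2)) (use edges_subset[OF assms(1)] in blast)
  ultimately show ?thesis using assms(3) by (simp add: graph_iso_def)
qed

lemma graph_iso_restrict: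
  "simple_graph G \<Longrightarrow> graph_iso f G H \<Longrightarrow> graph_iso (restrict f (verts G)) G H"
  by (rule graph_iso_cong[of G f]) simp_all

lemma graph_iso_inv:
  assumes "simple_graph G" "graph_iso f G H"
  shows "graph_iso (inv_into (verts G) f) H G"
proof -
  have f: "bij_betw f (verts G) (verts H)" "image f ` edges G = edges H"
    using assms(2) by (auto simp: graph_iso_def)
  have "image (inv_into (verts G) f) ` edges H = (\<lambda>e. e) ` edges G"
    unfolding f(2)[symmetric] image_comp
    by (rule image_cong[OF refl])
      (use f(1) edges_subset[OF assms(1)] in \<open>simp add: bij_betw_def inv_into_image_cancel\<close>)
  then show ?thesis using bij_betw_inv_into[OF f(1)] by (simp add: graph_iso_def)
qed

lemma graph_iso_id: "graph_iso id G G" "graph_iso (\<lambda>x. x) G G"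
  by (simp_all add: graph_iso_def bij_betw_def)

lemma graph_iso_simple:
  assumes "simple_graph G" "graph_iso f G H"
  shows "simple_graph H"
proof -
  have f: "inj_on f (verts G)" "verts H = f ` verts G" "edges H = image f ` edges G"
    using assms(2) by (auto simp: graph_iso_def bij_betw_def)
  have "f ` e \<subseteq> f ` verts G \<and> card (f ` e) = 2" if "e \<in> edges G" for e
  proof -
    have e: "e \<subseteq> verts G" "card e = 2" using assms(1) that by (auto simp: simple_graph_def)
    then show ?thesis using card_image[OF inj_on_subset[OF f(1) e(1)]] by (simp add: image_mono)
  qed
  moreover have "finite (f ` verts G)" using simple_graph_finite[OF assms(1)] by simp
  ultimately show ?thesis unfolding simple_graph_def f(2,3) by simp
qed

lemma graph_iso_edge: "graph_iso f G H \<Longrightarrow> {x, y} \<in> edges G \<Longrightarrow> {f x, f y} \<in> edges H"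
  using image_eqI[of "{f x, f y}" "image f" "{x, y}" "edges G"] by (simp add: graph_iso_def)

lemma graph_iso_verts: "graph_iso f G H \<Longrightarrow> x \<in> verts G \<Longrightarrow> f x \<in> verts H"
  unfolding graph_iso_def by (auto dest: bij_betwE)

lemma graph_iso_funpow: "graph_iso f G G \<Longrightarrow> graph_iso (f ^^ n) G G"
  by (induction n) (auto intro: graph_iso_id graph_iso_comp)

lemma graph_AutI:
  assumes "simple_graph G" "graph_iso f G G" "\<And>v. v \<notin> verts G \<Longrightarrow> f v = v"
  shows "f \<in> graph_Aut G"
  using assms unfolding graph_Aut_def graph_iso_def by (auto intro: bij_imp_permutes)

lemma finite_graph_Aut: "simple_graph G \<Longrightarrow> finite (graph_Aut G)"
  unfolding graph_Aut_def by (simp add: simple_graph_finite finite_permutations)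

text \<open>\<open>pairs_isomorphic\<close> with the witness exposed and between possibly different
  vertex types, because glued pairs live on a sum type.\<close>

definition pair_iso :: "('v \<Rightarrow> 'w) \<Rightarrow> 'v graph \<times> 'v graph \<Rightarrow> 'w graph \<times> 'w graph \<Rightarrow> bool" where
  "pair_iso f P Q \<longleftrightarrow> graph_iso f (fst P) (fst Q) \<and> graph_iso f (snd P) (snd Q)"

definition wf_pair :: "'v graph \<times> 'v graph \<Rightarrow> bool" where
  "wf_pair P \<longleftrightarrow> simple_graph (fst P) \<and> simple_graph (snd P) \<and> verts (snd P) \<subseteq> verts (fst P)"

lemma pair_iso_comp: "pair_iso f P Q \<Longrightarrow> pair_iso g Q R \<Longrightarrow> pair_iso (g \<circ> f) P R"
  unfolding pair_iso_def by (blast intro: graph_iso_comp)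

lemma pair_iso_cong:
  assumes "wf_pair P" "\<And>v. v \<in> verts (fst P) \<Longrightarrow> f v = g v" "pair_iso f P Q"
  shows "pair_iso g P Q"
  using assms graph_iso_cong[of "fst P" f g] graph_iso_cong[of "snd P" f g]
  unfolding pair_iso_def wf_pair_def by blast

lemma pair_iso_restrict:
  "wf_pair P \<Longrightarrow> pair_iso f P Q \<Longrightarrow> pair_iso (restrict f (verts (fst P))) P Q"
  by (rule pair_iso_cong[of P f]) simp_all

text \<open>One inverse serves both graphs: on the core it agrees with the inverse of the
  restriction, as f is injective on the larger vertex set.\<close>

lemma pair_iso_inv:
  assumes "wf_pair P" "pair_iso f P Q"
  shows "pair_iso (inv_into (verts (fst P)) f) Q P"
proof -
  have G: "simple_graph (fst P)" "simple_graph (snd P)" "verts (snd P) \<subseteq> verts (fst P)"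
    and f: "graph_iso f (fst P) (fst Q)" "graph_iso f (snd P) (snd Q)"
    using assms by (auto simp: wf_pair_def pair_iso_def)
  have inj: "inj_on f (verts (fst P))" "inj_on f (verts (snd P))"
    and im: "verts (snd Q) = f ` verts (snd P)"
    using f by (auto simp: graph_iso_def bij_betw_def)
  have "inv_into (verts (snd P)) f v = inv_into (verts (fst P)) f v" if "v \<in> verts (snd Q)" for v
    using that inj G(3) unfolding im by (auto simp: subset_iff)
  then have "graph_iso (inv_into (verts (fst P)) f) (snd Q) (snd P)"
    using graph_iso_cong[OF graph_iso_simple[OF G(2) f(2)] _ graph_iso_inv[OF G(2) f(2)]] by blast
  then show ?thesis using graph_iso_inv[OF G(1) f(1)] by (simp add: pair_iso_def)
qed

lemma network_iso_comp: "network_iso f N M \<Longrightarrow> network_iso g M K \<Longrightarrow> network_iso (g \<circ> f) N K"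
  unfolding network_iso_def by (auto intro: graph_iso_comp)

lemma is_networkD:
  assumes "is_network N"
  shows "simple_graph (hat N)" "pole0 N \<in> verts (hat N)" "pole1 N \<in> verts (hat N)"
    "pole0 N \<noteq> pole1 N" "verts (hat N) = {pole0 N, pole1 N} \<union> internal N"
    "finite (internal N)"
  using assms simple_graph_finite by (auto simp: is_network_def internal_def)

lemma network_iso_cong:
  assumes "is_network N" "\<And>v. v \<in> verts (hat N) \<Longrightarrow> f v = g v" "network_iso f N M"
  shows "network_iso g N M"
  using assms graph_iso_cong[of "hat N" f g "hat M"] is_networkD(1-3)[OF assms(1)]
  by (auto simp: network_iso_def)

lemma network_iso_restrict:
  "is_network N \<Longrightarrow> network_iso f N M \<Longrightarrow> network_iso (restrict f (verts (hat N))) N M"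
  by (rule network_iso_cong[of N f]) simp_all

lemma network_iso_inv:
  assumes "is_network N" "network_iso f N M"
  shows "network_iso (inv_into (verts (hat N)) f) M N"
proof -
  have "inj_on f (verts (hat N))" using assms(2) by (auto simp: network_iso_def graph_iso_def bij_betw_def)
  then show ?thesis
    using assms(2) graph_iso_inv[OF is_networkD(1)[OF assms(1)], of f "hat M"] is_networkD(2,3)[OF assms(1)]
    by (auto simp: network_iso_def) (metis inv_into_f_eq)+
qed

lemma network_iso_network_map: "inj_on f (verts (hat N)) \<Longrightarrow> network_iso f N (network_map f N)"
  by (simp add: network_iso_def graph_iso_graph_map)

lemma network_iso_internal:
  assumes "is_network N" "network_iso f N M"
  shows "bij_betw f (internal N) (internal M)"
proof -
  let ?V = "verts (hat N)" and ?p = "{pole0 N, pole1 N}"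
  have f: "inj_on f ?V" "f ` ?V = verts (hat M)" "f ` ?p = {pole0 M, pole1 M}"
    using assms(2) by (auto simp: network_iso_def graph_iso_def bij_betw_def)
  have "f ` (?V - ?p) = f ` ?V - f ` ?p"
    by (rule inj_on_image_set_diff[OF f(1)]) (use is_networkD(2,3)[OF assms(1)] in auto)
  then show ?thesis
    using f unfolding internal_def bij_betw_def by (auto intro: inj_on_subset)
qed

lemma graph_connected_iso:
  assumes "graph_iso f G H" "graph_connected G"
  shows "graph_connected H"
proof -
  have im: "verts H = f ` verts G" using assms(1) by (auto simp: graph_iso_def bij_betw_def)
  have path: "(f u, f v) \<in> {(x, y). {x, y} \<in> edges H}\<^sup>*"
    if "(u, v) \<in> {(x, y). {x, y} \<in> edges G}\<^sup>*" for u v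
    using that
  proof (induction rule: rtrancl_induct)
    case (step y z)
    then have "(f y, f z) \<in> {(x, y). {x, y} \<in> edges H}" using graph_iso_edge[OF assms(1)] by simp
    with step.IH show ?case by (rule rtrancl_into_rtrancl)
  qed simp
  then show ?thesis using assms(2) unfolding graph_connected_def im by blast
qed

lemma delete_vertex_iso:
  assumes "simple_graph G" "graph_iso f G H" "v \<in> verts G"
  shows "graph_iso f (delete_vertex G v) (delete_vertex H (f v))"
proof -
  have f: "inj_on f (verts G)" "verts H = f ` verts G" "edges H = image f ` edges G"
    using assms(2) by (auto simp: graph_iso_def bij_betw_def)
  have "f v \<in> f ` e \<longleftrightarrow> v \<in> e" if "e \<in> edges G" for e
    using edges_subset[OF assms(1) that] f(1) assms(3) by (auto simp: inj_on_def)
  then have "image f ` {e \<in> edges G. v \<notin> e} = {e \<in> edges H. f v \<notin> e}"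
    unfolding f(3) by blast
  moreover have "bij_betw f (verts G - {v}) (verts H - {f v})"
    using f assms(3) by (auto simp: bij_betw_def inj_on_def)
  ultimately show ?thesis by (simp add: graph_iso_def delete_vertex_def)
qed

lemma two_connected_iso:
  assumes "simple_graph G" "graph_iso f G H" "two_connected G"
  shows "two_connected H"
proof -
  have f: "inj_on f (verts G)" "verts H = f ` verts G"
    using assms(2) by (auto simp: graph_iso_def bij_betw_def)
  show ?thesis
    using assms(3) graph_connected_iso[OF assms(2)] graph_connected_iso[OF delete_vertex_iso[OF assms(1,2)]]
    unfolding two_connected_def f(2) card_image[OF f(1)] by blast
qed

lemma add_edge_iso: "graph_iso f G H \<Longrightarrow> graph_iso f (add_edge G u v) (add_edge H (f u) (f v))"
  by (simp add: graph_iso_def add_edge_def)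

lemma is_network_iso:
  assumes "is_network N" "network_iso f N M"
  shows "is_network M"
proof -
  have f: "graph_iso f (hat N) (hat M)" "pole0 M = f (pole0 N)" "pole1 M = f (pole1 N)"
    using assms(2) by (auto simp: network_iso_def)
  have inj: "inj_on f (verts (hat N))" using f(1) by (auto simp: graph_iso_def bij_betw_def)
  note N = is_networkD[OF assms(1)]
  have simple: "simple_graph (add_edge (hat N) (pole0 N) (pole1 N))"
    using N by (auto simp: simple_graph_def add_edge_def)
  have "two_connected (add_edge (hat M) (pole0 M) (pole1 M))"
    unfolding f(2,3)
    by (rule two_connected_iso[OF simple add_edge_iso[OF f(1)]]) (use assms(1) in \<open>simp add:
        is_network_def\<close>)
  moreover have "pole0 M \<noteq> pole1 M" using N(2-4) inj f(2,3) by (auto simp: inj_on_def)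
  ultimately show ?thesis
    using assms(1) graph_connected_iso[OF f(1)] graph_iso_simple[OF N(1) f(1)] graph_iso_verts[OF f(1)]
    unfolding is_network_def f(2,3) by blast
qed

lemma is_network_opposite: "is_network N \<Longrightarrow> is_network (opposite N)"
  by (auto simp: is_network_def opposite_def add_edge_def insert_commute)

lemma internal_opposite [simp]: "internal (opposite N) = internal N"
  by (auto simp: internal_def opposite_def)

lemma network_species_iso:
  assumes "network_species \<N>" "N \<in> \<N>" "network_iso f N M"
  shows "M \<in> \<N>"
  using assms is_network_iso[of N f M] unfolding network_species_def networks_isomorphic_def by blast

section \<open>Transport along isomorphisms\<close>

text \<open>The inverse of h after f on V, completed by the identity so that the result can satisfy
  \<open>permutes\<close>. For f = \<rho> \<circ> h this is \<rho> conjugated by h.\<close>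

definition pull_back :: "'v set \<Rightarrow> ('v \<Rightarrow> 'w) \<Rightarrow> ('v \<Rightarrow> 'w) \<Rightarrow> 'v \<Rightarrow> 'v" where
  "pull_back V h f v = (if v \<in> V then inv_into V h (f v) else v)"

lemma pull_back_outside: "v \<notin> V \<Longrightarrow> pull_back V h f v = v"
  by (simp add: pull_back_def)

lemma apply_pull_back: "v \<in> V \<Longrightarrow> f v \<in> h ` V \<Longrightarrow> h (pull_back V h f v) = f v"
  by (simp add: pull_back_def f_inv_into_f)

lemma graph_iso_pull_back:
  assumes "simple_graph G" "graph_iso h G H" "graph_iso f G H"
  shows "graph_iso (pull_back (verts G) h f) G G"
  by (rule graph_iso_cong[OF assms(1) _ graph_iso_comp[OF assms(3) graph_iso_inv[OF assms(1,2)]]])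
    (simp add: pull_back_def)

lemma pull_back_graph_Aut:
  assumes "simple_graph G" "graph_iso h G H" "graph_iso f G H"
  shows "pull_back (verts G) h f \<in> graph_Aut G"
    and "\<And>v. v \<in> verts G \<Longrightarrow> h (pull_back (verts G) h f v) = f v"
proof -
  show "pull_back (verts G) h f \<in> graph_Aut G"
    by (rule graph_AutI[OF assms(1) graph_iso_pull_back[OF assms] pull_back_outside])
  show "h (pull_back (verts G) h f v) = f v" if "v \<in> verts G" for v
    by (rule apply_pull_back[OF that]) (use assms(2,3) that in \<open>auto simp: graph_iso_def bij_betw_def\<close>)
qed

text \<open>With one isomorphism h fixed, \<alpha> \<mapsto> h \<circ> \<alpha> is a bijection from
  A to I with inverse \<open>pull_back V h\<close>. The members of I are extensional, since
  otherwise functions differing outside V would be counted separately.\<close>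

lemma card_torsor:
  assumes "inj_on h V" and A: "\<And>\<alpha>. \<alpha> \<in> A \<Longrightarrow> \<alpha> permutes V" "\<And>\<alpha>. \<alpha> \<in> A \<Longrightarrow> restrict (h \<circ> \<alpha>) V \<in> I"
    and I: "\<And>f. f \<in> I \<Longrightarrow> f \<in> extensional V" "\<And>f. f \<in> I \<Longrightarrow> f ` V \<subseteq> h ` V" "\<And>f. f \<in> I \<Longrightarrow> pull_back V h f \<in> A"
  shows "card I = card A"
proof -
  have "bij_betw (\<lambda>\<alpha>. restrict (h \<circ> \<alpha>) V) A I"
  proof (rule bij_betw_byWitness[where f' = "pull_back V h"])
    show "\<forall>\<alpha>\<in>A. pull_back V h (restrict (h \<circ> \<alpha>) V) = \<alpha>"
    proof
      fix \<alpha> assume "\<alpha> \<in> A"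
      then have "\<alpha> permutes V" by (rule A)
      then show "pull_back V h (restrict (h \<circ> \<alpha>) V) = \<alpha>"
        using assms(1) by (auto simp: pull_back_def permutes_in_image permutes_not_in)
    qed
    show "\<forall>f\<in>I. restrict (h \<circ> pull_back V h f) V = f"
    proof
      fix f assume "f \<in> I"
      then show "restrict (h \<circ> pull_back V h f) V = f"
        using I(1,2)[of f] by (intro extensionalityI[of _ V]) (auto simp: apply_pull_back image_subset_iff)
    qed
  qed (use A I in auto)
  then show ?thesis by (simp add: bij_betw_same_card)
qed

definition graph_isos :: "'v graph \<Rightarrow> 'w graph \<Rightarrow> ('v \<Rightarrow> 'w) set" where
  "graph_isos G H = {f \<in> extensional (verts G). graph_iso f G H}"

definition pair_isos :: "'v graph \<times> 'v graph \<Rightarrow> 'w graph \<times> 'w graph \<Rightarrow> ('v \<Rightarrow> 'w) set" where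
  "pair_isos P Q = {f \<in> extensional (verts (fst P)). pair_iso f P Q}"

definition network_isos :: "'v network \<Rightarrow> 'w network \<Rightarrow> ('v \<Rightarrow> 'w) set" where
  "network_isos N M = {f \<in> extensional (verts (hat N)). network_iso f N M}"

text \<open>$\mathrm{Aut}^+$ (for \<open>s\<close>) and $\mathrm{Aut}^-$ (otherwise), each symmetry already extended to
  the poles as $\sigma^+$ or $\sigma^-$.\<close>

definition network_syms :: "bool \<Rightarrow> 'v network \<Rightarrow> ('v \<Rightarrow> 'v) set" where
  "network_syms s N = {\<rho> \<in> graph_Aut (hat N).
     if s then \<rho> (pole0 N) = pole0 N \<and> \<rho> (pole1 N) = pole1 N
     else \<rho> (pole0 N) = pole1 N \<and> \<rho> (pole1 N) = pole0 N}"

lemma card_graph_isos: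
  assumes G: "simple_graph G" and h: "graph_iso h G H"
  shows "card (graph_isos G H) = card (graph_Aut G)"
proof (rule card_torsor)
  show "inj_on h (verts G)" using h by (auto simp: graph_iso_def bij_betw_def)
  fix \<alpha> assume \<alpha>: "\<alpha> \<in> graph_Aut G"
  then show "\<alpha> permutes verts G" by (simp add: graph_Aut_def)
  have "graph_iso (h \<circ> \<alpha>) G H" using \<alpha> h by (auto simp: graph_Aut_def intro: graph_iso_comp)
  then show "restrict (h \<circ> \<alpha>) (verts G) \<in> graph_isos G H"
    unfolding graph_isos_def by (simp add: graph_iso_restrict G)
next
  fix f assume f: "f \<in> graph_isos G H"
  then show "f \<in> extensional (verts G)" by (simp add: graph_isos_def)
  show "f ` verts G \<subseteq> h ` verts G" using f h by (auto simp: graph_isos_def graph_iso_def bij_betw_def)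
  show "pull_back (verts G) h f \<in> graph_Aut G"
    by (rule pull_back_graph_Aut[OF G h]) (use f in \<open>simp add: graph_isos_def\<close>)
qed

lemma pair_AutI:
  assumes "wf_pair P" "pair_iso \<sigma> P P" "\<And>v. v \<notin> verts (fst P) \<Longrightarrow> \<sigma> v = v"
  shows "\<sigma> \<in> pair_Aut P"
  using assms graph_AutI[of "fst P" \<sigma>] by (auto simp: pair_Aut_def pair_iso_def wf_pair_def)

lemma pair_AutD: "\<sigma> \<in> pair_Aut P \<Longrightarrow> pair_iso \<sigma> P P" "\<sigma> \<in> pair_Aut P \<Longrightarrow> \<sigma> \<in> graph_Aut (fst P)"
  by (auto simp: pair_Aut_def pair_iso_def graph_Aut_def)

text \<open>Here the automorphisms act on the target, \<alpha> \<mapsto> \<alpha> \<circ> h, whereas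
  \<open>card_torsor\<close> composes on the source side: the coefficient of a pair contains |Aut
  P|, and Q will be a glued pair.\<close>

lemma card_pair_isos:
  assumes P: "wf_pair P" and h: "pair_iso h Q P" and Q: "wf_pair Q"
  shows "card (pair_isos Q P) = card (pair_Aut P)"
proof -
  let ?V = "verts (fst P)" and ?W = "verts (fst Q)"
  let ?h' = "inv_into ?W h"
  have bij: "bij_betw h ?W ?V" using h by (auto simp: pair_iso_def graph_iso_def)
  have h': "pair_iso ?h' P Q" by (rule pair_iso_inv[OF Q h])
  have "bij_betw (\<lambda>\<alpha>. restrict (\<alpha> \<circ> h) ?W) (pair_Aut P) (pair_isos Q P)"
  proof (rule bij_betw_byWitness[where f' = "\<lambda>f v. if v \<in> ?V then f (?h' v) else v"])
    show "\<forall>\<alpha>\<in>pair_Aut P. (\<lambda>v. if v \<in> ?V then restrict (\<alpha> \<circ> h) ?W (?h' v) else v) = \<alpha>"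
    proof
      fix \<alpha> assume "\<alpha> \<in> pair_Aut P"
      then have "\<alpha> permutes ?V" by (simp add: pair_Aut_def graph_Aut_def)
      then show "(\<lambda>v. if v \<in> ?V then restrict (\<alpha> \<circ> h) ?W (?h' v) else v) = \<alpha>"
        using bij bij_betw_inv_into_right[OF bij] bij_betw_apply[OF bij_betw_inv_into[OF bij]]
        by (auto simp: permutes_not_in)
    qed
    show "\<forall>f\<in>pair_isos Q P. restrict ((\<lambda>v. if v \<in> ?V then f (?h' v) else v) \<circ> h) ?W = f"
      using bij_betw_inv_into_left[OF bij] bij_betw_apply[OF bij]
      by (auto simp: pair_isos_def intro!: extensionalityI[of _ ?W])
    show "(\<lambda>\<alpha>. restrict (\<alpha> \<circ> h) ?W) ` pair_Aut P \<subseteq> pair_isos Q P"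
    proof safe
      fix \<alpha> assume "\<alpha> \<in> pair_Aut P"
      then have "pair_iso (\<alpha> \<circ> h) Q P" using h pair_iso_comp pair_AutD(1) by blast
      then show "restrict (\<alpha> \<circ> h) ?W \<in> pair_isos Q P"
        unfolding pair_isos_def by (simp add: pair_iso_restrict Q)
    qed
    show "(\<lambda>f v. if v \<in> ?V then f (?h' v) else v) ` pair_isos Q P \<subseteq> pair_Aut P"
    proof safe
      fix f assume "f \<in> pair_isos Q P"
      then have "pair_iso f Q P" by (simp add: pair_isos_def)
      then have "pair_iso (f \<circ> ?h') P P" by (rule pair_iso_comp[OF h'])
      then have "pair_iso (\<lambda>v. if v \<in> ?V then f (?h' v) else v) P P"
        by (rule pair_iso_cong[OF P, rotated]) simp
      then show "(\<lambda>v. if v \<in> ?V then f (?h' v) else v) \<in> pair_Aut P"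
        by (rule pair_AutI[OF P]) simp
    qed
  qed
  then show ?thesis by (simp add: bij_betw_same_card)
qed

lemma card_network_isos:
  assumes N: "is_network N" and h: "network_iso h N M"
  shows "card (network_isos N M) = card (network_syms True N)"
proof (rule card_torsor)
  note simple = is_networkD(1)[OF N]
  have hG: "graph_iso h (hat N) (hat M)" using h by (simp add: network_iso_def)
  show inj: "inj_on h (verts (hat N))" using hG by (auto simp: graph_iso_def bij_betw_def)
  fix \<alpha> assume \<alpha>: "\<alpha> \<in> network_syms True N"
  then show "\<alpha> permutes verts (hat N)" by (simp add: network_syms_def graph_Aut_def)
  have "network_iso \<alpha> N N" using \<alpha> by (simp add: network_syms_def graph_Aut_def network_iso_def)
  then have "network_iso (h \<circ> \<alpha>) N M" using h by (rule network_iso_comp)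
  then show "restrict (h \<circ> \<alpha>) (verts (hat N)) \<in> network_isos N M"
    unfolding network_isos_def by (simp add: network_iso_restrict N)
next
  note simple = is_networkD(1)[OF N]
  have hG: "graph_iso h (hat N) (hat M)" using h by (simp add: network_iso_def)
  have inj: "inj_on h (verts (hat N))" using hG by (auto simp: graph_iso_def bij_betw_def)
  fix f assume f: "f \<in> network_isos N M"
  then show "f \<in> extensional (verts (hat N))" by (simp add: network_isos_def)
  have fG: "graph_iso f (hat N) (hat M)" using f by (auto simp: network_isos_def network_iso_def)
  then show "f ` verts (hat N) \<subseteq> h ` verts (hat N)" using hG by (auto simp: graph_iso_def bij_betw_def)
  let ?p = "pull_back (verts (hat N)) h f"
  have "h (?p (pole0 N)) = h (pole0 N)" "h (?p (pole1 N)) = h (pole1 N)"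
    using pull_back_graph_Aut(2)[OF simple hG fG] is_networkD(2,3)[OF N] f h
    by (auto simp: network_isos_def network_iso_def)
  then have "?p (pole0 N) = pole0 N" "?p (pole1 N) = pole1 N"
    using inj_onD[OF inj] is_networkD(2,3)[OF N] graph_iso_verts[OF graph_iso_pull_back[OF simple hG fG]]
    by blast+
  then show "?p \<in> network_syms True N"
    using pull_back_graph_Aut(1)[OF simple hG fG] by (simp add: network_syms_def)
qed

text \<open>Composition with h identifies the pole-fixing symmetries with those of sign s: a
  nonempty Aut^- is a coset of Aut^+. So the number of symmetries of either sign, if not zero, also
  counts the isomorphisms onto an isomorphic network.\<close>

lemma card_network_syms:
  assumes N: "is_network N" and h: "h \<in> network_syms s N"
  shows "card (network_syms s N) = card (network_syms True N)"
proof -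
  note simple = is_networkD(1)[OF N]
  let ?V = "verts (hat N)"
  have perm: "h permutes ?V" and hG: "graph_iso h (hat N) (hat N)"
    using h by (auto simp: network_syms_def graph_Aut_def)
  let ?h' = "inv_into UNIV h"
  have inv: "?h' permutes ?V" using perm by (rule permutes_inv)
  have cancel: "?h' (h v) = v" "h (?h' v) = v" for v using perm by (simp_all add: permutes_inverses)
  have "graph_iso ?h' (hat N) (hat N)"
    by (rule graph_iso_cong[OF simple _ graph_iso_inv[OF simple hG]])
      (rule inv_into_f_eq[OF permutes_inj_on[OF perm]], simp_all add: permutes_in_image[OF inv] cancel)
  then have h'A: "?h' \<in> graph_Aut (hat N)" using inv by (simp add: graph_Aut_def)
  have comp: "\<alpha> \<circ> \<beta> \<in> graph_Aut (hat N)" if "\<alpha> \<in> graph_Aut (hat N)" "\<beta> \<in> graph_Aut (hat N)" for \<alpha> \<beta>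
    using that permutes_compose[of \<beta> ?V \<alpha>] graph_iso_comp[of \<beta> "hat N" "hat N" \<alpha> "hat N"]
        by (simp add: graph_Aut_def)
  have "bij_betw (\<lambda>\<alpha>. h \<circ> \<alpha>) (network_syms True N) (network_syms s N)"
  proof (intro bij_betw_byWitness[where f' = "\<lambda>\<alpha>. ?h' \<circ> \<alpha>"] ballI)
    have poles: "h (pole0 N) = (if s then pole0 N else pole1 N)"
        "h (pole1 N) = (if s then pole1 N else pole0 N)"
      using h by (auto simp: network_syms_def split: if_splits)
    then have poles': "?h' (if s then pole0 N else pole1 N) = pole0 N"
        "?h' (if s then pole1 N else pole0 N) = pole1 N"
      using cancel(1)[of "pole0 N"] cancel(1)[of "pole1 N"] by simp_all
    have hA: "h \<in> graph_Aut (hat N)" using h by (simp add: network_syms_def)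
    show "(\<lambda>\<alpha>. h \<circ> \<alpha>) ` network_syms True N \<subseteq> network_syms s N"
      using comp[OF hA] poles by (cases s) (auto simp: network_syms_def)
    show "(\<lambda>\<alpha>. ?h' \<circ> \<alpha>) ` network_syms s N \<subseteq> network_syms True N"
      using comp[OF h'A] poles' by (cases s) (auto simp: network_syms_def)
  qed (rule ext, simp add: cancel)+
  then show ?thesis by (simp add: bij_betw_same_card)
qed

text \<open>Conjugation by h. Since h respects each pole, the effect on the poles is the same in N
  and in M.\<close>

lemma pull_back_network_syms:
  assumes N: "is_network N" and h: "network_iso h N M" and \<rho>: "graph_iso \<rho> (hat M) (hat M)"
    "if s then \<rho> (pole0 M) = pole0 M \<and> \<rho> (pole1 M) = pole1 M
     else \<rho> (pole0 M) = pole1 M \<and> \<rho> (pole1 M) = pole0 M"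
  shows "pull_back (verts (hat N)) h (\<rho> \<circ> h) \<in> network_syms s N"
    and "\<And>v. v \<in> verts (hat N) \<Longrightarrow> h (pull_back (verts (hat N)) h (\<rho> \<circ> h) v) = \<rho> (h v)"
proof -
  note simple = is_networkD(1)[OF N]
  have hG: "graph_iso h (hat N) (hat M)" using h by (simp add: network_iso_def)
  then have fG: "graph_iso (\<rho> \<circ> h) (hat N) (hat M)" using \<rho>(1) by (rule graph_iso_comp)
  have inj: "inj_on h (verts (hat N))" using hG by (auto simp: graph_iso_def bij_betw_def)
  let ?p = "pull_back (verts (hat N)) h (\<rho> \<circ> h)"
  show p: "\<And>v. v \<in> verts (hat N) \<Longrightarrow> h (?p v) = \<rho> (h v)"
    using pull_back_graph_Aut(2)[OF simple hG fG] by simp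
  have eq: "?p x = y" if "x \<in> verts (hat N)" "y \<in> verts (hat N)" "\<rho> (h x) = h y" for x y
    using inj_onD[OF inj, of "?p x" y] p[OF that(1)] that graph_iso_verts[OF graph_iso_pull_back[OF
        simple hG fG]]
    by simp
  show "?p \<in> network_syms s N"
    unfolding network_syms_def
    using pull_back_graph_Aut(1)[OF simple hG fG] \<rho>(2) eq is_networkD(2,3)[OF N] h
    by (auto simp: network_iso_def)
qed

section \<open>Representatives\<close>

locale equivalence_on =
  fixes eqv :: "'s \<Rightarrow> 's \<Rightarrow> bool" and S :: "'s set"
  assumes refl: "x \<in> S \<Longrightarrow> eqv x x"
    and sym: "x \<in> S \<Longrightarrow> y \<in> S \<Longrightarrow> eqv x y \<Longrightarrow> eqv y x"
    and trans: "x \<in> S \<Longrightarrow> y \<in> S \<Longrightarrow> z \<in> S \<Longrightarrow> eqv x y \<Longrightarrow> eqv y z \<Longrightarrow> eqv x z"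
begin

abbreviation "rel \<equiv> {(x, y). x \<in> S \<and> y \<in> S \<and> eqv x y}"

lemma equiv: "equiv S rel"
proof (rule equivI)
  show "trans rel"
  proof (rule transI)
    show "(x, z) \<in> rel" if "(x, y) \<in> rel" "(y, z) \<in> rel" for x y z
      using that trans[of x y z] by simp
  qed
  show "sym rel"
  proof (rule symI)
    show "(y, x) \<in> rel" if "(x, y) \<in> rel" for x y
      using that sym[of x y] by simp
  qed
qed (auto intro!: refl_onI refl)

lemma some_in_class: "X \<in> S // rel \<Longrightarrow> (SOME x. x \<in> X) \<in> X"
  using in_quotient_imp_non_empty[OF equiv] by (simp add: some_in_eq)

lemma representatives_subset: "representatives eqv S \<subseteq> S"
proof
  fix r assume "r \<in> representatives eqv S"
  then obtain X where X: "X \<in> S // rel" "r = (SOME x. x \<in> X)" by (auto simp: representatives_def)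
  then show "r \<in> S" using some_in_class[OF X(1)] in_quotient_imp_subset[OF equiv X(1)] by auto
qed

lemma representatives_ex: "x \<in> S \<Longrightarrow> \<exists>r\<in>representatives eqv S. eqv r x"
proof -
  assume x: "x \<in> S"
  let ?X = "rel `` {x}"
  have X: "?X \<in> S // rel" using x by (rule quotientI)
  have "(SOME y. y \<in> ?X) \<in> ?X" by (rule some_in_class[OF X])
  then have "(x, SOME y. y \<in> ?X) \<in> rel" by (simp only: Image_singleton_iff)
  then have "(SOME y. y \<in> ?X) \<in> S" "eqv x (SOME y. y \<in> ?X)" by (simp_all only: mem_Collect_eq prod.case)
  then have "eqv (SOME y. y \<in> ?X) x" using sym x by simp
  moreover have "(SOME y. y \<in> ?X) \<in> representatives eqv S"
    unfolding representatives_def by (rule imageI[OF X])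
  ultimately show ?thesis by (rule bexI)
qed

lemma representatives_unique:
  assumes "r \<in> representatives eqv S" "r' \<in> representatives eqv S" "eqv r r'"
  shows "r = r'"
proof -
  obtain X where X: "X \<in> S // rel" "r = (SOME x. x \<in> X)" using assms(1) by (auto simp: representatives_def)
  obtain Y where Y: "Y \<in> S // rel" "r' = (SOME x. x \<in> Y)" using assms(2) by (auto simp: representatives_def)
  have "r \<in> X" "r' \<in> Y" using some_in_class[OF X(1)] some_in_class[OF Y(1)] X(2) Y(2) by simp_all
  moreover have "(r, r') \<in> rel"
    using assms representatives_subset by (simp add: subset_iff)
  ultimately have "X = Y" by (rule quotient_eqI[OF equiv X(1) Y(1)])
  then show ?thesis using X Y by simp
qed

text \<open>Distinct representatives have distinct values under h, because equal values mean
  equivalence; so the finitely many values bound their number.\<close>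

lemma finite_representatives:
  assumes "finite (h ` {x \<in> S. p x})" "\<And>x y. x \<in> S \<Longrightarrow> y \<in> S \<Longrightarrow> p x \<Longrightarrow> p y \<Longrightarrow> h x = h y \<Longrightarrow> eqv x y"
  shows "finite {r \<in> representatives eqv S. p r}"
proof (rule finite_imageD[where f = h])
  show "finite (h ` {r \<in> representatives eqv S. p r})"
    using assms(1) representatives_subset by (auto intro: finite_subset[rotated])
  show "inj_on h {r \<in> representatives eqv S. p r}"
  proof (rule inj_onI)
    fix x y assume "x \<in> {r \<in> representatives eqv S. p r}" "y \<in> {r \<in> representatives eqv S. p r}" "h x = h y"
    then show "x = y" using assms(2)[of x y] representatives_unique[of x y] representatives_subset by blast
  qed
qed

end

lemma equivalence_on_graphs:
  assumes "\<And>G. G \<in> \<G> \<Longrightarrow> simple_graph G"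
  shows "equivalence_on graphs_isomorphic \<G>"
proof
  show "graphs_isomorphic x x" for x :: "'a graph"
    unfolding graphs_isomorphic_def using graph_iso_id(1) by blast
  show "graphs_isomorphic y x" if "x \<in> \<G>" "graphs_isomorphic x y" for x y
    using that graph_iso_inv[OF assms] unfolding graphs_isomorphic_def by blast
  show "graphs_isomorphic x z" if "graphs_isomorphic x y" "graphs_isomorphic y z" for x y z :: "'a graph"
    using that graph_iso_comp unfolding graphs_isomorphic_def by blast
qed

lemma equivalence_on_networks:
  assumes "\<And>N. N \<in> \<N> \<Longrightarrow> is_network N"
  shows "equivalence_on networks_isomorphic \<N>"
proof
  show "networks_isomorphic x x" for x :: "'a network"
    unfolding networks_isomorphic_def by (rule exI[of _ id]) (simp add: network_iso_def graph_iso_id)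
  show "networks_isomorphic y x" if "x \<in> \<N>" "networks_isomorphic x y" for x y
  proof -
    from that(2) obtain f where "network_iso f x y" unfolding networks_isomorphic_def ..
    with assms[OF that(1)] have "network_iso (inv_into (verts (hat x)) f) y x" by (rule network_iso_inv)
    then show ?thesis unfolding networks_isomorphic_def by blast
  qed
  show "networks_isomorphic x z"
      if "networks_isomorphic x y" "networks_isomorphic y z" for x y z :: "'a network"
  proof -
    from that obtain f g where "network_iso f x y" "network_iso g y z"
        unfolding networks_isomorphic_def by blast
    then have "network_iso (g \<circ> f) x z" by (rule network_iso_comp)
    then show ?thesis unfolding networks_isomorphic_def by blast
  qed
qed

lemma pairs_isomorphic_iff: "pairs_isomorphic P Q \<longleftrightarrow> (\<exists>f. pair_iso f P Q)"
  by (simp add: pairs_isomorphic_def pair_iso_def)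

lemma equivalence_on_pairs:
  assumes "\<And>P. P \<in> \<P> \<Longrightarrow> wf_pair P"
  shows "equivalence_on pairs_isomorphic \<P>"
proof
  show "pairs_isomorphic x x" for x :: "'a graph \<times> 'a graph"
    unfolding pairs_isomorphic_iff by (rule exI[of _ id]) (simp add: pair_iso_def graph_iso_id)
  show "pairs_isomorphic y x" if "x \<in> \<P>" "pairs_isomorphic x y" for x y
  proof -
    from that(2) obtain f where "pair_iso f x y" unfolding pairs_isomorphic_iff ..
    with assms[OF that(1)] have "pair_iso (inv_into (verts (fst x)) f) y x" by (rule pair_iso_inv)
    then show ?thesis unfolding pairs_isomorphic_iff by blast
  qed
  show "pairs_isomorphic x z" if "pairs_isomorphic x y" "pairs_isomorphic y z"
      for x y z :: "'a graph \<times> 'a graph"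
  proof -
    from that obtain f g where "pair_iso f x y" "pair_iso g y z" unfolding pairs_isomorphic_iff by blast
    then have "pair_iso (g \<circ> f) x z" by (rule pair_iso_comp)
    then show ?thesis unfolding pairs_isomorphic_iff by blast
  qed
qed

section \<open>Finitely many isomorphism classes for each number of vertices\<close>

definition numbering :: "'v set \<Rightarrow> 'v set \<Rightarrow> 'v \<Rightarrow> 'v" where
  "numbering F V = (SOME h. bij_betw h V F)"

lemma bij_betw_numbering:
  assumes "finite F" "card F = n" "finite V" "card V = n"
  shows "bij_betw (numbering F V) V F"
  unfolding numbering_def using someI_ex[OF finite_same_card_bij[OF assms(3,1)]] assms by simp

lemma finite_graphs_on:
  assumes "finite F"
  shows "finite {G :: 'v graph. verts G \<subseteq> F \<and> edges G \<subseteq> Pow F}"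
proof (rule finite_subset)
  show "{G :: 'v graph. verts G \<subseteq> F \<and> edges G \<subseteq> Pow F} \<subseteq> (\<lambda>(V, E). \<lparr>verts = V, edges
      = E\<rparr>) ` (Pow F \<times> Pow (Pow F))"
  proof
    fix G :: "'v graph" assume "G \<in> {G. verts G \<subseteq> F \<and> edges G \<subseteq> Pow F}"
    then show "G \<in> (\<lambda>(V, E). \<lparr>verts = V, edges = E\<rparr>) ` (Pow F \<times> Pow (Pow F))"
      by (intro image_eqI[of _ _ "(verts G, edges G)"]) simp_all
  qed
  show "finite ((\<lambda>(V, E). \<lparr>verts = V, edges = E\<rparr>) ` (Pow F \<times> Pow (Pow F)))"
    using assms by simp
qed

lemma graph_map_on:
  assumes "simple_graph G" "verts G \<subseteq> V" "bij_betw g V F"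
  shows "verts (graph_map g G) \<subseteq> F" "edges (graph_map g G) \<subseteq> Pow F"
proof -
  have g: "g ` V = F" using assms(3) by (simp add: bij_betw_def)
  show "verts (graph_map g G) \<subseteq> F"
    using image_mono[OF assms(2), of g] by (simp add: g)
  have "g ` e \<subseteq> F" if "e \<in> edges G" for e
    using image_mono[OF subset_trans[OF edges_subset[OF assms(1) that] assms(2)], of g] by (simp add: g)
  then show "edges (graph_map g G) \<subseteq> Pow F"
    by (simp add: image_subset_iff)
qed

text \<open>Every graph with n vertices is relabelled onto one fixed n-element set F, which carries
  finitely many graphs; equal relabellings mean isomorphic graphs. F exists because the vertex type
  is infinite.\<close>

lemma finite_graph_representatives:
  fixes \<G> :: "'v :: infinite graph set"
  assumes "\<And>G. G \<in> \<G> \<Longrightarrow> simple_graph G"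
  shows "finite {G \<in> representatives graphs_isomorphic \<G>. card (verts G) = n}"
proof -
  interpret equivalence_on graphs_isomorphic \<G> by (rule equivalence_on_graphs[OF assms])
  obtain F :: "'v set" where F: "finite F" "card F = n"
    using infinite_arbitrarily_large[OF infinite_UNIV] by blast
  note g' = bij_betw_numbering[OF F]
  let ?h = "\<lambda>G. graph_map (numbering F (verts G)) G"
  have g: "bij_betw (numbering F (verts G)) (verts G) F" if "G \<in> \<G>" "card (verts G) = n" for G
    using g'[of "verts G"] simple_graph_finite[OF assms[OF that(1)]] that(2) by simp
  have iso: "graph_iso (numbering F (verts G)) G (?h G)" if "G \<in> \<G>" "card (verts G) = n" for G
    by (rule graph_iso_graph_map) (use g[OF that] in \<open>simp add: bij_betw_def\<close>)
  show ?thesis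
  proof (rule finite_representatives[where h = ?h])
    have "?h ` {G \<in> \<G>. card (verts G) = n} \<subseteq> {G. verts G \<subseteq> F \<and> edges G \<subseteq> Pow F}"
    proof (rule image_subsetI)
      fix G assume "G \<in> {G \<in> \<G>. card (verts G) = n}"
      then show "?h G \<in> {G. verts G \<subseteq> F \<and> edges G \<subseteq> Pow F}"
        using graph_map_on[OF assms subset_refl g] by simp
    qed
    then show "finite (?h ` {G \<in> \<G>. card (verts G) = n})"
      using finite_graphs_on[OF F(1)] by (rule finite_subset)
    fix G H assume a: "G \<in> \<G>" "H \<in> \<G>" "card (verts G) = n" "card (verts H) = n" "?h G = ?h H"
    have "graph_iso (numbering F (verts G)) G (?h H)"
      using iso[OF a(1,3)] unfolding a(5) .
    from graph_iso_comp[OF this graph_iso_inv[OF assms[OF a(2)] iso[OF a(2,4)]]]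
    show "graphs_isomorphic G H" unfolding graphs_isomorphic_def by blast
  qed
qed

text \<open>As for graphs; the core is relabelled by the bijection chosen for the whole graph, so
  that one map is an isomorphism of both.\<close>

lemma finite_pair_representatives:
  fixes \<P> :: "('v :: infinite graph \<times> 'v graph) set"
  assumes "\<And>P. P \<in> \<P> \<Longrightarrow> wf_pair P"
  shows "finite {P \<in> representatives pairs_isomorphic \<P>. card (verts (fst P)) = n}"
proof -
  interpret equivalence_on pairs_isomorphic \<P> by (rule equivalence_on_pairs[OF assms])
  obtain F :: "'v set" where F: "finite F" "card F = n"
    using infinite_arbitrarily_large[OF infinite_UNIV] by blast
  note g' = bij_betw_numbering[OF F]
  let ?gP = "\<lambda>P. numbering F (verts (fst P))"
  let ?h = "\<lambda>P. (graph_map (?gP P) (fst P), graph_map (?gP P) (snd P))"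
  have wf: "simple_graph (fst P)" "simple_graph (snd P)" "verts (snd P) \<subseteq> verts (fst P)" if "P \<in> \<P>" for P
    using assms[OF that] by (auto simp: wf_pair_def)
  have g: "bij_betw (?gP P) (verts (fst P)) F" if "P \<in> \<P>" "card (verts (fst P)) = n" for P
    using g'[of "verts (fst P)"] simple_graph_finite[OF wf(1)[OF that(1)]] that(2) by simp
  have iso: "pair_iso (?gP P) P (?h P)" if "P \<in> \<P>" "card (verts (fst P)) = n" for P
  proof -
    have "inj_on (?gP P) (verts (fst P))" using g[OF that] by (simp add: bij_betw_def)
    then show ?thesis
      unfolding pair_iso_def fst_conv snd_conv
      using inj_on_subset[OF _ wf(3)[OF that(1)]] by (intro conjI graph_iso_graph_map)
  qed
  let ?T = "{G. verts G \<subseteq> F \<and> edges G \<subseteq> Pow F}"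
  show ?thesis
  proof (rule finite_representatives[where h = ?h])
    have "?h P \<in> ?T \<times> ?T" if "P \<in> \<P>" "card (verts (fst P)) = n" for P
      using graph_map_on[OF wf(1) subset_refl g] graph_map_on[OF wf(2) wf(3) g] that by simp
    then have "?h ` {P \<in> \<P>. card (verts (fst P)) = n} \<subseteq> ?T \<times> ?T" by blast
    then show "finite (?h ` {P \<in> \<P>. card (verts (fst P)) = n})"
      by (rule finite_subset) (intro finite_SigmaI finite_graphs_on F(1))
    fix P Q assume a: "P \<in> \<P>" "Q \<in> \<P>" "card (verts (fst P)) = n" "card (verts (fst Q)) = n" "?h P = ?h Q"
    have "pair_iso (?gP P) P (?h Q)"
      using iso[OF a(1,3)] unfolding a(5) .
    from pair_iso_comp[OF this pair_iso_inv[OF assms[OF a(2)] iso[OF a(2,4)]]]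
    show "pairs_isomorphic P Q" unfolding pairs_isomorphic_iff by blast
  qed
qed

lemma finite_network_representatives:
  fixes \<N> :: "'v :: infinite network set"
  assumes "\<And>N. N \<in> \<N> \<Longrightarrow> is_network N"
  shows "finite {N \<in> representatives networks_isomorphic \<N>. card (verts (hat N)) = n}"
proof -
  interpret equivalence_on networks_isomorphic \<N> by (rule equivalence_on_networks[OF assms])
  obtain F :: "'v set" where F: "finite F" "card F = n"
    using infinite_arbitrarily_large[OF infinite_UNIV] by blast
  note g' = bij_betw_numbering[OF F]
  let ?h = "\<lambda>N. network_map (numbering F (verts (hat N))) N"
  let ?T = "{G. verts G \<subseteq> F \<and> edges G \<subseteq> Pow F}"
  have g: "bij_betw (numbering F (verts (hat N))) (verts (hat N)) F"
      if "N \<in> \<N>" "card (verts (hat N)) = n" for N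
    using g'[of "verts (hat N)"] simple_graph_finite[OF is_networkD(1)[OF assms[OF that(1)]]] that(2)
        by simp
  have iso: "network_iso (numbering F (verts (hat N))) N (?h N)" if "N \<in> \<N>" "card (verts (hat N)) = n" for N
    by (rule network_iso_network_map) (use g[OF that] in \<open>simp add: bij_betw_def\<close>)
  show ?thesis
  proof (rule finite_representatives[where h = ?h])
    have "?h N \<in> (\<lambda>(G, p, q). \<lparr>hat = G, pole0 = p, pole1 = q\<rparr>) ` (?T \<times> F \<times> F)" if N: "N \<in> \<N>"
        "card (verts (hat N)) = n" for N
    proof -
      have "hat (?h N) \<in> ?T"
        using graph_map_on[OF is_networkD(1)[OF assms[OF N(1)]] subset_refl g[OF N]] by simp
      moreover have "pole0 (?h N) \<in> F" "pole1 (?h N) \<in> F"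
        using is_networkD(2,3)[OF assms[OF N(1)]] bij_betw_apply[OF g[OF N]] by auto
      ultimately show ?thesis
        by (intro image_eqI[of _ _ "(hat (?h N), pole0 (?h N), pole1 (?h N))"]) simp_all
    qed
    then have "?h ` {N \<in> \<N>. card (verts (hat N)) = n} \<subseteq> (\<lambda>(G, p, q). \<lparr>hat = G, pole0 = p, pole1
        = q\<rparr>) ` (?T \<times> F \<times> F)"
      by blast
    then show "finite (?h ` {N \<in> \<N>. card (verts (hat N)) = n})"
      by (rule finite_subset) (intro finite_imageI finite_SigmaI finite_graphs_on F(1))
    fix N M assume a: "N \<in> \<N>" "M \<in> \<N>" "card (verts (hat N)) = n" "card (verts (hat M)) = n" "?h N = ?h M"
    have "network_iso (numbering F (verts (hat N))) N (?h M)"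
      using iso[OF a(1,3)] unfolding a(5) .
    from network_iso_comp[OF this network_iso_inv[OF assms[OF a(2)] iso[OF a(2,4)]]]
    show "networks_isomorphic N M" unfolding networks_isomorphic_def by blast
  qed
qed

section \<open>Substituted networks are determined by the graph and its core\<close>

lemma doubleton_subset_eq:
  assumes "A \<subseteq> B" "card A = 2" "card B = 2"
  shows "A = B"
  using card_subset_eq[OF card_ge_0_finite assms(1)] assms(2,3) by simp

text \<open>Steps that may arrive at a pole but never start from one.\<close>

definition inner_step :: "'v network \<Rightarrow> ('v \<times> 'v) set" where
  "inner_step N = {(x, y). {x, y} \<in> edges (hat N) \<and> x \<in> internal N}"

text \<open>Deleting pole 1 from N \<union> 01 leaves a connected graph and removes the added edge
  01 as well, so the path to pole 0 consists of edges of N itself.\<close>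

lemma inner_path_pole0:
  assumes N: "is_network N" and u: "u \<in> internal N"
  shows "(u, pole0 N) \<in> (inner_step N)\<^sup>*"
proof -
  note Nd = is_networkD[OF N]
  let ?G = "delete_vertex (add_edge (hat N) (pole0 N) (pole1 N)) (pole1 N)"
  have "graph_connected ?G"
    using N Nd(3) by (auto simp: is_network_def two_connected_def add_edge_def)
  moreover have "u \<in> verts ?G" "pole0 N \<in> verts ?G"
    using u Nd(2,4) by (auto simp: internal_def delete_vertex_def add_edge_def)
  ultimately have "(u, pole0 N) \<in> {(x, y). {x, y} \<in> edges ?G}\<^sup>*"
    by (simp add: graph_connected_def)
  then show ?thesis
  proof (induction rule: converse_rtrancl_induct)
    case (step x y)
    show ?case
    \<comment> \<open>The path is cut at its first visit to pole 0; all vertices before that are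
      internal.\<close>
    proof (cases "x = pole0 N")
      case False
      have "{x, y} \<in> edges (hat N)" "x \<noteq> pole1 N"
        using step(1) by (auto simp: delete_vertex_def add_edge_def doubleton_eq_iff)
      then have "(x, y) \<in> inner_step N"
        using False edges_subset[OF Nd(1)] by (auto simp: inner_step_def internal_def)
      then show ?thesis using step.IH by (rule converse_rtrancl_into_rtrancl)
    qed simp
  qed simp
qed

lemma inner_path_pole1:
  assumes "is_network N" "u \<in> internal N"
  shows "(u, pole1 N) \<in> (inner_step N)\<^sup>*"
  using inner_path_pole0[OF is_network_opposite[OF assms(1)], of u] assms(2)
  by (simp add: inner_step_def) (simp add: opposite_def)

definition outer_step :: "'v graph \<times> 'v graph \<Rightarrow> ('v \<times> 'v) set" where
  "outer_step P = {(x, y). {x, y} \<in> edges (fst P) \<and> x \<notin> verts (snd P)}"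

text \<open>As \<open>N \<union> 01\<close> is 2-connected, an internal vertex of the network on the core edge \<open>e\<close> reaches
  both ends of \<open>e\<close>, and no other core vertex, without passing through the core.\<close>

definition inner_verts :: "'v graph \<times> 'v graph \<Rightarrow> 'v set \<Rightarrow> 'v set" where
  "inner_verts P e = {u \<in> verts (fst P) - verts (snd P). \<forall>a\<in>e. (u, a) \<in> (outer_step P)\<^sup>*}"

definition inner_edges :: "'v graph \<times> 'v graph \<Rightarrow> 'v set \<Rightarrow> 'v set set" where
  "inner_edges P e = {d \<in> edges (fst P). d \<subseteq> e \<union> inner_verts P e}"

definition part :: "'v graph \<times> 'v graph \<Rightarrow> 'v \<Rightarrow> 'v \<Rightarrow> 'v network" where
  "part P a b = \<lparr>hat = \<lparr>verts = {a, b} \<union> inner_verts P {a, b}, edges = inner_edges P {a, b}\<rparr>,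
     pole0 = a, pole1 = b\<rparr>"

lemma part_simps [simp]:
  "verts (hat (part P a b)) = {a, b} \<union> inner_verts P {a, b}"
  "edges (hat (part P a b)) = inner_edges P {a, b}"
  "pole0 (part P a b) = a" "pole1 (part P a b) = b"
  by (simp_all add: part_def)

lemma opposite_part: "opposite (part P a b) = part P b a"
  by (simp add: opposite_def part_def insert_commute)

text \<open>Membership in \<open>edge_substitution\<close> with the family exposed and the species
  replaced by \<open>is_network\<close>. In this form it applies to pairs on any vertex type, in
  particular to glued ones.\<close>

definition substituted :: "'v graph \<times> 'v graph \<Rightarrow> ('v set \<Rightarrow> 'v network) \<Rightarrow> bool" where
  "substituted P Ns \<longleftrightarrow> simple_graph (snd P) \<and>
     (\<forall>e\<in>edges (snd P). is_network (Ns e) \<and> {pole0 (Ns e), pole1 (Ns e)} = e \<and>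
                        internal (Ns e) \<inter> verts (snd P) = {}) \<and>
     disjoint_family_on (\<lambda>e. internal (Ns e)) (edges (snd P)) \<and>
     fst P = \<lparr>verts = verts (snd P) \<union> (\<Union>e\<in>edges (snd P). internal (Ns e)),
              edges = (\<Union>e\<in>edges (snd P). edges (hat (Ns e)))\<rparr>"

lemma substitutedD:
  assumes "substituted P Ns"
  shows "simple_graph (snd P)"
    "\<And>e. e \<in> edges (snd P) \<Longrightarrow> is_network (Ns e)"
    "\<And>e. e \<in> edges (snd P) \<Longrightarrow> {pole0 (Ns e), pole1 (Ns e)} = e"
    "\<And>e. e \<in> edges (snd P) \<Longrightarrow> internal (Ns e) \<inter> verts (snd P) = {}"
    "\<And>e e' u. e \<in> edges (snd P) \<Longrightarrow> e' \<in> edges (snd P) \<Longrightarrow> u \<in> internal (Ns e) \<Longrightarrow> u \<in> internal (Ns e') \<Longrightarrow> e = e'"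
    "verts (fst P) = verts (snd P) \<union> (\<Union>e\<in>edges (snd P). internal (Ns e))"
    "edges (fst P) = (\<Union>e\<in>edges (snd P). edges (hat (Ns e)))"
    "\<And>e. e \<in> edges (snd P) \<Longrightarrow> verts (hat (Ns e)) = e \<union> internal (Ns e)"
proof -
  show net: "\<And>e. e \<in> edges (snd P) \<Longrightarrow> is_network (Ns e)"
    and poles: "\<And>e. e \<in> edges (snd P) \<Longrightarrow> {pole0 (Ns e), pole1 (Ns e)} = e"
    using assms by (auto simp: substituted_def)
  show "\<And>e. e \<in> edges (snd P) \<Longrightarrow> verts (hat (Ns e)) = e \<union> internal (Ns e)"
    using is_networkD(5)[OF net] poles by simp
  show "e = e'" if "e \<in> edges (snd P)" "e' \<in> edges (snd P)" "u \<in> internal (Ns e)"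
      "u \<in> internal (Ns e')" for e e' u
    using assms that unfolding substituted_def disjoint_family_on_def by blast
qed (use assms in \<open>auto simp: substituted_def\<close>)

lemma substituted_inner_verts:
  assumes S: "substituted P Ns" and e: "e \<in> edges (snd P)"
  shows "inner_verts P e = internal (Ns e)"
proof (intro equalityI subsetI)
  note Sd = substitutedD[OF S]
  fix u assume u: "u \<in> internal (Ns e)"
  have "inner_step (Ns e) \<subseteq> outer_step P"
    using Sd(4,7) e by (auto simp: inner_step_def outer_step_def)
  then have "(u, pole0 (Ns e)) \<in> (outer_step P)\<^sup>*" "(u, pole1 (Ns e)) \<in> (outer_step P)\<^sup>*"
    using inner_path_pole0[OF Sd(2)[OF e] u] inner_path_pole1[OF Sd(2)[OF e] u] rtrancl_mono by auto
  then have "\<forall>a\<in>{pole0 (Ns e), pole1 (Ns e)}. (u, a) \<in> (outer_step P)\<^sup>*" by simp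
  then show "u \<in> inner_verts P e"
    unfolding Sd(3)[OF e] using u e Sd(4,6) by (auto simp: inner_verts_def)
next
  note Sd = substitutedD[OF S]
  fix u assume u: "u \<in> inner_verts P e"
  then obtain d where d: "d \<in> edges (snd P)" "u \<in> internal (Ns d)"
    using Sd(6) by (auto simp: inner_verts_def)
  \<comment> \<open>Each step leaves a non-core vertex, which is internal to a single network; the
    edge used therefore belongs to that network, and the walk cannot escape from it.\<close>
  have closed: "y \<in> d \<union> internal (Ns d)" if "(u, y) \<in> (outer_step P)\<^sup>*" for y
    using that
  proof (induction rule: rtrancl_induct)
    case base
    then show ?case using d by simp
  next
    case (step y z)
    have yz: "{y, z} \<in> edges (fst P)" "y \<notin> verts (snd P)" using step(2) by (auto simp: outer_step_def)
    then have y: "y \<in> internal (Ns d)" using step.IH edges_subset[OF Sd(1) d(1)] by blast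
    obtain d' where d': "d' \<in> edges (snd P)" "{y, z} \<in> edges (hat (Ns d'))" using yz(1) Sd(7) by auto
    then have yz': "{y, z} \<subseteq> d' \<union> internal (Ns d')"
      using edges_subset[OF is_networkD(1)[OF Sd(2)[OF d'(1)]] d'(2)] Sd(8)[OF d'(1)] by simp
    then have "y \<in> internal (Ns d')" using yz(2) edges_subset[OF Sd(1) d'(1)] by blast
    then have "d' = d" using Sd(5) d'(1) d(1) y by blast
    then show ?case using yz' by simp
  qed
  have "e \<subseteq> d"
  proof
    fix a assume a: "a \<in> e"
    then have "a \<in> d \<union> internal (Ns d)" using closed u by (simp add: inner_verts_def)
    moreover have "a \<in> verts (snd P)" using a edges_subset[OF Sd(1) e] by blast
    ultimately show "a \<in> d" using Sd(4)[OF d(1)] by blast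
  qed
  then have "e = d" using Sd(1) e d(1) doubleton_subset_eq[of e d]
    by (simp add: simple_graph_def)
  then show "u \<in> internal (Ns e)" using d(2) by simp
qed

text \<open>The doubtful edges join two core vertices. An edge of another network inside e \<union>
  internal (Ns e) would consist of the ends of e and also of the ends of the other core edge, which
  makes the two core edges equal.\<close>

lemma substituted_inner_edges:
  assumes S: "substituted P Ns" and e: "e \<in> edges (snd P)"
  shows "inner_edges P e = edges (hat (Ns e))"
proof (intro equalityI subsetI)
  note Sd = substitutedD[OF S]
  fix d assume "d \<in> edges (hat (Ns e))"
  then show "d \<in> inner_edges P e"
    using edges_subset[OF is_networkD(1)[OF Sd(2)[OF e]]] e Sd(7,8)
    by (auto simp: inner_edges_def substituted_inner_verts[OF S e])
next
  note Sd = substitutedD[OF S]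
  fix d assume "d \<in> inner_edges P e"
  then have d: "d \<in> edges (fst P)" "d \<subseteq> e \<union> internal (Ns e)"
    by (auto simp: inner_edges_def substituted_inner_verts[OF S e])
  then obtain e' where e': "e' \<in> edges (snd P)" "d \<in> edges (hat (Ns e'))" using Sd(7) by auto
  have simple: "simple_graph (hat (Ns e'))" by (rule is_networkD(1)[OF Sd(2)[OF e'(1)]])
  have d': "d \<subseteq> e' \<union> internal (Ns e')" "card d = 2"
    using edges_subset[OF simple e'(2)] Sd(8)[OF e'(1)] simple e'(2) by (auto simp: simple_graph_def)
  have core: "e \<subseteq> verts (snd P)" "e' \<subseteq> verts (snd P)" "card e = 2" "card e' = 2"
    using Sd(1) e e'(1) by (auto simp: simple_graph_def)
  have "e' = e"
  proof (rule ccontr)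
    assume ne: "e' \<noteq> e"
    then have "internal (Ns e) \<inter> internal (Ns e') = {}" using Sd(5) e e'(1) by blast
    then have "d \<subseteq> e" "d \<subseteq> e'"
      using d(2) d'(1) core(1,2) Sd(4)[OF e] Sd(4)[OF e'(1)] by blast+
    then have "d = e" "d = e'"
      using d'(2) core(3,4) doubleton_subset_eq by blast+
    then show False using ne by simp
  qed
  then show "d \<in> edges (hat (Ns e))" using e' by simp
qed

lemma substituted_part:
  assumes S: "substituted P Ns" and e: "e \<in> edges (snd P)"
  shows "part P (pole0 (Ns e)) (pole1 (Ns e)) = Ns e"
  using substitutedD(3,8)[OF S e] substituted_inner_verts[OF S e] substituted_inner_edges[OF S e]
  by (simp add: part_def)

text \<open>The graph and its core do not record which end of an edge was pole 0; the two possible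
  orders differ by \<open>opposite\<close>.\<close>

lemma substituted_part_cases:
  assumes S: "substituted P Ns" and ab: "{a, b} \<in> edges (snd P)"
  shows "part P a b = Ns {a, b} \<or> part P a b = opposite (Ns {a, b})"
proof -
  let ?N = "Ns {a, b}"
  consider "pole0 ?N = a" "pole1 ?N = b" | "pole0 ?N = b" "pole1 ?N = a"
    using substitutedD(3)[OF assms] by (auto simp: doubleton_eq_iff)
  then show ?thesis
  proof cases
    case 2
    then show ?thesis using substituted_part[OF assms] opposite_part[of P b a] by simp
  qed (use substituted_part[OF assms] in simp)
qed

lemma substituted_is_network_part:
  assumes S: "substituted P Ns" and ab: "{a, b} \<in> edges (snd P)"
  shows "is_network (part P a b)"
  using substituted_part_cases[OF assms] substitutedD(2)[OF assms] is_network_opposite by metis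

lemma substituted_wf:
  assumes S: "substituted P Ns"
  shows "wf_pair P"
proof -
  note Sd = substitutedD[OF S]
  have fin: "finite (verts (fst P))"
    unfolding Sd(6) using simple_graph_finite[OF Sd(1)] is_networkD(6)[OF Sd(2)] by auto
  have "d \<subseteq> verts (fst P) \<and> card d = 2" if d: "d \<in> edges (fst P)" for d
  proof -
    obtain e where e: "e \<in> edges (snd P)" "d \<in> edges (hat (Ns e))" using d Sd(7) by auto
    have "simple_graph (hat (Ns e))" by (rule is_networkD(1)[OF Sd(2)[OF e(1)]])
    then have "d \<subseteq> e \<union> internal (Ns e)" "card d = 2"
      using e(2) Sd(8)[OF e(1)] by (auto simp: simple_graph_def)
    then show ?thesis using edges_subset[OF Sd(1) e(1)] e(1) Sd(6) by blast
  qed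
  then show ?thesis using fin Sd(1,6) by (simp add: wf_pair_def simple_graph_def)
qed

section \<open>Isomorphisms of pairs respect the recovered networks\<close>

lemma inner_verts_iso_subset:
  assumes wf: "wf_pair P" and f: "pair_iso f P Q"
  shows "f ` inner_verts P e \<subseteq> inner_verts Q (f ` e)"
proof -
  have P: "simple_graph (fst P)" "verts (snd P) \<subseteq> verts (fst P)" using wf by (auto simp: wf_pair_def)
  have g: "graph_iso f (fst P) (fst Q)" "graph_iso f (snd P) (snd Q)" using f by (auto simp: pair_iso_def)
  have inj: "inj_on f (verts (fst P))" and im: "verts (fst Q) = f ` verts (fst P)"
      "verts (snd Q) = f ` verts (snd P)"
    using g by (auto simp: graph_iso_def bij_betw_def)
  have core: "f x \<notin> verts (snd Q)" if "x \<in> verts (fst P)" "x \<notin> verts (snd P)" for x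
    using that inj P(2) unfolding im(2) by (auto simp: inj_on_def)
  have outer: "(f x, f y) \<in> outer_step Q" if "(x, y) \<in> outer_step P" for x y
  proof -
    have xy: "{x, y} \<in> edges (fst P)" "x \<notin> verts (snd P)" using that by (auto simp: outer_step_def)
    then have "x \<in> verts (fst P)" using edges_subset[OF P(1)] by blast
    then show ?thesis using xy graph_iso_edge[OF g(1)] core by (simp add: outer_step_def)
  qed
  have path: "(f x, f y) \<in> (outer_step Q)\<^sup>*" if "(x, y) \<in> (outer_step P)\<^sup>*" for x y
    using that
  proof (induction rule: rtrancl_induct)
    case (step y z)
    then show ?case using outer by (meson rtrancl_into_rtrancl)
  qed simp
  then show ?thesis using core im(1) by (auto simp: inner_verts_def)
qed

text \<open>Combines the inclusion for f with the inclusion for its inverse.\<close>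

lemma inner_verts_iso:
  assumes wf: "wf_pair P" "wf_pair Q" and f: "pair_iso f P Q" and e: "e \<subseteq> verts (snd P)"
  shows "f ` inner_verts P e = inner_verts Q (f ` e)"
proof (rule equalityI[OF inner_verts_iso_subset[OF wf(1) f]])
  let ?g = "inv_into (verts (fst P)) f"
  have bij: "bij_betw f (verts (fst P)) (verts (fst Q))" using f by (auto simp: pair_iso_def graph_iso_def)
  have e': "e \<subseteq> verts (fst P)" using e wf(1) by (auto simp: wf_pair_def)
  have "?g ` inner_verts Q (f ` e) \<subseteq> inner_verts P (?g ` (f ` e))"
    by (rule inner_verts_iso_subset[OF wf(2) pair_iso_inv[OF wf(1) f]])
  also have "?g ` (f ` e) = e"
    using bij e' by (simp add: inv_into_image_cancel bij_betw_def)
  finally have sub: "?g ` inner_verts Q (f ` e) \<subseteq> inner_verts P e" .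
  show "inner_verts Q (f ` e) \<subseteq> f ` inner_verts P e"
  proof
    fix y assume y: "y \<in> inner_verts Q (f ` e)"
    then have "f (?g y) = y" using bij_betw_inv_into_right[OF bij] by (simp add: inner_verts_def)
    then show "y \<in> f ` inner_verts P e" using sub y by force
  qed
qed

lemma inj_on_image_subset:
  assumes "inj_on f V" "A \<subseteq> V" "B \<subseteq> V"
  shows "f ` A \<subseteq> f ` B \<longleftrightarrow> A \<subseteq> B"
proof
  assume "f ` A \<subseteq> f ` B"
  then have "inv_into V f ` f ` A \<subseteq> inv_into V f ` f ` B" by (rule image_mono)
  then show "A \<subseteq> B" using assms by (simp add: inv_into_image_cancel)
qed (rule image_mono)

lemma inner_edges_iso:
  assumes wf: "wf_pair P" "wf_pair Q" and f: "pair_iso f P Q" and e: "e \<subseteq> verts (snd P)"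
  shows "image f ` inner_edges P e = inner_edges Q (f ` e)"
proof -
  have P: "simple_graph (fst P)" "verts (snd P) \<subseteq> verts (fst P)" using wf by (auto simp: wf_pair_def)
  have g: "inj_on f (verts (fst P))" "edges (fst Q) = image f ` edges (fst P)"
    using f by (auto simp: pair_iso_def graph_iso_def bij_betw_def)
  have "e \<union> inner_verts P e \<subseteq> verts (fst P)" using e P(2) by (auto simp: inner_verts_def)
  then have "f ` d \<subseteq> f ` (e \<union> inner_verts P e) \<longleftrightarrow> d \<subseteq> e \<union> inner_verts P e" if "d \<in> edges (fst P)" for d
    by (rule inj_on_image_subset[OF g(1) edges_subset[OF P(1) that]])
  then show ?thesis
    unfolding inner_edges_def inner_verts_iso[OF assms, symmetric] image_Un[symmetric] g(2) by blast
qed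

text \<open>\<open>part\<close> is built from reachability outside the core and from incidence, both
  of which f preserves, and its poles are simply its arguments.\<close>

lemma part_iso:
  assumes wf: "wf_pair P" "wf_pair Q" and f: "pair_iso f P Q" and ab: "a \<in> verts (snd P)"
      "b \<in> verts (snd P)"
  shows "network_iso f (part P a b) (part Q (f a) (f b))"
proof -
  have "{a, b} \<union> inner_verts P {a, b} \<subseteq> verts (fst P)"
    using ab wf by (auto simp: wf_pair_def inner_verts_def)
  moreover have "inj_on f (verts (fst P))"
    using f by (simp add: pair_iso_def graph_iso_def bij_betw_def)
  ultimately have "inj_on f ({a, b} \<union> inner_verts P {a, b})"
    by (rule inj_on_subset[rotated])
  then show ?thesis
    using inner_verts_iso[OF wf f, of "{a, b}"] inner_edges_iso[OF wf f, of "{a, b}"] ab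
    by (simp add: network_iso_def graph_iso_def bij_betw_def)
qed

lemma internal_part:
  assumes "wf_pair P" "a \<in> verts (snd P)" "b \<in> verts (snd P)"
  shows "internal (part P a b) = inner_verts P {a, b}"
  using assms by (auto simp: internal_def inner_verts_def wf_pair_def)

text \<open>An edge of the new core carries the image of the network on its preimage. Q may have
  another vertex type; that is how a glued pair is brought back to the type of the species.\<close>

lemma substituted_image:
  assumes S: "substituted P Ns" and f: "pair_iso f P Q"
  shows "substituted Q (\<lambda>e. network_map f (Ns (inv_into (verts (fst P)) f ` e)))"
proof -
  note Sd = substitutedD[OF S]
  note wf = substituted_wf[OF S]
  let ?g = "inv_into (verts (fst P)) f"
  have g: "inj_on f (verts (fst P))" "verts (fst Q) = f ` verts (fst P)"
      "edges (fst Q) = image f ` edges (fst P)"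
    "verts (snd Q) = f ` verts (snd P)" "edges (snd Q) = image f ` edges (snd P)"
    using f by (auto simp: pair_iso_def graph_iso_def bij_betw_def)
  have sub: "e \<subseteq> verts (fst P)" if "e \<in> edges (snd P)" for e
    using edges_subset[OF Sd(1) that] Sd(6) by blast
  have bck: "?g ` f ` e = e" if "e \<in> edges (snd P)" for e
    using g(1) sub[OF that] by (simp add: inv_into_image_cancel)
  have V: "verts (hat (Ns e)) \<subseteq> verts (fst P)" if "e \<in> edges (snd P)" for e
    using Sd(6,8) that sub[OF that] by auto
  have iso: "network_iso f (Ns e) (network_map f (Ns e))" if "e \<in> edges (snd P)" for e
    by (rule network_iso_network_map[OF inj_on_subset[OF g(1) V[OF that]]])
  have int: "internal (network_map f (Ns e)) = f ` internal (Ns e)" if "e \<in> edges (snd P)" for e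
    using network_iso_internal[OF Sd(2)[OF that] iso[OF that]] by (simp add: bij_betw_def)
  have int_sub: "internal (Ns e) \<subseteq> verts (fst P)" if "e \<in> edges (snd P)" for e
    using V[OF that] by (auto simp: internal_def)
  have cap: "f ` A \<inter> f ` B = f ` (A \<inter> B)" if "A \<subseteq> verts (fst P)" "B \<subseteq> verts (fst P)" for A B
    using inj_on_image_Int[OF g(1) that] by simp
  show ?thesis
    unfolding substituted_def
  proof (intro conjI ballI)
    show "simple_graph (snd Q)" using f Sd(1) graph_iso_simple by (auto simp: pair_iso_def)
    fix e' assume "e' \<in> edges (snd Q)"
    then obtain e where e: "e \<in> edges (snd P)" "e' = f ` e" using g(5) by auto
    show "is_network (network_map f (Ns (?g ` e')))"
      using is_network_iso[OF Sd(2)[OF e(1)] iso[OF e(1)]] e bck by simp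
    have "f ` {pole0 (Ns e), pole1 (Ns e)} = f ` e" using Sd(3)[OF e(1)] by simp
    then show "{pole0 (network_map f (Ns (?g ` e'))), pole1 (network_map f (Ns (?g ` e')))} = e'"
      using e bck by simp
    show "internal (network_map f (Ns (?g ` e'))) \<inter> verts (snd Q) = {}"
      using cap[OF int_sub[OF e(1)], of "verts (snd P)"] Sd(4)[OF e(1)] Sd(6) e bck int g(4) by auto
  next
    show "disjoint_family_on (\<lambda>e. internal (network_map f (Ns (?g ` e)))) (edges (snd Q))"
      unfolding disjoint_family_on_def
    proof (intro ballI impI)
      fix d' e' assume de': "d' \<in> edges (snd Q)" "e' \<in> edges (snd Q)" "d' \<noteq> e'"
      then obtain d e where de: "d \<in> edges (snd P)" "e \<in> edges (snd P)" "d' = f ` d" "e' = f ` e"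
        unfolding g(5) by blast
      then have "internal (Ns d) \<inter> internal (Ns e) = {}" using Sd(5) de'(3) by blast
      then show "internal (network_map f (Ns (?g ` d'))) \<inter> internal (network_map f (Ns (?g ` e'))) = {}"
        using cap[OF int_sub[OF de(1)] int_sub[OF de(2)]] bck int de by simp
    qed
  next
    have "verts (fst Q) = verts (snd Q) \<union> (\<Union>e\<in>edges (snd Q). internal (network_map f (Ns (?g ` e))))"
    proof -
      have "(\<Union>e\<in>edges (snd Q). internal (network_map f (Ns (?g ` e))))
          = (\<Union>e\<in>edges (snd P). f ` internal (Ns e))"
        unfolding g(5) image_image by (rule SUP_cong[OF refl]) (simp add: bck[unfolded image_image] int)
      moreover have "verts (fst Q) = verts (snd Q) \<union> (\<Union>e\<in>edges (snd P). f ` internal (Ns e))"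
        unfolding g(2,4) by (simp add: Sd(6) image_Un image_UN)
      ultimately show ?thesis by simp
    qed
    moreover have "edges (fst Q) = (\<Union>e\<in>edges (snd Q). edges (hat (network_map f (Ns (?g ` e)))))"
    proof -
      have "(\<Union>e\<in>edges (snd Q). edges (hat (network_map f (Ns (?g ` e)))))
          = (\<Union>e\<in>edges (snd P). image f ` edges (hat (Ns e)))"
        unfolding g(5) image_image by (rule SUP_cong[OF refl]) (simp add: bck[unfolded image_image])
      moreover have "edges (fst Q) = (\<Union>e\<in>edges (snd P). image f ` edges (hat (Ns e)))"
        unfolding g(3) by (simp add: Sd(7) image_UN)
      ultimately show ?thesis by simp
    qed
    ultimately show "fst Q = \<lparr>verts
        = verts (snd Q) \<union> (\<Union>e\<in>edges (snd Q). internal (network_map f (Ns (?g ` e)))),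
         edges = (\<Union>e\<in>edges (snd Q). edges (hat (network_map f (Ns (?g ` e)))))\<rparr>"
      by simp
  qed
qed

lemma edge_substitution_iff:
  assumes "graph_species \<G>" "network_species \<N>"
  shows "P \<in> \<G> \<up> \<N> \<longleftrightarrow> snd P \<in> \<G> \<and> (\<exists>Ns. substituted P Ns \<and> (\<forall>e\<in>edges (snd P). Ns e \<in> \<N>))"
proof
  assume "P \<in> \<G> \<up> \<N>"
  then obtain Ns where core: "snd P \<in> \<G>"
    and Ns: "\<forall>e\<in>edges (snd P). Ns e \<in> \<N> \<and> {pole0 (Ns e), pole1 (Ns e)} = e \<and>
        internal (Ns e) \<inter> verts (snd P) = {}"
      "disjoint_family_on (\<lambda>e. internal (Ns e)) (edges (snd P))"
      "fst P = \<lparr>verts = verts (snd P) \<union> (\<Union>e\<in>edges (snd P). internal (Ns e)),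
                edges = (\<Union>e\<in>edges (snd P). edges (hat (Ns e)))\<rparr>"
    unfolding edge_substitution_def by (cases P) auto
  moreover have "simple_graph (snd P)" "\<forall>N\<in>\<N>. is_network N"
    using assms core by (auto simp: graph_species_def network_species_def)
  ultimately have "substituted P Ns" unfolding substituted_def by simp
  then show "snd P \<in> \<G> \<and> (\<exists>Ns. substituted P Ns \<and> (\<forall>e\<in>edges (snd P). Ns e \<in> \<N>))"
    using core Ns(1) by blast
next
  assume "snd P \<in> \<G> \<and> (\<exists>Ns. substituted P Ns \<and> (\<forall>e\<in>edges (snd P). Ns e \<in> \<N>))"
  then obtain Ns where "snd P \<in> \<G>" "substituted P Ns" "\<forall>e\<in>edges (snd P). Ns e \<in> \<N>" by blast
  then show "P \<in> \<G> \<up> \<N>"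
    unfolding edge_substitution_def substituted_def by (cases P) (auto intro!: exI[of _ Ns])
qed

section \<open>Gluing\<close>

text \<open>Copies are kept apart by tags: \<open>Inl\<close> holds the core vertices,
  \<open>Inr (e, u)\<close> the internal vertex u in the copy on e. The poles are sent to the ends A
  e and B e, which thereby orient e.\<close>

definition glue_map :: "('v set \<Rightarrow> 'v) \<Rightarrow> ('v set \<Rightarrow> 'v) \<Rightarrow> ('v set \<Rightarrow> 'v network) \<Rightarrow> 'v set \<Rightarrow>
    'v \<Rightarrow> 'v + 'v set \<times> 'v" where
  "glue_map A B Ns e u =
     (if u = pole0 (Ns e) then Inl (A e) else if u = pole1 (Ns e) then Inl (B e) else Inr (e, u))"

definition glue :: "'v graph \<Rightarrow> ('v set \<Rightarrow> 'v) \<Rightarrow> ('v set \<Rightarrow> 'v) \<Rightarrow> ('v set \<Rightarrow> 'v network) \<Rightarrow>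
    ('v + 'v set \<times> 'v) graph \<times> ('v + 'v set \<times> 'v) graph" where
  "glue G A B Ns =
     (\<lparr>verts = Inl ` verts G \<union> (\<Union>e\<in>edges G. (\<lambda>u. Inr (e, u)) ` internal (Ns e)),
       edges = (\<Union>e\<in>edges G. image (glue_map A B Ns e) ` edges (hat (Ns e)))\<rparr>,
      graph_map Inl G)"

lemma glue_simps [simp]:
  "verts (fst (glue G A B Ns)) = Inl ` verts G \<union> (\<Union>e\<in>edges G. (\<lambda>u. Inr (e, u)) ` internal (Ns e))"
  "edges (fst (glue G A B Ns)) = (\<Union>e\<in>edges G. image (glue_map A B Ns e) ` edges (hat (Ns e)))"
  "snd (glue G A B Ns) = graph_map Inl G"
  by (simp_all add: glue_def)

locale gluing =
  fixes G :: "'v graph" and A B :: "'v set \<Rightarrow> 'v" and Ns :: "'v set \<Rightarrow> 'v network"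
  assumes G: "simple_graph G"
    and AB: "e \<in> edges G \<Longrightarrow> {A e, B e} = e"
    and net: "e \<in> edges G \<Longrightarrow> is_network (Ns e)"
begin

abbreviation "X \<equiv> glue G A B Ns"
abbreviation "gm \<equiv> glue_map A B Ns"

lemma AB_neq: "e \<in> edges G \<Longrightarrow> A e \<noteq> B e"
proof
  assume "e \<in> edges G" "A e = B e"
  then have "e = {A e}" "card e = 2" using AB[of e] G by (auto simp: simple_graph_def)
  moreover have "card {A e} = 1" by simp
  ultimately show False by simp
qed

lemma AB_verts: "e \<in> edges G \<Longrightarrow> A e \<in> verts G" "e \<in> edges G \<Longrightarrow> B e \<in> verts G"
  using AB edges_subset[OF G] by blast+

lemma gm_simps:
  "gm e (pole0 (Ns e)) = Inl (A e)"
  "e \<in> edges G \<Longrightarrow> gm e (pole1 (Ns e)) = Inl (B e)"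
  "u \<in> internal (Ns e) \<Longrightarrow> gm e u = Inr (e, u)"
  using is_networkD(4)[OF net, of e] by (auto simp: glue_map_def internal_def)

lemma gm_inj: "e \<in> edges G \<Longrightarrow> inj_on (gm e) (verts (hat (Ns e)))"
  using AB_neq[of e] by (auto simp: inj_on_def glue_map_def)

lemma gm_internal: "gm e ` internal (Ns e) = (\<lambda>u. Inr (e, u)) ` internal (Ns e)"
  using gm_simps(3) by (rule image_cong[OF refl])

lemma gm_iso: "e \<in> edges G \<Longrightarrow> network_iso (gm e) (Ns e) (network_map (gm e) (Ns e))"
  by (rule network_iso_network_map[OF gm_inj])

lemma internal_network_map_gm:
  "e \<in> edges G \<Longrightarrow> internal (network_map (gm e) (Ns e)) = (\<lambda>u. Inr (e, u)) ` internal (Ns e)"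
  using network_iso_internal[OF net gm_iso] gm_internal by (simp add: bij_betw_def)

text \<open>Core edges of the glued pair are images under \<open>Inl\<close> of edges of G; taking
  the preimage recovers the edge and hence its network.\<close>

lemma glue_substituted: "substituted X (\<lambda>e. network_map (gm (Inl -` e)) (Ns (Inl -` e)))"
proof -
  have vi [simp]: "Inl -` Inl ` e = e" for e :: "'v set" by auto
  show ?thesis
    unfolding substituted_def
  proof (intro conjI ballI)
    have "graph_iso Inl G (graph_map Inl G)" by (simp add: graph_iso_graph_map)
    then show "simple_graph (snd X)" using graph_iso_simple[OF G] by simp
    fix e' assume "e' \<in> edges (snd X)"
    then obtain e where e: "e \<in> edges G" "e' = Inl ` e" by auto
    show "is_network (network_map (gm (Inl -` e')) (Ns (Inl -` e')))"
      using is_network_iso[OF net gm_iso] e by simp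
    have "Inl ` {A e, B e} = Inl ` e" using AB[OF e(1)] by simp
    then show "{pole0 (network_map (gm (Inl -` e')) (Ns (Inl -` e'))), pole1 (network_map (gm (Inl -`
        e')) (Ns (Inl -` e')))} = e'"
      using e gm_simps by simp
    show "internal (network_map (gm (Inl -` e')) (Ns (Inl -` e'))) \<inter> verts (snd X) = {}"
      using e internal_network_map_gm by auto
  next
    show "disjoint_family_on (\<lambda>e. internal (network_map (gm (Inl -` e)) (Ns (Inl -` e)))) (edges (snd X))"
      using internal_network_map_gm by (auto simp: disjoint_family_on_def)
  next
    show "fst X = \<lparr>verts = verts (snd X) \<union> (\<Union>e\<in>edges (snd X). internal (network_map (gm (Inl -` e))
        (Ns (Inl -` e)))),
        edges = (\<Union>e\<in>edges (snd X). edges (hat (network_map (gm (Inl -` e)) (Ns (Inl -` e)))))\<rparr>"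
      by (simp add: glue_def internal_network_map_gm)
  qed
qed

lemma wf_glue: "wf_pair X"
  by (rule substituted_wf[OF glue_substituted])

lemma part_glue:
  assumes e: "e \<in> edges G"
  shows "part X (Inl (A e)) (Inl (B e)) = network_map (gm e) (Ns e)"
proof -
  have vi: "Inl -` Inl ` e = e" by auto
  have "Inl ` e \<in> edges (snd X)" using e by simp
  from substituted_part[OF glue_substituted this] show ?thesis
    by (simp add: vi gm_simps e)
qed

lemma gm_verts:
  assumes e: "e \<in> edges G" and u: "u \<in> verts (hat (Ns e))"
  shows "gm e u \<in> verts (fst X)"
proof -
  have "gm e u \<in> verts (hat (part X (Inl (A e)) (Inl (B e))))" using u by (simp add: part_glue[OF e])
  then show ?thesis using AB_verts[OF e] by (auto simp: inner_verts_def)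
qed

lemma glue_part_iso:
  assumes e: "e \<in> edges G"
  shows "network_iso (gm e) (Ns e) (part X (Inl (A e)) (Inl (B e)))"
  unfolding part_glue[OF e] by (rule gm_iso[OF e])

text \<open>Universal property of gluing: an isomorphism f of the cores and isomorphisms \<kappa> e
  onto the matching parts fit together because they agree at the poles. The result is bijective
  since in P, too, the internal sets are disjoint from each other and from the core.\<close>

lemma iso_glueI:
  assumes S: "substituted P Ms" and f: "graph_iso f G (snd P)"
    and \<kappa>: "\<And>e. e \<in> edges G \<Longrightarrow> network_iso (\<kappa> e) (Ns e) (part P (f (A e)) (f (B e)))"
    and \<beta>1: "\<And>v. v \<in> verts G \<Longrightarrow> \<beta> (Inl v) = f v"
    and \<beta>2: "\<And>e u. e \<in> edges G \<Longrightarrow> u \<in> internal (Ns e) \<Longrightarrow> \<beta> (Inr (e, u)) = \<kappa> e u"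
  shows "pair_iso \<beta> X P"
    and "\<And>e u. e \<in> edges G \<Longrightarrow> u \<in> verts (hat (Ns e)) \<Longrightarrow> \<beta> (gm e u) = \<kappa> e u"
proof -
  note Sd = substitutedD[OF S]
  note wf = substituted_wf[OF S]
  have inj: "inj_on f (verts G)" and V: "verts (snd P) = f ` verts G" and E:
      "edges (snd P) = image f ` edges G"
    using f by (auto simp: graph_iso_def bij_betw_def)
  have fe: "{f (A e), f (B e)} = f ` e" if "e \<in> edges G" for e
  proof -
    have "f ` {A e, B e} = f ` e" using AB[OF that] by simp
    then show ?thesis by simp
  qed
  have fe': "f ` e \<in> edges (snd P)" if "e \<in> edges G" for e using that E by simp
  have fAB: "f (A e) \<in> verts (snd P)" "f (B e) \<in> verts (snd P)" if "e \<in> edges G" for e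
    using AB_verts[OF that] V by auto
  have \<kappa>int: "bij_betw (\<kappa> e) (internal (Ns e)) (internal (Ms (f ` e)))" if "e \<in> edges G" for e
    using network_iso_internal[OF net[OF that] \<kappa>[OF that]] internal_part[OF wf fAB[OF that]]
      substituted_inner_verts[OF S fe'[OF that]] fe[OF that] by simp
  have \<kappa>edges: "image (\<kappa> e) ` edges (hat (Ns e)) = edges (hat (Ms (f ` e)))" if "e \<in> edges G" for e
    using \<kappa>[OF that] substituted_inner_edges[OF S fe'[OF that]] fe[OF that]
    by (simp add: network_iso_def graph_iso_def)
  show \<beta>gm: "\<beta> (gm e u) = \<kappa> e u" if e: "e \<in> edges G" and u: "u \<in> verts (hat (Ns e))" for e u
  proof -
    consider "u = pole0 (Ns e)" | "u = pole1 (Ns e)" | "u \<in> internal (Ns e)"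
      using u is_networkD(5)[OF net[OF e]] by blast
    then show ?thesis
    proof cases
      case 1
      then show ?thesis using gm_simps(1) \<beta>1 AB_verts[OF e] \<kappa>[OF e] by (simp add: network_iso_def)
    next
      case 2
      then show ?thesis using gm_simps(2)[OF e] \<beta>1 AB_verts[OF e] \<kappa>[OF e] by (simp add: network_iso_def)
    next
      case 3
      then show ?thesis using gm_simps(3) \<beta>2[OF e] by simp
    qed
  qed
  have im1: "\<beta> ` Inl ` verts G = verts (snd P)"
    unfolding V image_image by (rule image_cong[OF refl \<beta>1])
  have im2: "\<beta> ` (\<lambda>u. Inr (e, u)) ` internal (Ns e) = internal (Ms (f ` e))" if "e \<in> edges G" for e
  proof -
    have "\<beta> ` (\<lambda>u. Inr (e, u)) ` internal (Ns e) = \<kappa> e ` internal (Ns e)"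
      unfolding image_image using \<beta>2[OF that] by (rule image_cong[OF refl])
    then show ?thesis using \<kappa>int[OF that] by (simp add: bij_betw_def)
  qed
  have surj: "\<beta> ` verts (fst X) = verts (fst P)"
  proof -
    have "(\<Union>e\<in>edges G. \<beta> ` (\<lambda>u. Inr (e, u)) ` internal (Ns e)) = (\<Union>e\<in>edges G. internal (Ms (f ` e)))"
      by (rule SUP_cong[OF refl im2])
    then show ?thesis
      by (simp only: glue_simps image_Un image_UN im1 Sd(6) E UN_simps)
  qed
  have "inj_on \<beta> (verts (fst X))"
  proof (rule inj_onI)
    fix x y assume xy: "x \<in> verts (fst X)" "y \<in> verts (fst X)" "\<beta> x = \<beta> y"
    have cl: "\<beta> (Inl u) \<in> verts (snd P)" if "u \<in> verts G" for u using that im1 by auto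
    have cr: "\<beta> (Inr (e, u)) \<in> internal (Ms (f ` e))" if "e \<in> edges G" "u \<in> internal (Ns e)" for e u
      using im2[OF that(1)] that(2) by auto
    consider (ll) u v where "x = Inl u" "y = Inl v" "u \<in> verts G" "v \<in> verts G"
      | (lr) u e v where "x = Inl u" "y = Inr (e, v)" "u \<in> verts G" "e \<in> edges G" "v \<in> internal (Ns e)"
      | (rl) u e v where "y = Inl u" "x = Inr (e, v)" "u \<in> verts G" "e \<in> edges G" "v \<in> internal (Ns e)"
      | (rr) d u e v where "x = Inr (d, u)" "y = Inr (e, v)" "d \<in> edges G" "e \<in> edges G"
          "u \<in> internal (Ns d)" "v \<in> internal (Ns e)"
      using xy(1,2) by auto
    then show "x = y"
    proof cases
      case ll
      then show ?thesis using xy(3) \<beta>1 inj by (auto simp: inj_on_def)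
    next
      case lr
      have "\<beta> x \<in> verts (snd P)" "\<beta> y \<in> internal (Ms (f ` e))"
        using lr cl cr by simp_all
      then show ?thesis using Sd(4)[OF fe'[OF lr(4)]] xy(3) by auto
    next
      case rl
      have "\<beta> y \<in> verts (snd P)" "\<beta> x \<in> internal (Ms (f ` e))"
        using rl cl cr by simp_all
      then show ?thesis using Sd(4)[OF fe'[OF rl(4)]] xy(3) by auto
    next
      case rr
      have "\<beta> x \<in> internal (Ms (f ` d))" "\<beta> x \<in> internal (Ms (f ` e))"
        using cr[OF rr(3,5)] cr[OF rr(4,6)] rr(1,2) xy(3) by simp_all
      then have "f ` d = f ` e" using Sd(5)[OF fe'[OF rr(3)] fe'[OF rr(4)]] by blast
      then have "d = e" using inj_on_image_eq_iff[OF inj] edges_subset[OF G] rr(3,4) by blast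
      then show ?thesis
        using rr xy(3) \<beta>2 \<kappa>int[OF rr(3)] by (auto simp: bij_betw_def inj_on_def)
    qed
  qed
  moreover have "image \<beta> ` edges (fst X) = edges (fst P)"
  proof -
    have "image \<beta> ` image (gm e) ` edges (hat (Ns e)) = edges (hat (Ms (f ` e)))" if e: "e \<in> edges G" for e
    proof -
      have "\<beta> ` gm e ` d = \<kappa> e ` d" if "d \<in> edges (hat (Ns e))" for d
        unfolding image_image
        by (intro image_cong refl \<beta>gm[OF e]) (use edges_subset[OF is_networkD(1)[OF net[OF e]] that]
            in blast)
      then have "image \<beta> ` image (gm e) ` edges (hat (Ns e)) = image (\<kappa> e) ` edges (hat (Ns e))"
        unfolding image_image[of "image \<beta>"] by (rule image_cong[OF refl])
      then show ?thesis using \<kappa>edges[OF e] by simp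
    qed
    then show ?thesis by (simp add: image_UN Sd(7) E)
  qed
  ultimately have 1: "graph_iso \<beta> (fst X) (fst P)"
    using surj by (simp add: graph_iso_def bij_betw_def)
  have "graph_iso \<beta> (snd X) (snd P)"
  proof -
    have "inj_on \<beta> (Inl ` verts G)" using inj \<beta>1 by (auto simp: inj_on_def)
    moreover have "image \<beta> ` image Inl ` edges G = image f ` edges G"
    proof -
      have "\<beta> ` Inl ` e = f ` e" if "e \<in> edges G" for e
        unfolding image_image by (intro image_cong refl \<beta>1) (use edges_subset[OF G that] in blast)
      then show ?thesis unfolding image_image[of "image \<beta>"] by (rule image_cong[OF refl])
    qed
    ultimately show ?thesis using im1 E by (simp add: graph_iso_def bij_betw_def)
  qed
  with 1 show "pair_iso \<beta> X P" by (simp add: pair_iso_def)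
qed

text \<open>The converse of \<open>iso_glueI\<close>, by restriction to the copy on e.\<close>

lemma iso_glueD:
  assumes wf: "wf_pair P" and \<beta>: "pair_iso \<beta> X P" and e: "e \<in> edges G"
  shows "network_iso (\<beta> \<circ> gm e) (Ns e) (part P (\<beta> (Inl (A e))) (\<beta> (Inl (B e))))"
  by (rule network_iso_comp[OF glue_part_iso[OF e] part_iso[OF wf_glue wf \<beta>]])
    (use AB_verts[OF e] in simp_all)

lemma iso_glue_core: "pair_iso \<beta> X P \<Longrightarrow> graph_iso (\<beta> \<circ> Inl) G (snd P)"
  by (rule graph_iso_comp[of Inl G "graph_map Inl G"])
    (simp_all add: graph_iso_graph_map pair_iso_def)

end

section \<open>Gluing along the cycles of an automorphism of the core\<close>

text \<open>Nothing distinguishes an edge of a cycle or an order of its ends, so both are chosen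
  once and for all.\<close>

definition root_pair :: "'v set set \<Rightarrow> 'v \<times> 'v" where
  "root_pair C = (SOME p. {fst p, snd p} \<in> C)"

definition root :: "'v set set \<Rightarrow> 'v set" where
  "root C = {fst (root_pair C), snd (root_pair C)}"

definition edge_index :: "('v \<Rightarrow> 'v) \<Rightarrow> 'v set \<Rightarrow> nat" where
  "edge_index \<sigma> e = (LEAST i. (\<sigma> ^^ i) ` root (orbit (image \<sigma>) e) = e)"

text \<open>The first end of the root, carried to e by the least power of \<sigma> that reaches e.
  The exponent has to be fixed: one round later, a Moebius cycle reaches e with its ends
  exchanged.\<close>

definition head :: "('v \<Rightarrow> 'v) \<Rightarrow> 'v set \<Rightarrow> 'v" where
  "head \<sigma> e = (\<sigma> ^^ edge_index \<sigma> e) (fst (root_pair (orbit (image \<sigma>) e)))"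

definition tail :: "('v \<Rightarrow> 'v) \<Rightarrow> 'v set \<Rightarrow> 'v" where
  "tail \<sigma> e = (\<sigma> ^^ edge_index \<sigma> e) (snd (root_pair (orbit (image \<sigma>) e)))"

locale graph_automorphism =
  fixes G :: "'v graph" and \<sigma> :: "'v \<Rightarrow> 'v"
  assumes G: "simple_graph G" and \<sigma>: "\<sigma> \<in> graph_Aut G"
begin

abbreviation "cyc \<equiv> orbit (image \<sigma>)"

lemmas \<sigma>_simps = graph_AutD[OF \<sigma>]

lemma \<sigma>_edges: "image \<sigma> ` edges G \<subseteq> edges G"
  using \<sigma>_simps(3) by simp

lemma self_in_cyc: "e \<in> edges G \<Longrightarrow> e \<in> cyc e"
  using self_in_orbit_bij[OF _ \<sigma>_simps(4)] simple_graph_finite[OF G] by blast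

lemma cyc_subset: "e \<in> edges G \<Longrightarrow> cyc e \<subseteq> edges G"
  by (rule orbit_subset_invariant[OF \<sigma>_edges])

lemma cyc_eq: "e \<in> edges G \<Longrightarrow> d \<in> cyc e \<Longrightarrow> cyc d = cyc e"
  by (rule orbit_eq_if_mem[OF self_in_cyc])

lemma cyc_in: "e \<in> edges G \<Longrightarrow> cyc e \<in> edge_cycles G \<sigma>"
  by (simp add: edge_cycles_def)

lemma edge_cyclesD:
  assumes "C \<in> edge_cycles G \<sigma>"
  shows "root C \<in> C" "C \<subseteq> edges G" "root C \<in> edges G" "cyc (root C) = C" "e \<in> C \<Longrightarrow> cyc e = C"
    "fst (root_pair C) \<noteq> snd (root_pair C)" "card C > 0" "finite C"
proof -
  obtain e where e: "e \<in> edges G" "C = cyc e" using assms by (auto simp: edge_cycles_def)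
  obtain a b where "e = {a, b}" using simple_graph_edgeE[OF G e(1)] by metis
  then have "{fst (a, b), snd (a, b)} \<in> C" using self_in_cyc[OF e(1)] e(2) by simp
  then show r: "root C \<in> C" unfolding root_def root_pair_def by (rule someI)
  show sub: "C \<subseteq> edges G" using cyc_subset e by simp
  show rE: "root C \<in> edges G" using r sub by blast
  show "cyc (root C) = C" "e' \<in> C \<Longrightarrow> cyc e' = C" for e' using cyc_eq r e by auto
  have "card (root C) = 2" using rE G by (simp add: simple_graph_def)
  then show "fst (root_pair C) \<noteq> snd (root_pair C)" unfolding root_def by (auto simp: card_insert_if)
  show fin: "finite C" using sub simple_graph_finite[OF G] finite_subset by blast
  show "card C > 0" using fin r by (auto simp: card_gt_0_iff)
qed

lemma finite_edge_cycles: "finite (edge_cycles G \<sigma>)"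
  using simple_graph_finite[OF G] by (simp add: edge_cycles_def)

lemma cycle_eq:
  assumes C: "C \<in> edge_cycles G \<sigma>"
  shows "C = (\<lambda>i. (\<sigma> ^^ i) ` root C) ` {..<card C}"
    "inj_on (\<lambda>i. (\<sigma> ^^ i) ` root C) {..<card C}"
    "(\<sigma> ^^ card C) ` root C = root C"
  using card_orbit_funpow[OF self_in_cyc[OF edge_cyclesD(3)[OF C]]]
  unfolding funpow_image edge_cyclesD(4)[OF C] by auto

lemma edge_index:
  assumes e: "e \<in> edges G"
  shows "edge_index \<sigma> e < card (cyc e)" "(\<sigma> ^^ edge_index \<sigma> e) ` root (cyc e) = e"
    and "\<And>i. i < card (cyc e) \<Longrightarrow> (\<sigma> ^^ i) ` root (cyc e) = e \<Longrightarrow> edge_index \<sigma> e = i"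
proof -
  note C = cyc_in[OF e]
  have "e \<in> (\<lambda>i. (\<sigma> ^^ i) ` root (cyc e)) ` {..<card (cyc e)}"
    using cycle_eq(1)[OF C] self_in_cyc[OF e] by simp
  then obtain i where i: "i < card (cyc e)" "(\<sigma> ^^ i) ` root (cyc e) = e" by auto
  have "edge_index \<sigma> e \<le> i" unfolding edge_index_def by (rule Least_le) (rule i(2))
  then show 1: "edge_index \<sigma> e < card (cyc e)" using i(1) by simp
  show 2: "(\<sigma> ^^ edge_index \<sigma> e) ` root (cyc e) = e"
    unfolding edge_index_def by (rule LeastI) (rule i(2))
  show "edge_index \<sigma> e = i" if "i < card (cyc e)" "(\<sigma> ^^ i) ` root (cyc e) = e" for i
    using inj_onD[OF cycle_eq(2)[OF C], of "edge_index \<sigma> e" i] 1 2 that by simp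
qed

lemma edge_index_root:
  assumes C: "C \<in> edge_cycles G \<sigma>"
  shows "edge_index \<sigma> (root C) = 0" "head \<sigma> (root C) = fst (root_pair C)"
      "tail \<sigma> (root C) = snd (root_pair C)"
proof -
  show "edge_index \<sigma> (root C) = 0"
    using edge_index(3)[OF edge_cyclesD(3)[OF C], of 0] edge_cyclesD(4,7)[OF C] by simp
  then show "head \<sigma> (root C) = fst (root_pair C)" "tail \<sigma> (root C) = snd (root_pair C)"
    by (simp_all add: head_def tail_def edge_cyclesD(4)[OF C])
qed

lemma image_in_edges: "e \<in> edges G \<Longrightarrow> \<sigma> ` e \<in> edges G"
  using \<sigma>_edges by blast

lemma cyc_image: "e \<in> edges G \<Longrightarrow> cyc (\<sigma> ` e) = cyc e"
  by (rule cyc_eq) (simp_all add: orbit.base)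

text \<open>The images of the root under the exponents below the cycle length are all different, so
  the index of an edge is its exponent there, and only the last exponent leads back to the
  root.\<close>

lemma edge_index_step:
  assumes e: "e \<in> edges G"
  shows "\<sigma> ` e \<noteq> root (cyc e) \<Longrightarrow> edge_index \<sigma> (\<sigma> ` e) = Suc (edge_index \<sigma> e)"
    and "\<sigma> ` e = root (cyc e) \<Longrightarrow> Suc (edge_index \<sigma> e) = card (cyc e)"
proof -
  let ?i = "edge_index \<sigma> e" and ?l = "card (cyc e)"
  note C = cyc_in[OF e]
  have im: "(\<sigma> ^^ Suc ?i) ` root (cyc e) = \<sigma> ` e"
  proof -
    have "(\<sigma> ^^ Suc ?i) ` root (cyc e) = \<sigma> ` (\<sigma> ^^ ?i) ` root (cyc e)" by (simp add: image_comp)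
    then show ?thesis using edge_index(2)[OF e] by simp
  qed
  have lt: "Suc ?i \<le> ?l" using edge_index(1)[OF e] by simp
  show "edge_index \<sigma> (\<sigma> ` e) = Suc ?i" if "\<sigma> ` e \<noteq> root (cyc e)"
  proof -
    have "Suc ?i \<noteq> ?l"
    proof
      assume "Suc ?i = ?l"
      then show False using that im cycle_eq(3)[OF C] by simp
    qed
    then show ?thesis
      using edge_index(3)[OF image_in_edges[OF e], of "Suc ?i"] lt im cyc_image[OF e] by simp
  qed
  show "Suc ?i = ?l" if "\<sigma> ` e = root (cyc e)"
  proof (rule ccontr)
    assume "Suc ?i \<noteq> ?l"
    then have "Suc ?i < ?l" using lt by simp
    moreover have "0 < ?l" using edge_cyclesD(7)[OF C] .
    ultimately have "Suc ?i = 0"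
      using inj_onD[OF cycle_eq(2)[OF C], of "Suc ?i" 0] im that by simp
    then show False by simp
  qed
qed

lemma head_tail: "e \<in> edges G \<Longrightarrow> {head \<sigma> e, tail \<sigma> e} = e"
  using edge_index(2)[of e] by (simp add: head_def tail_def root_def)

lemma head_tail_step:
  assumes e: "e \<in> edges G" "\<sigma> ` e \<noteq> root (cyc e)"
  shows "head \<sigma> (\<sigma> ` e) = \<sigma> (head \<sigma> e)" "tail \<sigma> (\<sigma> ` e) = \<sigma> (tail \<sigma> e)"
  using edge_index_step(1)[OF e] cyc_image[OF e(1)] by (simp_all add: head_def tail_def)

lemma root_return:
  assumes C: "C \<in> edge_cycles G \<sigma>"
  shows "cylindrical \<sigma> C \<Longrightarrow> (\<sigma> ^^ card C) (fst (root_pair C)) = fst (root_pair C)"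
    "cylindrical \<sigma> C \<Longrightarrow> (\<sigma> ^^ card C) (snd (root_pair C)) = snd (root_pair C)"
    "\<not> cylindrical \<sigma> C \<Longrightarrow> (\<sigma> ^^ card C) (fst (root_pair C)) = snd (root_pair C)"
    "\<not> cylindrical \<sigma> C \<Longrightarrow> (\<sigma> ^^ card C) (snd (root_pair C)) = fst (root_pair C)"
  using cylindrical_iff[OF \<sigma>_simps(2) edge_cyclesD(6)[OF C]] self_in_cyc[OF edge_cyclesD(3)[OF C]]
    edge_cyclesD(4)[OF C] unfolding root_def by auto

text \<open>On the last edge of a cycle one more step completes the power
  \<open>card (cyc e)\<close> of \<sigma>, which restores the order of the ends of the root or, for
  a Moebius cycle, reverses it.\<close>

lemma head_tail_return:
  assumes e: "e \<in> edges G" "\<sigma> ` e = root (cyc e)"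
  shows "cylindrical \<sigma> (cyc e) \<Longrightarrow> \<sigma> (head \<sigma> e) = fst (root_pair (cyc e))"
    "cylindrical \<sigma> (cyc e) \<Longrightarrow> \<sigma> (tail \<sigma> e) = snd (root_pair (cyc e))"
    "\<not> cylindrical \<sigma> (cyc e) \<Longrightarrow> \<sigma> (head \<sigma> e) = snd (root_pair (cyc e))"
    "\<not> cylindrical \<sigma> (cyc e) \<Longrightarrow> \<sigma> (tail \<sigma> e) = fst (root_pair (cyc e))"
proof -
  have "\<sigma> ((\<sigma> ^^ edge_index \<sigma> e) v) = (\<sigma> ^^ card (cyc e)) v" for v
    using edge_index_step(2)[OF e, symmetric] by simp
  then have "\<sigma> (head \<sigma> e) = (\<sigma> ^^ card (cyc e)) (fst (root_pair (cyc e)))"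
    "\<sigma> (tail \<sigma> e) = (\<sigma> ^^ card (cyc e)) (snd (root_pair (cyc e)))"
    by (simp_all add: head_def tail_def)
  then show "cylindrical \<sigma> (cyc e) \<Longrightarrow> \<sigma> (head \<sigma> e) = fst (root_pair (cyc e))"
    "cylindrical \<sigma> (cyc e) \<Longrightarrow> \<sigma> (tail \<sigma> e) = snd (root_pair (cyc e))"
    "\<not> cylindrical \<sigma> (cyc e) \<Longrightarrow> \<sigma> (head \<sigma> e) = snd (root_pair (cyc e))"
    "\<not> cylindrical \<sigma> (cyc e) \<Longrightarrow> \<sigma> (tail \<sigma> e) = fst (root_pair (cyc e))"
    using root_return[OF cyc_in[OF e(1)]] by simp_all
qed

end

definition cycle_glue :: "'v graph \<Rightarrow> ('v \<Rightarrow> 'v) \<Rightarrow> ('v set set \<Rightarrow> 'v network \<times> ('v \<Rightarrow> 'v)) \<Rightarrow>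
    ('v + 'v set \<times> 'v) graph \<times> ('v + 'v set \<times> 'v) graph" where
  "cycle_glue G \<sigma> \<nu> = glue G (head \<sigma>) (tail \<sigma>) (\<lambda>e. fst (\<nu> (orbit (image \<sigma>) e)))"

text \<open>The automorphism of the glued graph extends \<open>\<sigma>\<close>, carries each network identically to the next
  edge of the cycle, and applies the chosen symmetry only when the cycle closes up at its root.\<close>

definition twist :: "'v graph \<Rightarrow> ('v \<Rightarrow> 'v) \<Rightarrow> ('v set set \<Rightarrow> 'v network \<times> ('v \<Rightarrow> 'v)) \<Rightarrow>
    'v + 'v set \<times> 'v \<Rightarrow> 'v + 'v set \<times> 'v" where
  "twist G \<sigma> \<nu> x = (if x \<in> verts (fst (cycle_glue G \<sigma> \<nu>)) then
     (case x of Inl v \<Rightarrow> Inl (\<sigma> v)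
      | Inr (e, u) \<Rightarrow> Inr (\<sigma> ` e, if \<sigma> ` e = root (orbit (image \<sigma>) e)
          then snd (\<nu> (orbit (image \<sigma>) e)) u else u))
     else x)"

text \<open>The sign of the chosen symmetry has to match the type of its cycle, because closing the
  cycle returns the ends of the root in order or exchanged.\<close>

locale cycle_gluing = graph_automorphism G \<sigma> for G :: "'v graph" and \<sigma> +
  fixes \<nu> :: "'v set set \<Rightarrow> 'v network \<times> ('v \<Rightarrow> 'v)"
  assumes net\<nu>: "C \<in> edge_cycles G \<sigma> \<Longrightarrow> is_network (fst (\<nu> C))"
    and sym\<nu>: "C \<in> edge_cycles G \<sigma> \<Longrightarrow> snd (\<nu> C) \<in> network_syms (cylindrical \<sigma> C) (fst (\<nu> C))"
begin

abbreviation "Ns \<equiv> \<lambda>e. fst (\<nu> (cyc e))"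

sublocale gluing G "head \<sigma>" "tail \<sigma>" Ns
  by standard (simp_all add: G head_tail net\<nu> cyc_in)

lemma cycle_glue_eq: "cycle_glue G \<sigma> \<nu> = X"
  by (simp add: cycle_glue_def)

abbreviation "tw \<equiv> twist G \<sigma> \<nu>"

lemma sym_in: "C \<in> edge_cycles G \<sigma> \<Longrightarrow> snd (\<nu> C) \<in> graph_Aut (hat (fst (\<nu> C)))"
  using sym\<nu> by (simp add: network_syms_def)

lemma sym_verts: "C \<in> edge_cycles G \<sigma> \<Longrightarrow> u \<in> verts (hat (fst (\<nu> C))) \<Longrightarrow> snd (\<nu> C) u \<in> verts (hat (fst (\<nu> C)))"
  using graph_AutD(1)[OF sym_in] by (simp add: permutes_in_image)

lemma sym_internal: "C \<in> edge_cycles G \<sigma> \<Longrightarrow> u \<in> internal (fst (\<nu> C)) \<Longrightarrow> snd (\<nu> C) u \<in> internal (fst (\<nu> C))"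
proof -
  assume C: "C \<in> edge_cycles G \<sigma>" and u: "u \<in> internal (fst (\<nu> C))"
  have "snd (\<nu> C) ` {pole0 (fst (\<nu> C)), pole1 (fst (\<nu> C))} = {pole0 (fst (\<nu> C)), pole1 (fst (\<nu> C))}"
    using sym\<nu>[OF C] by (auto simp: network_syms_def split: if_splits)
  moreover have "u \<notin> {pole0 (fst (\<nu> C)), pole1 (fst (\<nu> C))}" using u by (simp add: internal_def)
  ultimately have "snd (\<nu> C) u \<notin> {pole0 (fst (\<nu> C)), pole1 (fst (\<nu> C))}"
    using inj_image_mem_iff[OF graph_AutD(2)[OF sym_in[OF C]]] by metis
  then show ?thesis using sym_verts[OF C] u by (simp add: internal_def)
qed

text \<open>\<open>iso_glueI\<close> with the glued pair as its own target: the core moves by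
  \<sigma>, and \<kappa> must send the poles of a copy to the images of head and tail. Along the
  cycle this is \<open>head_tail_step\<close>; where the cycle closes, the sign of the symmetry
  agrees with \<open>head_tail_return\<close>.\<close>

lemma twist_step:
  shows "pair_iso tw X X"
    and "\<And>e u. e \<in> edges G \<Longrightarrow> u \<in> verts (hat (Ns e)) \<Longrightarrow>
        tw (gm e u) = gm (\<sigma> ` e) (if \<sigma> ` e = root (cyc e) then snd (\<nu> (cyc e)) u else u)"
proof -
  define \<kappa> where "\<kappa> e u = gm (\<sigma> ` e) (if \<sigma> ` e = root (cyc e) then snd (\<nu> (cyc e)) u else u)" for e u
  have tw1: "tw (Inl v) = (Inl \<circ> \<sigma>) v" if "v \<in> verts G" for v
    using that by (simp add: twist_def cycle_glue_eq)
  have tw2: "tw (Inr (e, u)) = \<kappa> e u" if e: "e \<in> edges G" and u: "u \<in> internal (Ns e)" for e u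
  proof -
    have "Inr (e, u) \<in> verts (fst X)" using e u by auto
    moreover have "gm (\<sigma> ` e) (snd (\<nu> (cyc e)) u) = Inr (\<sigma> ` e, snd (\<nu> (cyc e)) u)"
      "gm (\<sigma> ` e) u = Inr (\<sigma> ` e, u)"
      using sym_internal[OF cyc_in[OF e] u] u cyc_image[OF e] by (simp_all add: gm_simps(3))
    ultimately show ?thesis
      by (cases "\<sigma> ` e = root (cyc e)") (simp_all add: twist_def cycle_glue_eq \<kappa>_def del: glue_simps)
  qed
  have iso\<sigma>: "graph_iso (Inl \<circ> \<sigma>) G (snd X)"
    by (rule graph_iso_comp[of _ _ G])
      (use \<sigma> in \<open>auto simp: graph_Aut_def intro: graph_iso_graph_map\<close>)
  have \<kappa>: "network_iso (\<kappa> e) (Ns e) (part X ((Inl \<circ> \<sigma>) (head \<sigma> e)) ((Inl \<circ> \<sigma>) (tail \<sigma> e)))"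
    if e: "e \<in> edges G" for e
  proof (cases "\<sigma> ` e = root (cyc e)")
    case False
    then show ?thesis
      using glue_part_iso[OF image_in_edges[OF e]] head_tail_step[OF e False] cyc_image[OF e]
      by (simp add: \<kappa>_def fun_eq_iff cong: if_cong) (simp add: \<kappa>_def[abs_def] False)
  next
    case True
    let ?C = "cyc e" and ?\<tau> = "snd (\<nu> (cyc e))"
    note C = cyc_in[OF e]
    have k: "\<kappa> e = gm (root ?C) \<circ> ?\<tau>" using True by (simp add: \<kappa>_def fun_eq_iff)
    have g: "network_iso (gm (root ?C)) (Ns e) (part X (Inl (fst (root_pair ?C))) (Inl (snd
        (root_pair ?C))))"
      using glue_part_iso[OF edge_cyclesD(3)[OF C]] edge_index_root[OF C] edge_cyclesD(4)[OF C] by simp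
    have t: "graph_iso ?\<tau> (hat (Ns e)) (hat (Ns e))" using sym_in[OF C] by (simp add: graph_Aut_def)
    have gt: "graph_iso (gm (root ?C) \<circ> ?\<tau>) (hat (Ns e)) (hat (part X (Inl (fst (root_pair ?C))) (Inl
        (snd (root_pair ?C)))))"
      by (rule graph_iso_comp[OF t]) (use g in \<open>simp add: network_iso_def\<close>)
    show ?thesis
    proof (cases "cylindrical \<sigma> ?C")
      case cyl: True
      then show ?thesis
        using head_tail_return[OF e True] gt g sym\<nu>[OF C] unfolding k
        by (simp add: network_iso_def network_syms_def)
    next
      case ncyl: False
      \<comment> \<open>The symmetry exchanges the poles, and the ends arrive in reversed order as
        well; the underlying graph of a part does not depend on that order.\<close>
      have "hat (part X (Inl (snd (root_pair ?C))) (Inl (fst (root_pair ?C))))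
          = hat (part X (Inl (fst (root_pair ?C))) (Inl (snd (root_pair ?C))))"
        by (simp add: part_def insert_commute)
      then show ?thesis
        using ncyl head_tail_return[OF e True] gt g sym\<nu>[OF C] unfolding k
        by (simp add: network_iso_def network_syms_def)
    qed
  qed
  show "pair_iso tw X X" "\<And>e u. e \<in> edges G \<Longrightarrow> u \<in> verts (hat (Ns e)) \<Longrightarrow>
        tw (gm e u) = gm (\<sigma> ` e) (if \<sigma> ` e = root (cyc e) then snd (\<nu> (cyc e)) u else u)"
    using iso_glueI[OF glue_substituted iso\<sigma> \<kappa> tw1 tw2] unfolding \<kappa>_def by blast+
qed

lemma twist_Aut: "tw \<in> pair_Aut X"
  by (rule pair_AutI[OF wf_glue twist_step(1)]) (simp add: twist_def cycle_glue_eq)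

lemma twist_Inl: "tw (Inl v) = Inl (\<sigma> v)"
  by (cases "v \<in> verts G") (auto simp: twist_def cycle_glue_eq permutes_not_in[OF \<sigma>_simps(1)])

text \<open>As long as the round has not closed, the twist only copies the network identically from
  edge to edge.\<close>

lemma twist_funpow:
  assumes C: "C \<in> edge_cycles G \<sigma>" and u: "u \<in> verts (hat (fst (\<nu> C)))" and i: "i < card C"
  shows "(tw ^^ i) (gm (root C) u) = gm ((\<sigma> ^^ i) ` root C) u"
  using i
proof (induction i)
  case (Suc i)
  let ?e = "(\<sigma> ^^ i) ` root C"
  have "?e \<in> C" using cycle_eq(1)[OF C] Suc.prems by auto
  then have e: "?e \<in> edges G" "cyc ?e = C" using edge_cyclesD(2,5)[OF C] by auto
  have im: "\<sigma> ` ?e = (\<sigma> ^^ Suc i) ` root C" by (simp add: image_comp)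
  have "\<sigma> ` ?e \<noteq> root C"
    using inj_onD[OF cycle_eq(2)[OF C], of "Suc i" 0] Suc.prems unfolding im by auto
  then show ?case
    using Suc twist_step(2)[OF e(1)] u e(2) im by simp
qed simp

text \<open>The symmetry is applied once per round, at the last step; so a full round acts on the
  root copy as the symmetry itself.\<close>

lemma twist_return:
  assumes C: "C \<in> edge_cycles G \<sigma>" and u: "u \<in> verts (hat (fst (\<nu> C)))"
  shows "(tw ^^ card C) (gm (root C) u) = gm (root C) (snd (\<nu> C) u)"
proof -
  obtain i where i: "card C = Suc i" using edge_cyclesD(7)[OF C] gr0_implies_Suc by blast
  let ?e = "(\<sigma> ^^ i) ` root C"
  have "?e \<in> C" using cycle_eq(1)[OF C] i by auto
  then have e: "?e \<in> edges G" "cyc ?e = C" using edge_cyclesD(2,5)[OF C] by auto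
  have im: "\<sigma> ` ?e = root C" using cycle_eq(3)[OF C] i by (simp add: image_comp)
  have "(tw ^^ card C) (gm (root C) u) = tw (gm ?e u)"
    using twist_funpow[OF C u, of i] i by simp
  then show ?thesis using twist_step(2)[OF e(1)] u e(2) im by simp
qed

lemma twist_unfolding_vertices:
  assumes C: "C \<in> edge_cycles G \<sigma>"
  shows "cycle_unfolding tw (gm (root C)) (card C) (internal (fst (\<nu> C))) (snd (\<nu> C))"
    and "unfold_cycle tw (gm (root C)) (card C) (internal (fst (\<nu> C)))
      = (\<Union>e\<in>C. (\<lambda>u. Inr (e, u)) ` internal (Ns e))"
proof -
  let ?N = "fst (\<nu> C)"
  have V: "u \<in> verts (hat ?N)" if "u \<in> internal ?N" for u using that by (simp add: internal_def)
  have pw: "(tw ^^ i) (gm (root C) u) = Inr ((\<sigma> ^^ i) ` root C, u)"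
      if "i < card C" "u \<in> internal ?N" for i u
  proof -
    have "(\<sigma> ^^ i) ` root C \<in> C" using cycle_eq(1)[OF C] that(1) by auto
    then have "cyc ((\<sigma> ^^ i) ` root C) = C" using edge_cyclesD(5)[OF C] by blast
    then show ?thesis using twist_funpow[OF C V[OF that(2)] that(1)] gm_simps(3) that(2) by simp
  qed
  show "cycle_unfolding tw (gm (root C)) (card C) (internal ?N) (snd (\<nu> C))"
  proof
    show "card C > 0" by (rule edge_cyclesD(7)[OF C])
    show "finite (internal ?N)" by (rule is_networkD(6)[OF net\<nu>[OF C]])
    show "inj_on (gm (root C)) (internal ?N)"
    proof (rule inj_on_subset)
      show "inj_on (gm (root C)) (verts (hat ?N))"
        using gm_inj[OF edge_cyclesD(3)[OF C]] by (simp add: edge_cyclesD(4)[OF C])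
    qed (use V in blast)
    have "inj_on (snd (\<nu> C)) (internal ?N)"
      by (rule inj_on_subset[OF graph_AutD(2)[OF sym_in[OF C]] subset_UNIV])
    then show "bij_betw (snd (\<nu> C)) (internal ?N) (internal ?N)"
      using sym_internal[OF C] is_networkD(6)[OF net\<nu>[OF C]]
      unfolding bij_betw_def by (intro conjI endo_inj_surj) auto
    show "(tw ^^ card C) (gm (root C) u) = gm (root C) (snd (\<nu> C) u)" if "u \<in> internal ?N" for u
      by (rule twist_return[OF C V[OF that]])
    show "i = j" if "i < card C" "j < card C" "u \<in> internal ?N" "v \<in> internal ?N"
      "(tw ^^ i) (gm (root C) u) = (tw ^^ j) (gm (root C) v)" for i j u v
      using that pw inj_onD[OF cycle_eq(2)[OF C], of i j] by simp
  qed
  have "(tw ^^ i) ` gm (root C) ` internal ?N = (\<lambda>u. Inr ((\<sigma> ^^ i) ` root C, u)) ` internal ?N"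
      if "i < card C" for i
    unfolding image_image using pw[OF that] by (rule image_cong[OF refl])
  then have "unfold_cycle tw (gm (root C)) (card C) (internal ?N)
      = (\<Union>i<card C. (\<lambda>u. Inr ((\<sigma> ^^ i) ` root C, u)) ` internal ?N)"
    unfolding unfold_cycle_def by (intro SUP_cong[OF refl]) simp
  also have "\<dots> = (\<Union>e\<in>(\<lambda>i. (\<sigma> ^^ i) ` root C) ` {..<card C}. (\<lambda>u. Inr (e, u)) ` internal ?N)"
    by simp
  also have "\<dots> = (\<Union>e\<in>C. (\<lambda>u. Inr (e, u)) ` internal ?N)"
    using cycle_eq(1)[OF C] by simp
  also have "\<dots> = (\<Union>e\<in>C. (\<lambda>u. Inr (e, u)) ` internal (Ns e))"
    using edge_cyclesD(5)[OF C] by simp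
  finally show "unfold_cycle tw (gm (root C)) (card C) (internal ?N)
      = (\<Union>e\<in>C. (\<lambda>u. Inr (e, u)) ` internal (Ns e))" .
qed

text \<open>Copies on different core edges may share poles, so the disjointness of their edge sets
  needs an argument: a common edge has no internal end, hence joins two core vertices and coincides
  with both core edges.\<close>

lemma gm_edge_disjoint:
  assumes "e \<in> edges G" "e' \<in> edges G" "d \<in> edges (hat (Ns e))" "d' \<in> edges (hat (Ns e'))"
    and "gm e ` d = gm e' ` d'"
  shows "e = e'"
proof -
  have "gm e ` d \<subseteq> Inl ` e \<union> (\<lambda>u. Inr (e, u)) ` internal (Ns e)" "card (gm e ` d) = 2"
    if e: "e \<in> edges G" and d: "d \<in> edges (hat (Ns e))" for e d
  proof -
    have simple: "simple_graph (hat (Ns e))" by (rule is_networkD(1)[OF net[OF e]])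
    have dV: "d \<subseteq> verts (hat (Ns e))" "card d = 2" using simple d by (auto simp: simple_graph_def)
    have "gm e ` d \<subseteq> gm e ` ({pole0 (Ns e), pole1 (Ns e)} \<union> internal (Ns e))"
      using dV(1) is_networkD(5)[OF net[OF e]] by (intro image_mono) simp
    also have "\<dots> = {Inl (head \<sigma> e), Inl (tail \<sigma> e)} \<union> (\<lambda>u. Inr (e, u)) ` internal (Ns e)"
      unfolding image_Un gm_internal by (simp add: gm_simps(1) gm_simps(2)[OF e])
    also have "{Inl (head \<sigma> e), Inl (tail \<sigma> e)} = Inl ` {head \<sigma> e, tail \<sigma> e}" by simp
    also have "{head \<sigma> e, tail \<sigma> e} = e" by (rule head_tail[OF e])
    finally show "gm e ` d \<subseteq> Inl ` e \<union> (\<lambda>u. Inr (e, u)) ` internal (Ns e)" .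
    show "card (gm e ` d) = 2"
      using card_image[OF inj_on_subset[OF gm_inj[OF e] dV(1)]] dV(2) by simp
  qed
  note sub = this
  show ?thesis
  proof (rule ccontr)
    assume ne: "e \<noteq> e'"
    let ?I = "\<lambda>e. (\<lambda>u. Inr (e, u)) ` internal (Ns e) :: ('v + 'v set \<times> 'v) set"
    have "?I e \<inter> (Inl ` e' \<union> ?I e') = {}" "?I e' \<inter> (Inl ` e \<union> ?I e) = {}" using ne by auto
    note disj = this
    have aux: "S \<subseteq> T" if "S \<subseteq> T \<union> U" "S \<subseteq> Z" "U \<inter> Z = {}" for S T U Z :: "('v + 'v set \<times> 'v) set"
      using that by blast
    have "gm e ` d \<subseteq> Inl ` e"
      by (rule aux[OF sub(1)[OF assms(1,3)] _ disj(1)]) (simp only: assms(5) sub(1)[OF assms(2,4)])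
    moreover have "gm e ` d \<subseteq> Inl ` e'"
      unfolding assms(5)
      by (rule aux[OF sub(1)[OF assms(2,4)] _ disj(2)]) (simp only: assms(5)[symmetric] sub(1)[OF
          assms(1,3)])
    moreover have "card e = 2" "card e' = 2"
      using G assms(1,2) by (simp_all add: simple_graph_def)
    then have "card (Inl ` e :: ('v + 'v set \<times> 'v) set) = 2" "card (Inl ` e' :: ('v + 'v set \<times> 'v) set) = 2"
      by (simp_all add: card_image)
    ultimately have "gm e ` d = Inl ` e" "gm e ` d = Inl ` e'"
      using doubleton_subset_eq[OF _ sub(2)[OF assms(1,3)]] by simp_all
    then have "Inl ` e = (Inl ` e' :: ('v + 'v set \<times> 'v) set)" by simp
    then show False using ne by (simp add: inj_image_eq_iff)
  qed
qed

lemma twist_unfolding_edges: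
  assumes C: "C \<in> edge_cycles G \<sigma>"
  shows "cycle_unfolding (image tw) (image (gm (root C))) (card C) (edges (hat (fst (\<nu> C)))) (image
      (snd (\<nu> C)))"
    and "unfold_cycle (image tw) (image (gm (root C))) (card C) (edges (hat (fst (\<nu> C))))
      = (\<Union>e\<in>C. image (gm e) ` edges (hat (Ns e)))"
proof -
  let ?N = "fst (\<nu> C)"
  have simple: "simple_graph (hat ?N)" by (rule is_networkD(1)[OF net\<nu>[OF C]])
  have pw: "(image tw ^^ i) (gm (root C) ` d) = gm ((\<sigma> ^^ i) ` root C) ` d"
    if "i < card C" "d \<in> edges (hat ?N)" for i d
    unfolding funpow_image image_image
    by (intro image_cong refl twist_funpow[OF C _ that(1)]) (use edges_subset[OF simple that(2)] in blast)
  have in_C: "(\<sigma> ^^ i) ` root C \<in> edges G" "Ns ((\<sigma> ^^ i) ` root C) = ?N" if "i < card C" for i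
  proof -
    have "(\<sigma> ^^ i) ` root C \<in> C" using cycle_eq(1)[OF C] that(1) by auto
    then show "(\<sigma> ^^ i) ` root C \<in> edges G" "Ns ((\<sigma> ^^ i) ` root C) = ?N"
      using edge_cyclesD(2,5)[OF C] by auto
  qed
  show "cycle_unfolding (image tw) (image (gm (root C))) (card C) (edges (hat ?N)) (image (snd (\<nu> C)))"
  proof
    show "card C > 0" by (rule edge_cyclesD(7)[OF C])
    show "finite (edges (hat ?N))" using simple_graph_finite[OF simple] by simp
    have "inj_on (gm (root C)) (verts (hat ?N))"
      using gm_inj[OF edge_cyclesD(3)[OF C]] edge_cyclesD(4)[OF C] by simp
    then show "inj_on (image (gm (root C))) (edges (hat ?N))"
      using edges_subset[OF simple] by (auto intro!: inj_onI simp: inj_on_image_eq_iff)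
    show "bij_betw (image (snd (\<nu> C))) (edges (hat ?N)) (edges (hat ?N))"
      by (rule graph_AutD(4)[OF sym_in[OF C]])
    show "(image tw ^^ card C) (gm (root C) ` d) = gm (root C) ` snd (\<nu> C) ` d"
        if "d \<in> edges (hat ?N)" for d
      unfolding funpow_image image_image
      by (intro image_cong refl twist_return[OF C]) (use edges_subset[OF simple that] in blast)
    show "i = j" if "i < card C" "j < card C" "d \<in> edges (hat ?N)" "d' \<in> edges (hat ?N)"
      "(image tw ^^ i) (gm (root C) ` d) = (image tw ^^ j) (gm (root C) ` d')" for i j d d'
      using that pw gm_edge_disjoint[OF in_C(1)[OF that(1)] in_C(1)[OF that(2)], of d d']
        in_C(2)[OF that(1)] in_C(2)[OF that(2)] inj_onD[OF cycle_eq(2)[OF C], of i j] by simp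
  qed
  have "(image tw ^^ i) ` image (gm (root C)) ` edges (hat ?N)
      = image (gm ((\<sigma> ^^ i) ` root C)) ` edges (hat ?N)"
    if "i < card C" for i
    unfolding image_image[of "image tw ^^ i"] using pw[OF that] by (rule image_cong[OF refl])
  then have "unfold_cycle (image tw) (image (gm (root C))) (card C) (edges (hat ?N))
      = (\<Union>i<card C. image (gm ((\<sigma> ^^ i) ` root C)) ` edges (hat ?N))"
    unfolding unfold_cycle_def by (intro SUP_cong[OF refl]) simp
  also have "\<dots> = (\<Union>e\<in>(\<lambda>i. (\<sigma> ^^ i) ` root C) ` {..<card C}. image (gm e) ` edges (hat ?N))"
    by simp
  also have "\<dots> = (\<Union>e\<in>C. image (gm e) ` edges (hat ?N))"
    using cycle_eq(1)[OF C] by simp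
  also have "\<dots> = (\<Union>e\<in>C. image (gm e) ` edges (hat (Ns e)))"
    using edge_cyclesD(5)[OF C] by simp
  finally show "unfold_cycle (image tw) (image (gm (root C))) (card C) (edges (hat ?N))
      = (\<Union>e\<in>C. image (gm e) ` edges (hat (Ns e)))" .
qed

lemma Union_edge_cycles: "(\<Union>e\<in>edges G. Y e) = (\<Union>C\<in>edge_cycles G \<sigma>. \<Union>e\<in>C. Y e)"
  using edge_cyclesD(2) self_in_cyc cyc_in by blast

text \<open>The vertices split into the core and one unfolding for each edge cycle, the edges into
  such unfoldings alone. The core edges have been replaced, so \<sigma> contributes only its vertex
  cycles.\<close>

lemma weight_twist:
  "weight (fst X) tw = vertex_monomial (verts G) \<sigma> + (\<Sum>C\<in>edge_cycles G \<sigma>. dilate_monomial (card C)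
     (vertex_monomial (internal (fst (\<nu> C))) (snd (\<nu> C)) + edge_monomial (edges (hat (fst (\<nu> C))))
         (snd (\<nu> C))))"
proof -
  let ?K = "edge_cycles G \<sigma>"
  let ?W = "\<lambda>C. unfold_cycle tw (gm (root C)) (card C) (internal (fst (\<nu> C)))"
  let ?F = "\<lambda>C. unfold_cycle (image tw) (image (gm (root C))) (card C) (edges (hat (fst (\<nu> C))))"
  have twA: "tw \<in> graph_Aut (fst X)" by (rule pair_AutD(2)[OF twist_Aut])
  have disjC: "e \<notin> C'" if "C \<in> ?K" "C' \<in> ?K" "C \<noteq> C'" "e \<in> C" for C C' e
    using edge_cyclesD(5) that by blast
  \<comment> \<open>On the core the twist is a copy of \<sigma>, that is, an unfolding of length
    1.\<close>
  have core: "cycle_unfolding tw Inl 1 (verts G) \<sigma>"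
    by standard (use simple_graph_finite[OF G] \<sigma>_simps(5) twist_Inl in auto)
  interpret core: cycle_unfolding tw Inl 1 "verts G" \<sigma> by (rule core)
  have Inl: "unfold_cycle tw Inl 1 (verts G) = Inl ` verts G" by (simp add: unfold_cycle_def lessThan_Suc)
  have Vsplit: "verts (fst X) = Inl ` verts G \<union> (\<Union>C\<in>?K. ?W C)"
    unfolding glue_simps Union_edge_cycles by (simp add: twist_unfolding_vertices(2))
  have Wsum: "sum H (orbit tw ` (\<Union>C\<in>?K. ?W C)) = (\<Sum>C\<in>?K. sum H (orbit tw ` ?W C))"
      for H :: "_ \<Rightarrow> wvar \<Rightarrow>\<^sub>0 nat"
  proof (rule sum_orbits_UN[OF finite_edge_cycles])
    fix C assume C: "C \<in> ?K"
    interpret cycle_unfolding tw "gm (root C)" "card C" "internal (fst (\<nu> C))" "snd (\<nu> C)"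
      by (rule twist_unfolding_vertices(1)[OF C])
    show "finite (?W C)" "tw ` ?W C \<subseteq> ?W C" by (rule finite_unfold, rule unfold_invariant)
    show "x \<in> orbit tw x" if "x \<in> ?W C" for x by (rule self_in_orbit_unfold[OF that])
    fix C' assume "C' \<in> ?K" "C \<noteq> C'"
    then show "?W C \<inter> ?W C' = {}"
      using disjC[OF C] by (auto simp: twist_unfolding_vertices(2) C)
  qed
  have Fsum: "sum H (orbit (image tw) ` (\<Union>C\<in>?K. ?F C)) = (\<Sum>C\<in>?K. sum H (orbit (image tw) ` ?F C))"
    for H :: "_ \<Rightarrow> wvar \<Rightarrow>\<^sub>0 nat"
  proof (rule sum_orbits_UN[OF finite_edge_cycles])
    fix C assume C: "C \<in> ?K"
    interpret cycle_unfolding "image tw" "image (gm (root C))" "card C" "edges (hat (fst (\<nu> C)))"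
        "image (snd (\<nu> C))"
      by (rule twist_unfolding_edges(1)[OF C])
    show "finite (?F C)" "image tw ` ?F C \<subseteq> ?F C" by (rule finite_unfold, rule unfold_invariant)
    show "x \<in> orbit (image tw) x" if "x \<in> ?F C" for x by (rule self_in_orbit_unfold[OF that])
    fix C' assume C': "C' \<in> ?K" "C \<noteq> C'"
    show "?F C \<inter> ?F C' = {}"
    proof (rule equals0I)
      fix x assume "x \<in> ?F C \<inter> ?F C'"
      then obtain e d e' d' where x: "e \<in> C" "d \<in> edges (hat (Ns e))" "x = gm e ` d"
        "e' \<in> C'" "d' \<in> edges (hat (Ns e'))" "x = gm e' ` d'"
        unfolding twist_unfolding_edges(2)[OF C] twist_unfolding_edges(2)[OF C'(1)] by blast
      then have "e = e'"
        using gm_edge_disjoint[of e e' d d'] edge_cyclesD(2)[OF C] edge_cyclesD(2)[OF C'(1)] by blast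
      then show False using disjC[OF C C'] x by blast
    qed
  qed
  have "vertex_monomial (verts (fst X)) tw
      = vertex_monomial (Inl ` verts G) tw + (\<Sum>C\<in>?K. vertex_monomial (?W C) tw)"
  proof -
    have fin: "finite (verts (fst X))"
      using wf_glue simple_graph_finite[of "fst X"] unfolding wf_pair_def by blast
    have bij: "x \<in> orbit tw x" if "x \<in> verts (fst X)" for x
      by (rule self_in_orbit_bij[OF fin graph_AutD(5)[OF twA] that])
    have inv: "tw ` ?W C \<subseteq> ?W C" if "C \<in> ?K" for C
      by (rule cycle_unfolding.unfold_invariant[OF twist_unfolding_vertices(1)[OF that]])
    have disj: "Inl ` verts G \<inter> (\<Union>C\<in>?K. ?W C) = {}"
      by (auto simp: twist_unfolding_vertices(2))
    show ?thesis
      unfolding vertex_monomial_def Wsum[symmetric] Vsplit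
    proof (rule sum_orbits_Un)
      show "finite (Inl ` verts G)" using simple_graph_finite[OF G] by simp
      show "finite (\<Union>C\<in>?K. ?W C)" using fin unfolding Vsplit finite_Un by (rule conjunct2)
      show "tw ` Inl ` verts G \<subseteq> Inl ` verts G" using core.unfold_invariant unfolding Inl .
      show "tw ` (\<Union>C\<in>?K. ?W C) \<subseteq> (\<Union>C\<in>?K. ?W C)" using inv by blast
      show "x \<in> orbit tw x" if "x \<in> Inl ` verts G \<union> (\<Union>C\<in>?K. ?W C)" for x
        by (rule bij) (use that Vsplit in simp)
    qed (rule disj)
  qed
  moreover have "vertex_monomial (Inl ` verts G) tw = vertex_monomial (verts G) \<sigma>"
  proof -
    have "dilate_monomial 1 (vertex_monomial (verts G) \<sigma>) = vertex_monomial (verts G) \<sigma>"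
      by (simp add: vertex_monomial_def dilate_monomial_sum)
    then show ?thesis using core.vertex_monomial_unfold unfolding Inl by simp
  qed
  moreover have "vertex_monomial (?W C) tw
      = dilate_monomial (card C) (vertex_monomial (internal (fst (\<nu> C))) (snd (\<nu> C)))"
    if "C \<in> ?K" for C
    by (rule cycle_unfolding.vertex_monomial_unfold[OF twist_unfolding_vertices(1)[OF that]])
  moreover have "edge_monomial (edges (fst X)) tw = (\<Sum>C\<in>?K. edge_monomial (?F C) tw)"
  proof -
    have "edges (fst X) = (\<Union>C\<in>?K. ?F C)"
      unfolding glue_simps Union_edge_cycles by (simp add: twist_unfolding_edges(2))
    then show ?thesis unfolding edge_monomial_def by (simp only: Fsum)
  qed
  moreover have "edge_monomial (?F C) tw
      = dilate_monomial (card C) (edge_monomial (edges (hat (fst (\<nu> C)))) (snd (\<nu> C)))"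
    if C: "C \<in> ?K" for C
  proof (rule edge_monomial_unfold[OF twist_unfolding_edges(1)[OF C]])
    show "inj tw" "inj (snd (\<nu> C))" using graph_AutD(2) twA sym_in[OF C] by blast+
    show "inj_on (gm (root C)) (verts (hat (fst (\<nu> C))))"
      using gm_inj[OF edge_cyclesD(3)[OF C]] edge_cyclesD(4)[OF C] by simp
    show "e \<subseteq> verts (hat (fst (\<nu> C))) \<and> card e = 2" if "e \<in> edges (hat (fst (\<nu> C)))" for e
      using is_networkD(1)[OF net\<nu>[OF C]] that by (simp add: simple_graph_def)
    show "snd (\<nu> C) ` verts (hat (fst (\<nu> C))) \<subseteq> verts (hat (fst (\<nu> C)))" using sym_verts[OF C] by blast
    show "(tw ^^ card C) (gm (root C) v) = gm (root C) (snd (\<nu> C) v)" if "v \<in> verts (hat (fst (\<nu> C)))" for v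
      by (rule twist_return[OF C that])
  qed
  moreover have "weight (fst X) tw = vertex_monomial (verts (fst X)) tw + edge_monomial (edges (fst X)) tw"
    by (rule weight_eq[OF _ twA]) (use wf_glue in \<open>simp add: wf_pair_def\<close>)
  ultimately show ?thesis
    by (simp add: dilate_monomial_add sum.distrib add.assoc cong: sum.cong)
qed

end

section \<open>The index series as sums over structures with an automorphism\<close>

text \<open>A conjugacy is an unfolding of length 1, and dilation by 1 changes no monomial.\<close>

lemma weight_iso:
  assumes G: "simple_graph G" and \<sigma>: "\<sigma> \<in> graph_Aut G" and \<tau>: "\<tau> \<in> graph_Aut H" and f: "graph_iso f G H"
    and comm: "\<And>v. v \<in> verts G \<Longrightarrow> f (\<sigma> v) = \<tau> (f v)"
  shows "weight H \<tau> = weight G \<sigma>"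
proof -
  have f': "inj_on f (verts G)" "verts H = f ` verts G" "edges H = image f ` edges G"
    using f by (auto simp: graph_iso_def bij_betw_def)
  have H: "simple_graph H" by (rule graph_iso_simple[OF G f])
  have commE: "\<tau> ` f ` e = f ` \<sigma> ` e" if "e \<in> edges G" for e
    unfolding image_image using edges_subset[OF G that] comm by (intro image_cong refl) auto
  have V: "cycle_unfolding \<tau> f 1 (verts G) \<sigma>"
    by standard (use simple_graph_finite[OF G] f'(1) graph_AutD(5)[OF \<sigma>] comm in auto)
  have injE: "inj_on (image f) (edges G)"
    using edges_subset[OF G] by (auto intro!: inj_onI simp: inj_on_image_eq_iff[OF f'(1)])
  have E: "cycle_unfolding (image \<tau>) (image f) 1 (edges G) (image \<sigma>)"
    by standard (use simple_graph_finite[OF G] injE graph_AutD(4)[OF \<sigma>] commE in simp_all)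
  have one: "unfold_cycle h k 1 S = k ` S" for h :: "'x \<Rightarrow> 'x" and k :: "'y \<Rightarrow> 'x" and S
    by (simp add: unfold_cycle_def lessThan_Suc)
  have dil: "dilate_monomial 1 (vertex_monomial S \<sigma>) = vertex_monomial S \<sigma>"
    "dilate_monomial 1 (edge_monomial D \<sigma>) = edge_monomial D \<sigma>" for S D
  proof -
    have "scale_var 1 x = x" for x by (cases x) simp_all
    then show "dilate_monomial 1 (vertex_monomial S \<sigma>) = vertex_monomial S \<sigma>"
      "dilate_monomial 1 (edge_monomial D \<sigma>) = edge_monomial D \<sigma>"
      by (simp_all only: vertex_monomial_def edge_monomial_def dilate_monomial_sum dilate_monomial_single)
  qed
  have "vertex_monomial (verts H) \<tau> = vertex_monomial (verts G) \<sigma>"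
    using cycle_unfolding.vertex_monomial_unfold[OF V] unfolding one dil f'(2) .
  moreover have "edge_monomial (edges H) \<tau> = edge_monomial (edges G) \<sigma>"
  proof -
    have "edge_monomial (unfold_cycle (image \<tau>) (image f) 1 (edges G)) \<tau>
        = dilate_monomial 1 (edge_monomial (edges G) \<sigma>)"
      by (rule edge_monomial_unfold[OF E graph_AutD(2)[OF \<tau>] graph_AutD(2)[OF \<sigma>] f'(1)])
        (use G graph_AutD(5)[OF \<sigma>] comm in \<open>auto simp: simple_graph_def bij_betw_def\<close>)
    then show ?thesis unfolding one dil f'(3) .
  qed
  ultimately show ?thesis by (simp add: weight_eq[OF G \<sigma>] weight_eq[OF H \<tau>])
qed

text \<open>The weight without the poles, which avoids the division. Here \<rho> is the symmetry
  already extended to the poles, because edges at the poles are counted too.\<close>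

definition network_monomial :: "'v network \<Rightarrow> ('v \<Rightarrow> 'v) \<Rightarrow> wvar \<Rightarrow>\<^sub>0 nat" where
  "network_monomial N \<rho> = vertex_monomial (internal N) \<rho> + edge_monomial (edges (hat N)) \<rho>"

lemma network_syms_internal:
  assumes "is_network N" "\<rho> \<in> network_syms s N"
  shows "bij_betw \<rho> (internal N) (internal N)"
proof -
  have \<rho>: "bij_betw \<rho> (verts (hat N)) (verts (hat N))" "inj \<rho>"
    using assms(2) graph_AutD by (auto simp: network_syms_def)
  have "\<rho> ` {pole0 N, pole1 N} = {pole0 N, pole1 N}"
    using assms(2) by (auto simp: network_syms_def split: if_splits)
  then have "\<rho> ` internal N = internal N"
    using \<rho> unfolding internal_def bij_betw_def by (simp add: image_set_diff)
  then show ?thesis unfolding bij_betw_def using inj_on_subset[OF \<rho>(2) subset_UNIV] by simp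
qed

text \<open>Two fixed poles form two cycles of length 1, exchanged poles form one cycle of length 2;
  these are the divisors a_1^2 and a_2.\<close>

lemma weight_network:
  assumes N: "is_network N" and \<rho>: "\<rho> \<in> network_syms s N"
  shows "weight (hat N) \<rho> = network_monomial N \<rho> +
    (if s then Poly_Mapping.single (VA 1) 2 else Poly_Mapping.single (VA 2) 1)"
proof -
  note Nd = is_networkD[OF N]
  let ?p = "{pole0 N, pole1 N}"
  have A: "\<rho> \<in> graph_Aut (hat N)" using \<rho> by (simp add: network_syms_def)
  have fin: "finite (verts (hat N))" using simple_graph_finite[OF Nd(1)] by simp
  have self: "x \<in> orbit \<rho> x" if "x \<in> verts (hat N)" for x
    by (rule self_in_orbit_bij[OF fin graph_AutD(5)[OF A] that])
  have inv: "\<rho> ` ?p \<subseteq> ?p" using \<rho> by (auto simp: network_syms_def split: if_splits)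
  have "vertex_monomial (?p \<union> internal N) \<rho> = vertex_monomial ?p \<rho> + vertex_monomial (internal N) \<rho>"
    unfolding vertex_monomial_def
  proof (rule sum_orbits_Un)
    show "\<rho> ` internal N \<subseteq> internal N" using network_syms_internal[OF N \<rho>] by (simp add: bij_betw_def)
    show "x \<in> orbit \<rho> x" if "x \<in> ?p \<union> internal N" for x using self that Nd(5) by simp
    show "?p \<inter> internal N = {}" by (auto simp: internal_def)
  qed (use inv Nd(6) in auto)
  moreover have "vertex_monomial ?p \<rho> =
    (if s then Poly_Mapping.single (VA 1) 2 else Poly_Mapping.single (VA 2) 1)"
  proof (cases s)
    case True
    then have fx: "\<rho> (pole0 N) = pole0 N" "\<rho> (pole1 N) = pole1 N" using \<rho> by (auto simp: network_syms_def)
    have "orbit \<rho> (pole0 N) = {pole0 N}" "orbit \<rho> (pole1 N) = {pole1 N}"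
      using fx by (simp_all add: orbit_eq_singleton_iff)
    then show ?thesis using True Nd(4) by (simp add: vertex_monomial_def numeral_2_eq_2 flip: single_add)
  next
    case False
    then have sw: "\<rho> (pole0 N) = pole1 N" "\<rho> (pole1 N) = pole0 N" using \<rho> by (auto simp: network_syms_def)
    have "orbit \<rho> x = ?p" if "x \<in> ?p" for x
    proof
      show "orbit \<rho> x \<subseteq> ?p" by (rule orbit_subset_invariant[OF inv that])
      have "\<rho> x \<in> orbit \<rho> x" by (rule orbit.base)
      moreover have "x \<in> orbit \<rho> x" using self that Nd(2,3) by blast
      ultimately show "?p \<subseteq> orbit \<rho> x" using that sw by auto
    qed
    then have "orbit \<rho> ` ?p = {?p}" by auto
    then show ?thesis using False Nd(4) by (simp add: vertex_monomial_def numeral_2_eq_2)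
  qed
  ultimately show ?thesis
    unfolding weight_eq[OF Nd(1) A] network_monomial_def Nd(5) by (simp add: ac_simps)
qed

text \<open>An isomorphism from \<open>opposite N\<close> to N is an automorphism of the graph that
  exchanges the poles. So for either sign these are the networks of the species that have a symmetry
  of that sign.\<close>

definition signed_species :: "bool \<Rightarrow> 'v network set \<Rightarrow> 'v network set" where
  "signed_species s \<N> = (if s then \<N> else tau_part \<N>)"

definition network_index :: "bool \<Rightarrow> 'v network set \<Rightarrow> ('v network \<times> ('v \<Rightarrow> 'v)) set" where
  "network_index s \<N> = (SIGMA N:representatives networks_isomorphic (signed_species s \<N>). network_syms s N)"

lemma finite_network_syms: "is_network N \<Longrightarrow> finite (network_syms s N)"
  by (rule finite_subset[OF _ finite_graph_Aut[OF is_networkD(1)]]) (auto simp: network_syms_def)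

lemma vertex_degree_network_monomial:
  assumes "is_network N" "\<rho> \<in> network_syms s N"
  shows "vertex_degree (network_monomial N \<rho>) + 2 = card (verts (hat N))"
proof -
  have "{pole0 N, pole1 N} \<inter> internal N = {}" by (auto simp: internal_def)
  then have "card (verts (hat N)) = card {pole0 N, pole1 N} + card (internal N)"
    unfolding is_networkD(5)[OF assms(1)] using is_networkD(6)[OF assms(1)] by (intro card_Un_disjoint) auto
  then show ?thesis
    using is_networkD(4,6)[OF assms(1)] vertex_degree_vertex_monomial[OF _ network_syms_internal[OF assms]]
    by (simp add: network_monomial_def vertex_degree_add)
qed

lemma representatives_networks:
  assumes "network_species \<N>"
  shows "equivalence_on networks_isomorphic (signed_species s \<N>)"
    and "\<And>N. N \<in> signed_species s \<N> \<Longrightarrow> N \<in> \<N> \<and> is_network N"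
    and "\<And>N. N \<in> representatives networks_isomorphic (signed_species s \<N>) \<Longrightarrow> N \<in> \<N> \<and> is_network N"
proof -
  show 1: "N \<in> \<N> \<and> is_network N" if "N \<in> signed_species s \<N>" for N
    using that assms by (auto simp: signed_species_def tau_part_def network_species_def split: if_splits)
  then show 2: "equivalence_on networks_isomorphic (signed_species s \<N>)"
    by (intro equivalence_on_networks) simp
  show "N \<in> \<N> \<and> is_network N" if "N \<in> representatives networks_isomorphic (signed_species s \<N>)" for N
    using 1 that equivalence_on.representatives_subset[OF 2] by blast
qed

lemma degreewise_finite_network_index:
  fixes \<N> :: "'v :: infinite network set"
  assumes \<N>: "network_species \<N>"
  shows "degreewise_finite (network_index s \<N>) (\<lambda>(N, \<rho>). network_monomial N \<rho>)"
  unfolding degreewise_finite_def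
proof
  fix n
  let ?R = "representatives networks_isomorphic (signed_species s \<N>)"
  note R = representatives_networks[OF \<N>, where s = s]
  \<comment> \<open>The 2 accounts for the poles, which \<open>network_monomial\<close>
    omits.\<close>
  have "finite {N \<in> ?R. card (verts (hat N)) = n + 2}"
    by (rule finite_network_representatives) (simp add: R(2))
  then have "finite (SIGMA N:{N \<in> ?R. card (verts (hat N)) = n + 2}. network_syms s N)"
    by (rule finite_SigmaI) (simp add: finite_network_syms R(3))
  then show "finite {i \<in> network_index s \<N>. vertex_degree (case i of (N, \<rho>) \<Rightarrow> network_monomial N \<rho>) = n}"
    by (rule rev_finite_subset) (auto simp: network_index_def
        vertex_degree_network_monomial[symmetric] R(3))
qed

text \<open>Passes from permutations of the internal vertices to their extensions to the poles. For
  the plus sign the functions are the same; for the minus sign the transposition of the poles is an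
  involution, so composing with it once more undoes it.\<close>

lemma bij_betw_network_syms:
  fixes N :: "'v network"
  assumes N: "is_network N"
  shows "bij_betw (\<lambda>\<tau>. if s then sigma_plus N \<tau> else sigma_minus N \<tau>)
    (if s then Aut_plus N else Aut_minus N) (network_syms s N)"
proof -
  note Nd = is_networkD[OF N]
  have perm: "\<tau> permutes internal N"
      if "\<tau> permutes verts (hat N)" "\<tau> (pole0 N) = pole0 N" "\<tau> (pole1 N) = pole1 N" for \<tau>
    by (rule permutes_superset[OF that(1)]) (use that in \<open>auto simp: internal_def\<close>)
  have fx: "\<tau> (pole0 N) = pole0 N" "\<tau> (pole1 N) = pole1 N" if "\<tau> permutes internal N" for \<tau>
    using that by (auto simp: internal_def permutes_not_in)
  show ?thesis
  proof (cases s)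
    case True
    have "Aut_plus N = network_syms True N"
      using perm fx by (auto simp: Aut_plus_def network_syms_def sigma_plus_def graph_Aut_def)
    then show ?thesis using True by (simp add: sigma_plus_def bij_betw_def)
  next
    case False
    let ?t = "transpose (pole0 N) (pole1 N)"
    have tt: "?t \<circ> (?t \<circ> \<tau>) = \<tau>" for \<tau> :: "'v \<Rightarrow> 'v" by (simp add: fun_eq_iff)
    have tp: "?t permutes verts (hat N)" using Nd(2,3) by (rule permutes_swap_id)
    have "bij_betw (sigma_minus N) (Aut_minus N) (network_syms False N)"
    proof (rule bij_betw_byWitness[where f' = "\<lambda>\<rho>. ?t \<circ> \<rho>"])
      show "sigma_minus N ` Aut_minus N \<subseteq> network_syms False N"
        by (auto simp: Aut_minus_def sigma_minus_def network_syms_def fx)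
      show "(\<lambda>\<rho>. ?t \<circ> \<rho>) ` network_syms False N \<subseteq> Aut_minus N"
      proof (rule image_subsetI)
        fix \<rho> assume \<rho>: "\<rho> \<in> network_syms False N"
        then have "\<rho> permutes verts (hat N)" by (simp add: network_syms_def graph_Aut_def)
        then have "?t \<circ> \<rho> permutes verts (hat N)" using tp by (rule permutes_compose)
        then have "?t \<circ> \<rho> permutes internal N"
          by (rule perm) (use \<rho> in \<open>simp_all add: network_syms_def\<close>)
        then show "?t \<circ> \<rho> \<in> Aut_minus N"
          using \<rho> tt by (simp add: Aut_minus_def sigma_minus_def network_syms_def)
      qed
    qed (simp_all add: sigma_minus_def tt)
    then show ?thesis using False by simp
  qed
qed

definition Walsh_sign :: "bool \<Rightarrow> 'v network set \<Rightarrow> (wvar, rat) mps" where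
  "Walsh_sign s \<N> = (if s then Walsh_plus \<N> else Walsh_minus \<N>)"

lemma Walsh_sign_eq:
  fixes \<N> :: "'v :: infinite network set"
  assumes \<N>: "network_species \<N>"
  shows "Walsh_sign s \<N> = series_of (network_index s \<N>)
    (\<lambda>(N, \<rho>). 1 / of_nat (card (network_syms s N))) (\<lambda>(N, \<rho>). network_monomial N \<rho>)"
proof -
  let ?R = "representatives networks_isomorphic (signed_species s \<N>)"
  define A :: "'v network \<Rightarrow> ('v \<Rightarrow> 'v) set" where "A N = (if s then Aut_plus N else Aut_minus N)" for N
  define h :: "'v network \<Rightarrow> ('v \<Rightarrow> 'v) \<Rightarrow> 'v \<Rightarrow> 'v"
    where "h N \<tau> = (if s then sigma_plus N \<tau> else sigma_minus N \<tau>)" for N \<tau>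
  define w :: "'v network \<Rightarrow> ('v \<Rightarrow> 'v) \<Rightarrow> wvar \<Rightarrow>\<^sub>0 nat"
    where "w N = (if s then weight_plus N else weight_minus N)" for N
  note R = representatives_networks(3)[OF \<N>, where s = s]
  have bij: "bij_betw (h N) (A N) (network_syms s N)" if "N \<in> ?R" for N
    using bij_betw_network_syms[of N s] R[OF that] by (cases s) (simp_all add: h_def[abs_def] A_def)
  have card: "card (A N) = card (network_syms s N)" if "N \<in> ?R" for N
    using bij_betw_same_card[OF bij[OF that]] .
  have wh: "w N \<tau> = network_monomial N (h N \<tau>)" if "N \<in> ?R" "\<tau> \<in> A N" for N \<tau>
  proof -
    have "h N \<tau> \<in> network_syms s N" using bij_betw_apply[OF bij[OF that(1)] that(2)] .
    with R[OF that(1)] have "weight (hat N) (h N \<tau>) = network_monomial N (h N \<tau>) +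
        (if s then Poly_Mapping.single (VA 1) 2 else Poly_Mapping.single (VA 2) 1)"
      by (intro weight_network) simp_all
    then show ?thesis
      by (cases s) (simp_all add: w_def h_def weight_plus_def weight_minus_def)
  qed
  let ?H = "\<lambda>(N, \<tau>). (N, h N \<tau>)"
  have bijS: "bij_betw ?H (Sigma ?R A) (network_index s \<N>)"
  proof -
    have "inj_on ?H (Sigma ?R A)"
      using bij by (auto simp: inj_on_def bij_betw_def)
    moreover have "?H ` Sigma ?R A = network_index s \<N>"
      unfolding network_index_def using bij by (force simp: bij_betw_def)
    ultimately show ?thesis by (simp add: bij_betw_def)
  qed
  have ww: "(case ?H z of (N, \<rho>) \<Rightarrow> network_monomial N \<rho>) = (case z of (N, \<tau>) \<Rightarrow> w N \<tau>)"
      if "z \<in> Sigma ?R A" for z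
    using that wh by auto
  have lf: "locally_finite (Sigma ?R A) (\<lambda>(N, \<tau>). w N \<tau>)"
  proof -
    have "locally_finite (Sigma ?R A) ((\<lambda>(N, \<rho>). network_monomial N \<rho>) \<circ> ?H)"
      using degreewise_finite_imp_locally_finite[OF degreewise_finite_network_index[OF \<N>, of s]]
      unfolding locally_finite_reindex[OF bijS] .
    then show ?thesis using ww unfolding locally_finite_def o_def
      by (simp cong: conj_cong)
  qed
  have finA: "finite (A N)" if "N \<in> ?R" for N
    using bij_betw_finite[OF bij[OF that]] finite_network_syms R[OF that] by blast
  have "Walsh_sign s \<N> = index_series networks_isomorphic A w (signed_species s \<N>)"
    by (cases s) (simp_all add: Walsh_sign_def Walsh_plus_def Walsh_minus_def signed_species_def
        A_def[abs_def] w_def[abs_def])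
  also have "\<dots> = series_of (Sigma ?R A) (\<lambda>(N, \<tau>). 1 / of_nat (card (A N))) (\<lambda>(N, \<tau>). w N \<tau>)"
    by (rule index_series_eq_series_of[OF finA lf])
  also have "\<dots> = series_of (Sigma ?R A)
      ((\<lambda>(N, \<rho>). 1 / of_nat (card (network_syms s N))) \<circ> ?H) ((\<lambda>(N, \<rho>). network_monomial N \<rho>) \<circ> ?H)"
    by (rule series_of_cong) (use card wh in auto)
  also have "\<dots> = series_of (network_index s \<N>)
      (\<lambda>(N, \<rho>). 1 / of_nat (card (network_syms s N))) (\<lambda>(N, \<rho>). network_monomial N \<rho>)"
    by (rule series_of_reindex[OF bijS, symmetric])
  finally show ?thesis .
qed

definition graph_index :: "'v graph set \<Rightarrow> ('v graph \<times> ('v \<Rightarrow> 'v)) set" where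
  "graph_index \<G> = (SIGMA G:representatives graphs_isomorphic \<G>. graph_Aut G)"

definition pair_index :: "('v graph \<times> 'v graph) set \<Rightarrow> (('v graph \<times> 'v graph) \<times> ('v \<Rightarrow> 'v)) set" where
  "pair_index \<P> = (SIGMA P:representatives pairs_isomorphic \<P>. pair_Aut P)"

lemma graph_index_finite:
  fixes \<G> :: "'v :: infinite graph set"
  assumes \<G>: "\<And>G. G \<in> \<G> \<Longrightarrow> simple_graph G"
  shows "finite {i \<in> graph_index \<G>. card (verts (fst i)) = n}"
proof -
  note sub = equivalence_on.representatives_subset[OF equivalence_on_graphs[of \<G>, OF \<G>]]
  have "finite (SIGMA G:{G \<in> representatives graphs_isomorphic \<G>. card (verts G) = n}. graph_Aut G)"
    by (rule finite_SigmaI[OF finite_graph_representatives[OF \<G>]]) (use sub \<G> in \<open>auto intro: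
        finite_graph_Aut\<close>)
  then show ?thesis by (rule rev_finite_subset) (auto simp: graph_index_def)
qed

lemma Walsh_eq:
  fixes \<G> :: "'v :: infinite graph set"
  assumes \<G>: "\<And>G. G \<in> \<G> \<Longrightarrow> simple_graph G"
  shows "Walsh \<G> = series_of (graph_index \<G>) (\<lambda>(G, \<sigma>). 1 / of_nat (card (graph_Aut G))) (\<lambda>(G, \<sigma>).
      weight G \<sigma>)"
    and "locally_finite (graph_index \<G>) (\<lambda>(G, \<sigma>). weight G \<sigma>)"
proof -
  note sub = equivalence_on.representatives_subset[OF equivalence_on_graphs[of \<G>, OF \<G>]]
  show lf: "locally_finite (graph_index \<G>) (\<lambda>(G, \<sigma>). weight G \<sigma>)"
    unfolding locally_finite_def
  proof
    fix m
    have "{i \<in> graph_index \<G>. (case i of (G, \<sigma>) \<Rightarrow> weight G \<sigma>) = m}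
        \<subseteq> {i \<in> graph_index \<G>. card (verts (fst i)) = vertex_degree m}"
      using vertex_degree_weight \<G> sub by (fastforce simp: graph_index_def)
    then show "finite {i \<in> graph_index \<G>. (case i of (G, \<sigma>) \<Rightarrow> weight G \<sigma>) = m}"
      using graph_index_finite[OF \<G>] by (rule finite_subset)
  qed
  show "Walsh \<G> = series_of (graph_index \<G>) (\<lambda>(G, \<sigma>). 1 / of_nat (card (graph_Aut G))) (\<lambda>(G, \<sigma>).
      weight G \<sigma>)"
    unfolding Walsh_def graph_index_def
    by (rule index_series_eq_series_of) (use sub \<G> lf in \<open>auto intro: finite_graph_Aut simp:
        graph_index_def\<close>)
qed

lemma finite_pair_Aut: "wf_pair P \<Longrightarrow> finite (pair_Aut P)"
  using finite_graph_Aut[of "fst P"] by (simp add: pair_Aut_def wf_pair_def)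

lemma Walsh_pairs_eq:
  fixes \<P> :: "('v :: infinite graph \<times> 'v graph) set"
  assumes \<P>: "\<And>P. P \<in> \<P> \<Longrightarrow> wf_pair P"
  shows "Walsh_pairs \<P> = series_of (pair_index \<P>) (\<lambda>(P, \<sigma>). 1 / of_nat (card (pair_Aut P))) (\<lambda>(P, \<sigma>).
      weight (fst P) \<sigma>)"
    and "locally_finite (pair_index \<P>) (\<lambda>(P, \<sigma>). weight (fst P) \<sigma>)"
proof -
  note sub = equivalence_on.representatives_subset[OF equivalence_on_pairs[of \<P>, OF \<P>]]
  show lf: "locally_finite (pair_index \<P>) (\<lambda>(P, \<sigma>). weight (fst P) \<sigma>)"
    unfolding locally_finite_def
  proof
    fix m
    let ?n = "vertex_degree m"
    have "finite (SIGMA P:{P \<in> representatives pairs_isomorphic \<P>. card (verts (fst P)) = ?n}. pair_Aut P)"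
      by (rule finite_SigmaI[OF finite_pair_representatives[OF \<P>]]) (use sub \<P> in \<open>auto intro:
          finite_pair_Aut\<close>)
    moreover have "card (verts (fst P)) = vertex_degree (weight (fst P) \<sigma>)"
        if "(P, \<sigma>) \<in> pair_index \<P>" for P \<sigma>
    proof -
      have "P \<in> \<P>" "\<sigma> \<in> graph_Aut (fst P)"
          using that sub pair_AutD(2)[of \<sigma> P] by (auto simp: pair_index_def)
      then show ?thesis using vertex_degree_weight[of "fst P" \<sigma>] \<P>[of P] by (simp add: wf_pair_def)
    qed
    ultimately show "finite {i \<in> pair_index \<P>. (case i of (P, \<sigma>) \<Rightarrow> weight (fst P) \<sigma>) = m}"
      by (elim rev_finite_subset) (auto simp: pair_index_def)
  qed
  show "Walsh_pairs \<P> = series_of (pair_index \<P>) (\<lambda>(P, \<sigma>). 1 / of_nat (card (pair_Aut P))) (\<lambda>(P, \<sigma>).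
      weight (fst P) \<sigma>)"
    unfolding Walsh_pairs_def pair_index_def
    by (rule index_series_eq_series_of) (use sub \<P> lf in \<open>auto intro: finite_pair_Aut simp: pair_index_def\<close>)
qed

text \<open>The terms of the fully expanded right-hand side of the theorem.\<close>

definition core_index :: "'v graph set \<Rightarrow> 'v network set \<Rightarrow>
    (('v graph \<times> ('v \<Rightarrow> 'v)) \<times> ('v set set \<Rightarrow> 'v network \<times> ('v \<Rightarrow> 'v))) set" where
  "core_index \<G> \<N> = (SIGMA i:graph_index \<G>.
     PiE (edge_cycles (fst i) (snd i)) (\<lambda>C. network_index (cylindrical (snd i) C) \<N>))"

definition core_coeff :: "(('v graph \<times> ('v \<Rightarrow> 'v)) \<times> ('v set set \<Rightarrow> 'v network \<times> ('v \<Rightarrow> 'v))) \<Rightarrow> rat" where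
  "core_coeff = (\<lambda>((G, \<sigma>), \<nu>). 1 / of_nat (card (graph_Aut G)) *
     (\<Prod>C\<in>edge_cycles G \<sigma>. 1 / of_nat (card (network_syms (cylindrical \<sigma> C) (fst (\<nu> C))))))"

definition core_monomial :: "(('v graph \<times> ('v \<Rightarrow> 'v)) \<times> ('v set set \<Rightarrow> 'v network \<times> ('v \<Rightarrow> 'v))) \<Rightarrow> wvar
    \<Rightarrow>\<^sub>0 nat" where
  "core_monomial = (\<lambda>((G, \<sigma>), \<nu>). vertex_monomial (verts G) \<sigma> +
     (\<Sum>C\<in>edge_cycles G \<sigma>. dilate_monomial (card C) (network_monomial (fst (\<nu> C)) (snd (\<nu> C)))))"

text \<open>Every edge cycle C of \<sigma> supplies a factor b or c of index card C, for which a
  dilated network series is substituted; expanding the product over C chooses a network with a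
  symmetry for each cycle. For local finiteness, the vertex degree of a term bounds the size of its
  core, which leaves finitely many (G, \<sigma>), and for each of them the choices form a locally
  finite family.\<close>

lemma Walsh_subst_eq:
  fixes \<G> :: "'v :: infinite graph set" and \<N> :: "'v network set"
  assumes \<G>: "graph_species \<G>" and \<N>: "network_species \<N>"
  shows "mps_subst (Walsh \<G>) (\<lambda>x. case x of
        VA k \<Rightarrow> mps_var (VA k)
      | VB k \<Rightarrow> dilate k (Walsh_plus \<N>)
      | VC k \<Rightarrow> dilate k (Walsh_minus \<N>)) = series_of (core_index \<G> \<N>) core_coeff core_monomial"
    and "locally_finite (core_index \<G> \<N>) core_monomial"
proof -
  have simple: "simple_graph G" if "G \<in> \<G>" for G using that \<G> by (simp add: graph_species_def)
  note subG = equivalence_on.representatives_subset[OF equivalence_on_graphs[of \<G>, OF simple]]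
  define F where "F = (\<lambda>x. case x of
        VA k \<Rightarrow> mps_var (VA k)
      | VB k \<Rightarrow> dilate k (Walsh_plus \<N>)
      | VC k \<Rightarrow> dilate k (Walsh_minus \<N>))"
  define J where "J i = PiE (edge_cycles (fst i) (snd i)) (\<lambda>C. network_index (cylindrical (snd i) C) \<N>)"
    for i :: "'v graph \<times> ('v \<Rightarrow> 'v)"
  define d :: "'v graph \<times> ('v \<Rightarrow> 'v) \<Rightarrow> ('v set set \<Rightarrow> 'v network \<times> ('v \<Rightarrow> 'v)) \<Rightarrow> rat"
    where "d i \<nu> = (\<Prod>C\<in>edge_cycles (fst i) (snd i). 1 / of_nat (card (network_syms (cylindrical (snd
        i) C) (fst (\<nu> C)))))"
    for i \<nu>
  define v :: "'v graph \<times> ('v \<Rightarrow> 'v) \<Rightarrow> ('v set set \<Rightarrow> 'v network \<times> ('v \<Rightarrow> 'v)) \<Rightarrow> wvar \<Rightarrow>\<^sub>0 nat"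
    where "v i \<nu> = vertex_monomial (verts (fst i)) (snd i) +
      (\<Sum>C\<in>edge_cycles (fst i) (snd i). dilate_monomial (card C) (network_monomial (fst (\<nu> C)) (snd (\<nu> C))))"
    for i \<nu>
  have fibre: "eval_monomial F (case i of (G, \<sigma>) \<Rightarrow> weight G \<sigma>)
      = series_of (J i) (d i) (v i) \<and> locally_finite (J i) (v i)"
    if i: "i \<in> graph_index \<G>" for i
  proof -
    obtain G \<sigma> where i': "i = (G, \<sigma>)" by (cases i)
    have G: "simple_graph G" and \<sigma>: "\<sigma> \<in> graph_Aut G" using i i' subG simple by (auto simp: graph_index_def)
    interpret graph_automorphism G \<sigma> by standard (rule G, rule \<sigma>)
    let ?K = "edge_cycles G \<sigma>"
    have Fvar: "F (edge_var \<sigma> C) = series_of (network_index (cylindrical \<sigma> C) \<N>)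
        (\<lambda>z. 1 / of_nat (card (network_syms (cylindrical \<sigma> C) (fst z))))
        (\<lambda>z. dilate_monomial (card C) (network_monomial (fst z) (snd z)))" if "C \<in> ?K" for C
    proof -
      have "F (edge_var \<sigma> C) = dilate (card C) (Walsh_sign (cylindrical \<sigma> C) \<N>)"
        by (simp add: F_def edge_var_def Walsh_sign_def)
      also have "\<dots> = series_of (network_index (cylindrical \<sigma> C) \<N>)
          (\<lambda>(N, \<rho>). 1 / of_nat (card (network_syms (cylindrical \<sigma> C) N)))
          (\<lambda>z. dilate_monomial (card C) (case z of (N, \<rho>) \<Rightarrow> network_monomial N \<rho>))"
        unfolding Walsh_sign_eq[OF \<N>]
        by (rule dilate_series_of[OF degreewise_finite_network_index[OF \<N>] edge_cyclesD(7)[OF that]])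
      finally show ?thesis by (simp add: case_prod_unfold)
    qed
    have lfC: "locally_finite (network_index (cylindrical \<sigma> C) \<N>)
        (\<lambda>z. dilate_monomial (card C) (network_monomial (fst z) (snd z)))" if "C \<in> ?K" for C
      using degreewise_finite_imp_locally_finite[OF
          degreewise_finite_dilate[OF degreewise_finite_network_index[OF \<N>] edge_cyclesD(7)[OF that]]]
      by (simp add: case_prod_unfold)
    let ?J = "\<lambda>C. network_index (cylindrical \<sigma> C) \<N>"
    let ?c = "\<lambda>C z. 1 / of_nat (card (network_syms (cylindrical \<sigma> C) (fst z))) :: rat"
    let ?w = "\<lambda>C z. dilate_monomial (card C) (network_monomial (fst z) (snd z))"
    have prd: "(\<Prod>C\<in>?K. series_of (?J C) (?c C) (?w C))
        = series_of (PiE ?K ?J) (\<lambda>\<nu>. \<Prod>C\<in>?K. ?c C (\<nu> C)) (\<lambda>\<nu>. \<Sum>C\<in>?K. ?w C (\<nu> C))"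
      "locally_finite (PiE ?K ?J) (\<lambda>\<nu>. \<Sum>C\<in>?K. ?w C (\<nu> C))"
      using prod_series_of[OF finite_edge_cycles, of ?J ?w ?c] lfC by blast+
    have "eval_monomial F (weight G \<sigma>)
        = (\<Prod>Z\<in>orbit \<sigma> ` verts G. F (VA (card Z))) * (\<Prod>C\<in>?K. F (edge_var \<sigma> C))"
      unfolding weight_eq[OF G \<sigma>] eval_monomial_add vertex_monomial_def edge_monomial_def eval_monomial_sum
        eval_monomial_single edge_cycles_def by (rule refl)
    also have "(\<Prod>Z\<in>orbit \<sigma> ` verts G. F (VA (card Z))) = mps_term 1 (vertex_monomial (verts G) \<sigma>)"
      by (simp add: F_def prod_mps_term vertex_monomial_def)
    also have "(\<Prod>C\<in>?K. F (edge_var \<sigma> C)) = series_of (J i)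
        (\<lambda>\<nu>. \<Prod>C\<in>?K. 1 / of_nat (card (network_syms (cylindrical \<sigma> C) (fst (\<nu> C)))))
        (\<lambda>\<nu>. \<Sum>C\<in>?K. dilate_monomial (card C) (network_monomial (fst (\<nu> C)) (snd (\<nu> C))))"
      using prd(1) by (simp add: Fvar J_def i' cong: prod.cong)
    also have "mps_term 1 (vertex_monomial (verts G) \<sigma>) * \<dots> = series_of (J i) (d i) (v i)"
      by (subst mps_term_times_series_of(1)) (simp_all add: J_def d_def[abs_def] v_def[abs_def] i' prd(2))
    finally have "eval_monomial F (weight G \<sigma>) = series_of (J i) (d i) (v i)" .
    moreover have "locally_finite (J i) (v i)"
      using mps_term_times_series_of(2)[OF prd(2)] by (simp add: J_def v_def[abs_def] i')
    ultimately show ?thesis by (simp add: i')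
  qed
  have core: "core_index \<G> \<N> = Sigma (graph_index \<G>) J" "core_monomial = (\<lambda>(i, \<nu>). v i \<nu>)"
    "core_coeff = (\<lambda>(i, \<nu>). (\<lambda>(G, \<sigma>). 1 / of_nat (card (graph_Aut G))) i * d i \<nu>)"
    by (auto simp: core_index_def core_monomial_def core_coeff_def J_def d_def v_def fun_eq_iff)
  have lf: "locally_finite (Sigma (graph_index \<G>) J) (\<lambda>(i, \<nu>). v i \<nu>)"
    unfolding locally_finite_def
  proof
    fix m
    let ?A = "\<Union>n\<le>vertex_degree m. {i \<in> graph_index \<G>. card (verts (fst i)) = n}"
    have "finite ?A" using graph_index_finite[OF simple] by simp
    then have fin: "finite (SIGMA i:?A. {\<nu> \<in> J i. v i \<nu> = m})"
      by (rule finite_SigmaI) (use fibre in \<open>auto simp: locally_finite_def\<close>)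
    have deg: "card (verts G) \<le> vertex_degree (v (G, \<sigma>) \<nu>)" if "(G, \<sigma>) \<in> graph_index \<G>" for G \<sigma> \<nu>
    proof -
      have G: "simple_graph G" and \<sigma>: "\<sigma> \<in> graph_Aut G"
          using that subG simple by (auto simp: graph_index_def)
      show ?thesis
        using vertex_degree_vertex_monomial[OF _ graph_AutD(5)[OF \<sigma>]] simple_graph_finite[OF G]
        by (simp add: v_def vertex_degree_add)
    qed
    show "finite {z \<in> Sigma (graph_index \<G>) J. (case z of (i, \<nu>) \<Rightarrow> v i \<nu>) = m}"
      by (rule finite_subset[OF _ fin]) (use deg in auto)
  qed
  then show "locally_finite (core_index \<G> \<N>) core_monomial" unfolding core .
  have "mps_subst (series_of (graph_index \<G>) (\<lambda>(G, \<sigma>). 1 / of_nat (card (graph_Aut G))) (\<lambda>(G, \<sigma>).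
      weight G \<sigma>)) F
      = series_of (core_index \<G> \<N>) core_coeff core_monomial"
    unfolding core
    by (rule mps_subst_series_of[OF Walsh_eq(2) lf]) (use fibre simple in blast)+
  then have "mps_subst (Walsh \<G>) F = series_of (core_index \<G> \<N>) core_coeff core_monomial"
    using Walsh_eq(1)[of \<G>] simple by simp
  then show "mps_subst (Walsh \<G>) (\<lambda>x. case x of
        VA k \<Rightarrow> mps_var (VA k)
      | VB k \<Rightarrow> dilate k (Walsh_plus \<N>)
      | VC k \<Rightarrow> dilate k (Walsh_minus \<N>)) = series_of (core_index \<G> \<N>) core_coeff core_monomial"
    unfolding F_def .
qed

section \<open>Counting realizations\<close>

text \<open>The incidence relation of the double count. The isomorphisms are collected rather than
  merely asserted to exist, because it is their number that the denominators |Aut|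
  compensate.\<close>

definition realizations :: "('v graph \<times> 'v graph) \<times> ('v \<Rightarrow> 'v) \<Rightarrow>
    ('v graph \<times> ('v \<Rightarrow> 'v)) \<times> ('v set set \<Rightarrow> 'v network \<times> ('v \<Rightarrow> 'v)) \<Rightarrow> ('v + 'v set \<times> 'v \<Rightarrow> 'v) set" where
  "realizations = (\<lambda>(P, \<tau>) ((G, \<sigma>), \<nu>). {\<beta> \<in> pair_isos (cycle_glue G \<sigma> \<nu>) P.
     \<forall>d\<in>verts (fst (cycle_glue G \<sigma> \<nu>)). \<beta> (twist G \<sigma> \<nu> d) = \<tau> (\<beta> d)})"

context cycle_gluing
begin

lemma realizations_eq:
  "realizations (P, \<tau>) ((G, \<sigma>), \<nu>) = {\<beta> \<in> pair_isos X P. \<forall>d\<in>verts (fst X). \<beta> (tw d) = \<tau> (\<beta> d)}"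
  by (simp add: realizations_def cycle_glue_eq)

lemma realization_weight:
  assumes "\<tau> \<in> pair_Aut P" "\<beta> \<in> realizations (P, \<tau>) ((G, \<sigma>), \<nu>)"
  shows "core_monomial ((G, \<sigma>), \<nu>) = weight (fst P) \<tau>"
proof -
  have \<beta>: "pair_iso \<beta> X P" "\<And>d. d \<in> verts (fst X) \<Longrightarrow> \<beta> (tw d) = \<tau> (\<beta> d)"
    using assms(2) by (auto simp: realizations_eq pair_isos_def)
  have "weight (fst P) \<tau> = weight (fst X) tw"
  proof (rule weight_iso)
    show "simple_graph (fst X)" using wf_glue unfolding wf_pair_def by blast
    show "tw \<in> graph_Aut (fst X)" by (rule pair_AutD(2)[OF twist_Aut])
    show "\<tau> \<in> graph_Aut (fst P)" by (rule pair_AutD(2)[OF assms(1)])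
    show "graph_iso \<beta> (fst X) (fst P)" using \<beta>(1) unfolding pair_iso_def by blast
    show "\<beta> (tw v) = \<tau> (\<beta> v)" if "v \<in> verts (fst X)" for v using \<beta>(2)[OF that] .
  qed
  then show ?thesis by (simp add: weight_twist core_monomial_def network_monomial_def)
qed

lemma finite_pair_isos:
  assumes "wf_pair P"
  shows "finite (pair_isos X P)"
proof (rule finite_subset)
  show "pair_isos X P \<subseteq> PiE (verts (fst X)) (\<lambda>_. verts (fst P))"
    by (auto simp: pair_isos_def pair_iso_def PiE_def extensional_def dest: graph_iso_verts simp del:
        glue_simps)
  have "finite (verts (fst X))" "finite (verts (fst P))"
    using wf_glue assms simple_graph_finite unfolding wf_pair_def by blast+
  then show "finite (PiE (verts (fst X)) (\<lambda>_. verts (fst P)))" by (intro finite_PiE)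
qed

text \<open>Each isomorphism \<beta> carries the twist to exactly one automorphism of P, the
  conjugate of the twist by \<beta>. So the sum counts every isomorphism onto P once, and there are
  |Aut P| of them.\<close>

lemma sum_card_realizations:
  assumes P: "wf_pair P" and h: "pair_iso h X P"
  shows "(\<Sum>\<tau>\<in>pair_Aut P. card (realizations (P, \<tau>) ((G, \<sigma>), \<nu>))) = card (pair_Aut P)"
proof -
  let ?R = "\<lambda>\<tau>. realizations (P, \<tau>) ((G, \<sigma>), \<nu>)"
  have "(\<Sum>\<tau>\<in>pair_Aut P. card (?R \<tau>)) = card (\<Union>\<tau>\<in>pair_Aut P. ?R \<tau>)"
  proof (rule card_UN_disjoint[symmetric])
    show "finite (pair_Aut P)" by (rule finite_pair_Aut[OF P])
    show "\<forall>\<tau>\<in>pair_Aut P. finite (?R \<tau>)"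
      using finite_pair_isos[OF P] by (auto simp: realizations_eq)
    show "\<forall>\<tau>\<in>pair_Aut P. \<forall>\<tau>'\<in>pair_Aut P. \<tau> \<noteq> \<tau>' \<longrightarrow> ?R \<tau> \<inter> ?R \<tau>' = {}"
    proof (intro ballI impI, rule equals0I)
      fix \<tau> \<tau>' \<beta> assume t: "\<tau> \<in> pair_Aut P" "\<tau>' \<in> pair_Aut P" "\<tau> \<noteq> \<tau>'" "\<beta> \<in> ?R \<tau> \<inter> ?R \<tau>'"
      then have im: "\<beta> ` verts (fst X) = verts (fst P)"
        and eq: "\<And>d. d \<in> verts (fst X) \<Longrightarrow> \<tau> (\<beta> d) = \<tau>' (\<beta> d)"
        by (auto simp: realizations_eq pair_isos_def pair_iso_def graph_iso_def bij_betw_def simp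
            del: glue_simps)
      have "\<tau> v = \<tau>' v" for v
      proof (cases "v \<in> verts (fst P)")
        case True
        then show ?thesis using eq unfolding im[symmetric] by blast
      next
        case False
        then show ?thesis
          using graph_AutD(1)[OF pair_AutD(2)[OF t(1)]] graph_AutD(1)[OF pair_AutD(2)[OF t(2)]]
          by (simp add: permutes_not_in)
      qed
      then show False using t(3) by blast
    qed
  qed
  also have "(\<Union>\<tau>\<in>pair_Aut P. ?R \<tau>) = pair_isos X P"
  proof (intro equalityI subsetI)
    fix \<beta> assume \<beta>: "\<beta> \<in> pair_isos X P"
    then have iso: "pair_iso \<beta> X P" by (simp add: pair_isos_def)
    then have bij: "bij_betw \<beta> (verts (fst X)) (verts (fst P))" by (simp add: pair_iso_def graph_iso_def)
    let ?b = "inv_into (verts (fst X)) \<beta>"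
    define \<tau> where "\<tau> v = (if v \<in> verts (fst P) then \<beta> (tw (?b v)) else v)" for v
    have "pair_iso (\<beta> \<circ> (tw \<circ> ?b)) P P"
      using pair_iso_inv[OF wf_glue iso] twist_step(1) iso by (blast intro: pair_iso_comp)
    then have "pair_iso \<tau> P P" by (rule pair_iso_cong[OF P, rotated]) (simp add: \<tau>_def)
    then have "\<tau> \<in> pair_Aut P" by (rule pair_AutI[OF P]) (simp add: \<tau>_def)
    moreover have "\<beta> \<in> ?R \<tau>"
      using \<beta> bij_betw_inv_into_left[OF bij] bij_betw_apply[OF bij]
      by (simp add: realizations_eq \<tau>_def del: glue_simps)
    ultimately show "\<beta> \<in> (\<Union>\<tau>\<in>pair_Aut P. ?R \<tau>)" by blast
  qed (auto simp: realizations_eq)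
  also have "card (pair_isos X P) = card (pair_Aut P)"
    by (rule card_pair_isos[OF P h wf_glue])
  finally show ?thesis .
qed

text \<open>The glued graph is finite and the vertex type infinite, so the pair can be relabelled
  from the sum type into that type. Its networks are known there only up to orientation, hence the
  use of symmetry.\<close>

lemma glue_representative:
  fixes \<G> :: "'v graph set"
  assumes sp: "graph_species \<G>" "network_species \<N>" "symmetric_species \<N>"
    and inf: "infinite (UNIV :: 'v set)"
    and mem: "G \<in> \<G>" "\<And>C. C \<in> edge_cycles G \<sigma> \<Longrightarrow> fst (\<nu> C) \<in> \<N>"
  obtains P h where "P \<in> \<G> \<up> \<N>" "pair_iso h X P"
proof -
  let ?V = "verts (fst X)"
  have fin: "finite ?V" using wf_glue simple_graph_finite unfolding wf_pair_def by blast
  obtain F :: "'v set" where F: "finite F" "card F = card ?V"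
    using infinite_arbitrarily_large[OF inf] by blast
  obtain j where j: "bij_betw j ?V F" using finite_same_card_bij[OF fin F(1)] F(2) by auto
  define P where "P = (graph_map j (fst X), graph_map j (snd X))"
  have inj: "inj_on j ?V" using j by (simp add: bij_betw_def)
  have "verts (snd X) \<subseteq> ?V" using wf_glue unfolding wf_pair_def by blast
  then have iso: "pair_iso j X P"
    unfolding pair_iso_def P_def fst_conv snd_conv
    using inj inj_on_subset[OF inj] by (intro conjI graph_iso_graph_map)
  obtain Ms where S: "substituted P Ms" using substituted_image[OF glue_substituted iso] by blast
  have core: "graph_iso (j \<circ> Inl) G (snd P)" by (rule iso_glue_core[OF iso])
  have "simple_graph (snd P)" by (rule substitutedD(1)[OF S])
  then have "snd P \<in> \<G>"
    using sp(1) mem(1) core unfolding graph_species_def graphs_isomorphic_def by blast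
  moreover have "Ms e' \<in> \<N>" if e': "e' \<in> edges (snd P)" for e'
  proof -
    have "e' \<in> image (j \<circ> Inl) ` edges G" using core e' unfolding graph_iso_def by blast
    then obtain e where e: "e \<in> edges G" "e' = (j \<circ> Inl) ` e" by blast
    let ?a = "j (Inl (head \<sigma> e))" and ?b = "j (Inl (tail \<sigma> e))"
    have "(j \<circ> Inl) ` {head \<sigma> e, tail \<sigma> e} = e'" unfolding e(2) head_tail[OF e(1)] ..
    then have ab: "{?a, ?b} = e'" by simp
    have pN: "part P ?a ?b \<in> \<N>"
      using network_species_iso[OF sp(2) mem(2)[OF cyc_in[OF e(1)]] iso_glueD[OF substituted_wf[OF S]
          iso e(1)]] .
    then have "opposite (part P ?a ?b) \<in> \<N>" using sp(3) by (simp add: symmetric_species_def)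
    moreover have "Ms e' = part P ?a ?b \<or> Ms e' = opposite (part P ?a ?b)"
    proof -
      have "part P ?a ?b = Ms e' \<or> part P ?a ?b = opposite (Ms e')"
        using substituted_part_cases[OF S, of ?a ?b] e' unfolding ab by blast
      moreover have "opposite (opposite (Ms e')) = Ms e'" by (simp add: opposite_def)
      ultimately show ?thesis by auto
    qed
    ultimately show ?thesis using pN by auto
  qed
  ultimately have "P \<in> \<G> \<up> \<N>" unfolding edge_substitution_iff[OF sp(1,2)] using S by blast
  then show thesis using that iso by blast
qed

end

text \<open>One network stands for the whole cycle: the others on the image of C are its images
  under powers of \<tau>.\<close>

definition core_part :: "'v graph \<times> 'v graph \<Rightarrow> ('v \<Rightarrow> 'v) \<Rightarrow> 'v set set \<Rightarrow> 'v network" where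
  "core_part P f C = part P (f (fst (root_pair C))) (f (snd (root_pair C)))"

text \<open>Inverse to restricting a realization to the core and the root copies. A realization
  commutes with the automorphisms, so on the edge of index i it is the i-th power of \<tau> after
  its value on the root copy.\<close>

definition assemble :: "('v \<Rightarrow> 'v) \<Rightarrow> ('v \<Rightarrow> 'v) \<Rightarrow> ('v \<Rightarrow> 'v) \<Rightarrow> ('v set set \<Rightarrow> 'v \<Rightarrow> 'v) \<Rightarrow>
    'v + 'v set \<times> 'v \<Rightarrow> 'v" where
  "assemble \<tau> \<sigma> f \<phi> d = (case d of Inl v \<Rightarrow> f v
     | Inr (e, u) \<Rightarrow> (\<tau> ^^ edge_index \<sigma> e) (\<phi> (orbit (image \<sigma>) e) u))"

lemma pair_iso_funpow: "pair_iso f P P \<Longrightarrow> pair_iso (f ^^ n) P P"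
  by (simp add: pair_iso_def graph_iso_funpow)

locale core_iso =
  fixes P :: "'v graph \<times> 'v graph" and Ms :: "'v set \<Rightarrow> 'v network" and \<tau> :: "'v \<Rightarrow> 'v"
    and G :: "'v graph" and f :: "'v \<Rightarrow> 'v" and \<sigma> :: "'v \<Rightarrow> 'v"
  assumes S: "substituted P Ms" and \<tau>: "\<tau> \<in> pair_Aut P" and simple: "simple_graph G"
    and f: "graph_iso f G (snd P)" and \<sigma>Aut: "\<sigma> \<in> graph_Aut G"
    and f\<sigma>: "v \<in> verts G \<Longrightarrow> f (\<sigma> v) = \<tau> (f v)"
begin

sublocale graph_automorphism G \<sigma>
  by standard (rule simple, rule \<sigma>Aut)

lemma wf: "wf_pair P" by (rule substituted_wf[OF S])

lemma f_funpow: "v \<in> verts G \<Longrightarrow> f ((\<sigma> ^^ i) v) = (\<tau> ^^ i) (f v)"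
proof (induction i)
  case (Suc i)
  have "(\<sigma> ^^ i) v \<in> verts G" by (rule funpow_in) (use \<sigma>_simps(5) Suc in \<open>auto simp: bij_betw_def\<close>)
  then show ?case using Suc f\<sigma> by simp
qed simp

lemma root_verts:
  assumes "C \<in> edge_cycles G \<sigma>"
  shows "fst (root_pair C) \<in> verts G" "snd (root_pair C) \<in> verts G"
  using edges_subset[OF simple edge_cyclesD(3)[OF assms]] by (auto simp: root_def)

lemma core_part_network:
  assumes C: "C \<in> edge_cycles G \<sigma>"
  shows "is_network (core_part P f C)"
    "{f (fst (root_pair C)), f (snd (root_pair C))} \<in> edges (snd P)"
proof -
  show e: "{f (fst (root_pair C)), f (snd (root_pair C))} \<in> edges (snd P)"
    by (rule graph_iso_edge[OF f]) (use edge_cyclesD(3)[OF C] in \<open>simp add: root_def\<close>)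
  show "is_network (core_part P f C)"
    unfolding core_part_def by (rule substituted_is_network_part[OF S e])
qed

text \<open>A full round of \<tau> maps the image of the root edge to itself, with its ends in order
  or exchanged, and hence also the network on it. This is the symmetry that a realizable term must
  have chosen, up to conjugation.\<close>

lemma core_part_return:
  assumes C: "C \<in> edge_cycles G \<sigma>"
  shows "graph_iso (\<tau> ^^ card C) (hat (core_part P f C)) (hat (core_part P f C))"
    and "if cylindrical \<sigma> C
      then (\<tau> ^^ card C) (pole0 (core_part P f C)) = pole0 (core_part P f C) \<and>
           (\<tau> ^^ card C) (pole1 (core_part P f C)) = pole1 (core_part P f C)
      else (\<tau> ^^ card C) (pole0 (core_part P f C)) = pole1 (core_part P f C) \<and>
           (\<tau> ^^ card C) (pole1 (core_part P f C)) = pole0 (core_part P f C)"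
proof -
  let ?a = "fst (root_pair C)" and ?b = "snd (root_pair C)"
  note ab = root_verts[OF C]
  have ret: "(\<tau> ^^ card C) (f v) = f ((\<sigma> ^^ card C) v)" if "v \<in> verts G" for v
    using f_funpow[OF that] by simp
  show poles: "if cylindrical \<sigma> C
      then (\<tau> ^^ card C) (pole0 (core_part P f C)) = pole0 (core_part P f C) \<and>
           (\<tau> ^^ card C) (pole1 (core_part P f C)) = pole1 (core_part P f C)
      else (\<tau> ^^ card C) (pole0 (core_part P f C)) = pole1 (core_part P f C) \<and>
           (\<tau> ^^ card C) (pole1 (core_part P f C)) = pole0 (core_part P f C)"
    using ret[OF ab(1)] ret[OF ab(2)] root_return[OF C] by (simp add: core_part_def)
  have "network_iso (\<tau> ^^ card C) (part P (f ?a) (f ?b)) (part P ((\<tau> ^^ card C) (f ?a)) ((\<tau> ^^ card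
      C) (f ?b)))"
    by (rule part_iso[OF wf wf pair_iso_funpow[OF pair_AutD(1)[OF \<tau>]]])
      (use graph_iso_verts[OF f] ab in blast)+
  moreover have "hat (part P ((\<tau> ^^ card C) (f ?a)) ((\<tau> ^^ card C) (f ?b))) = hat (part P (f ?a) (f ?b))"
  proof (cases "cylindrical \<sigma> C")
    case True
    then show ?thesis using poles by (simp add: core_part_def)
  next
    case False
    then show ?thesis using poles by (simp add: core_part_def part_def insert_commute)
  qed
  ultimately show "graph_iso (\<tau> ^^ card C) (hat (core_part P f C)) (hat (core_part P f C))"
    by (simp add: network_iso_def core_part_def)
qed

text \<open>In the Moebius case a full round of \<tau> is an isomorphism from the opposite network
  to the network itself, which is what \<open>tau_part\<close> asks for.\<close>

lemma core_part_tau: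
  assumes C: "C \<in> edge_cycles G \<sigma>" and \<N>: "network_species \<N>" "core_part P f C \<in> \<N>"
  shows "core_part P f C \<in> signed_species (cylindrical \<sigma> C) \<N>"
proof (cases "cylindrical \<sigma> C")
  case False
  then have "network_iso (\<tau> ^^ card C) (opposite (core_part P f C)) (core_part P f C)"
    using core_part_return[OF C] by (simp add: network_iso_def opposite_def)
  then show ?thesis using False \<N>(2) by (auto simp: signed_species_def tau_part_def networks_isomorphic_def)
qed (simp add: signed_species_def \<N>(2))

text \<open>Commuting with \<tau> is built into \<open>assemble\<close> except where a cycle closes.
  There it amounts to the hypothesis on \<nu>: the chosen symmetry is a full round of \<tau>
  conjugated by \<phi> C.\<close>

lemma assemble_realization:
  assumes net: "\<And>C. C \<in> edge_cycles G \<sigma> \<Longrightarrow> is_network (fst (\<nu> C))"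
    and \<phi>: "\<And>C. C \<in> edge_cycles G \<sigma> \<Longrightarrow> network_iso (\<phi> C) (fst (\<nu> C)) (core_part P f C)"
    and \<nu>: "\<And>C. C \<in> edge_cycles G \<sigma> \<Longrightarrow>
      snd (\<nu> C) = pull_back (verts (hat (fst (\<nu> C)))) (\<phi> C) ((\<tau> ^^ card C) \<circ> \<phi> C)"
  shows "cycle_gluing G \<sigma> \<nu>"
    and "restrict (assemble \<tau> \<sigma> f \<phi>) (verts (fst (cycle_glue G \<sigma> \<nu>))) \<in> realizations (P, \<tau>) ((G, \<sigma>), \<nu>)"
    and "\<And>C u. C \<in> edge_cycles G \<sigma> \<Longrightarrow> u \<in> verts (hat (fst (\<nu> C))) \<Longrightarrow>
      assemble \<tau> \<sigma> f \<phi> (glue_map (head \<sigma>) (tail \<sigma>) (\<lambda>e. fst (\<nu> (cyc e))) (root C) u) = \<phi> C u"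
proof -
  have sym: "snd (\<nu> C) \<in> network_syms (cylindrical \<sigma> C) (fst (\<nu> C))"
    and symv: "\<And>u. u \<in> verts (hat (fst (\<nu> C))) \<Longrightarrow> \<phi> C (snd (\<nu> C) u) = (\<tau> ^^ card C) (\<phi> C u)"
    if C: "C \<in> edge_cycles G \<sigma>" for C
    using pull_back_network_syms[OF net[OF C] \<phi>[OF C] core_part_return[OF C]] unfolding \<nu>[OF C] by blast+
  show cg: "cycle_gluing G \<sigma> \<nu>"
    by standard (rule net, assumption, rule sym, assumption)
  interpret cycle_gluing G \<sigma> \<nu> by (rule cg)
  let ?\<beta> = "assemble \<tau> \<sigma> f \<phi>"
  define \<kappa> where "\<kappa> e u = (\<tau> ^^ edge_index \<sigma> e) (\<phi> (cyc e) u)" for e u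
  have \<kappa>: "network_iso (\<kappa> e) (Ns e) (part P (f (head \<sigma> e)) (f (tail \<sigma> e)))" if e: "e \<in> edges G" for e
  proof -
    note C = cyc_in[OF e]
    let ?a = "fst (root_pair (cyc e))" and ?b = "snd (root_pair (cyc e))"
    have "network_iso (\<tau> ^^ edge_index \<sigma> e) (part P (f ?a) (f ?b))
        (part P ((\<tau> ^^ edge_index \<sigma> e) (f ?a)) ((\<tau> ^^ edge_index \<sigma> e) (f ?b)))"
      by (rule part_iso[OF wf wf pair_iso_funpow[OF pair_AutD(1)[OF \<tau>]]])
        (use graph_iso_verts[OF f] root_verts[OF C] in blast)+
    then have "network_iso (\<tau> ^^ edge_index \<sigma> e) (core_part P f (cyc e)) (part P (f (head \<sigma> e)) (f
        (tail \<sigma> e)))"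
      using f_funpow[OF root_verts(1)[OF C]] f_funpow[OF root_verts(2)[OF C]]
      by (simp add: core_part_def head_def tail_def)
    from network_iso_comp[OF \<phi>[OF C] this] show ?thesis by (simp add: \<kappa>_def[abs_def] o_def)
  qed
  have b1: "?\<beta> (Inl v) = f v" for v by (simp add: assemble_def)
  have b2: "?\<beta> (Inr (e, u)) = \<kappa> e u" for e u by (simp add: assemble_def \<kappa>_def)
  have iso: "pair_iso ?\<beta> X P" and bgm: "\<And>e u. e \<in> edges G \<Longrightarrow> u \<in> verts (hat (Ns e)) \<Longrightarrow> ?\<beta> (gm e u) = \<kappa> e u"
    using iso_glueI[OF S f \<kappa> b1 b2] by blast+
  show "?\<beta> (gm (root C) u) = \<phi> C u" if "C \<in> edge_cycles G \<sigma>" "u \<in> verts (hat (fst (\<nu> C)))" for C u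
    using bgm[OF edge_cyclesD(3)[OF that(1)], of u] that(2)
    by (simp add: edge_cyclesD(4)[OF that(1)] \<kappa>_def edge_index_root(1)[OF that(1)])
  have comm: "?\<beta> (tw d) = \<tau> (?\<beta> d)" if d: "d \<in> verts (fst X)" for d
  proof -
    consider v where "v \<in> verts G" "d = Inl v" | e u where "e \<in> edges G" "u \<in> internal (Ns e)"
        "d = Inr (e, u)"
      using d by auto
    then show ?thesis
    proof cases
      case 1
      then show ?thesis by (simp add: twist_Inl b1 f\<sigma>)
    next
      case 2
      have uV: "u \<in> verts (hat (Ns e))" using 2(2) by (simp add: internal_def)
      have d': "d = gm e u" using gm_simps(3)[OF 2(2)] 2(3) by simp
      note C = cyc_in[OF 2(1)]
      show ?thesis
      proof (cases "\<sigma> ` e = root (cyc e)")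
        case False
        then have "?\<beta> (tw d) = ?\<beta> (gm (\<sigma> ` e) u)" using twist_step(2)[OF 2(1) uV] d' by simp
        also have "\<dots> = \<kappa> (\<sigma> ` e) u"
            by (rule bgm[OF image_in_edges[OF 2(1)]]) (simp add: cyc_image[OF 2(1)] uV)
        also have "\<dots> = \<tau> (\<kappa> e u)"
            using edge_index_step(1)[OF 2(1) False] by (simp add: \<kappa>_def cyc_image[OF 2(1)])
        finally show ?thesis using 2(3) b2 by simp
      next
        case True
        then have "?\<beta> (tw d) = ?\<beta> (gm (root (cyc e)) (snd (\<nu> (cyc e)) u))"
            using twist_step(2)[OF 2(1) uV] d' by simp
        also have "\<dots> = \<kappa> (root (cyc e)) (snd (\<nu> (cyc e)) u)"
          by (rule bgm[OF edge_cyclesD(3)[OF C]]) (use sym_verts[OF C uV] in \<open>simp add: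
              edge_cyclesD(4)[OF C]\<close>)
        also have "\<dots> = \<phi> (cyc e) (snd (\<nu> (cyc e)) u)"
          by (simp add: \<kappa>_def edge_index_root(1)[OF C] edge_cyclesD(4)[OF C])
        also have "\<dots> = (\<tau> ^^ card (cyc e)) (\<phi> (cyc e) u)" by (rule symv[OF C uV])
        also have "\<dots> = \<tau> (\<kappa> e u)" by (simp add: \<kappa>_def flip: edge_index_step(2)[OF 2(1) True])
        finally show ?thesis using 2(3) b2 by simp
      qed
    qed
  qed
  have twV: "tw d \<in> verts (fst X)" if "d \<in> verts (fst X)" for d
    using graph_AutD(1)[OF pair_AutD(2)[OF twist_Aut]] that by (simp only: permutes_in_image)
  show "restrict ?\<beta> (verts (fst (cycle_glue G \<sigma> \<nu>))) \<in> realizations (P, \<tau>) ((G, \<sigma>), \<nu>)"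
    unfolding realizations_eq cycle_glue_eq pair_isos_def
    using pair_iso_restrict[OF wf_glue iso] comm twV by (simp del: glue_simps)
qed

end

context cycle_gluing
begin

text \<open>The converse of \<open>assemble_realization\<close>: commuting with the twist leaves no
  freedom beyond f and the maps \<phi> C. They determine \<beta>, and they force \<sigma> and the
  symmetries of the term to be conjugates of \<tau> and of its full rounds.\<close>

lemma realization_core_iso:
  assumes S: "substituted P Ms" and \<tau>: "\<tau> \<in> pair_Aut P" and \<beta>: "\<beta> \<in> realizations (P, \<tau>) ((G, \<sigma>), \<nu>)"
  defines "f \<equiv> restrict (\<beta> \<circ> Inl) (verts G)"
    and "\<phi> \<equiv> \<lambda>C. restrict (\<beta> \<circ> gm (root C)) (verts (hat (fst (\<nu> C))))"
  shows "core_iso P Ms \<tau> G f \<sigma>"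
    and "C \<in> edge_cycles G \<sigma> \<Longrightarrow> \<phi> C \<in> network_isos (fst (\<nu> C)) (core_part P f C)"
    and "C \<in> edge_cycles G \<sigma> \<Longrightarrow> snd (\<nu> C) = pull_back (verts (hat (fst (\<nu> C)))) (\<phi> C) ((\<tau> ^^ card C) \<circ> \<phi> C)"
    and "restrict (assemble \<tau> \<sigma> f \<phi>) (verts (fst (cycle_glue G \<sigma> \<nu>))) = \<beta>"
    and "\<sigma> = pull_back (verts G) f (\<tau> \<circ> f)"
proof -
  note wf = substituted_wf[OF S]
  have iso: "pair_iso \<beta> X P" and comm: "\<And>d. d \<in> verts (fst X) \<Longrightarrow> \<beta> (tw d) = \<tau> (\<beta> d)"
    and ext: "\<beta> \<in> extensional (verts (fst X))"
    using \<beta> by (auto simp: realizations_eq pair_isos_def)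
  have fI: "graph_iso f G (snd P)"
    unfolding f_def by (rule graph_iso_restrict[OF G iso_glue_core[OF iso]])
  have \<sigma>V: "\<sigma> v \<in> verts G" if "v \<in> verts G" for v using \<sigma>_simps(1) that by (simp add: permutes_in_image)
  have f\<sigma>: "f (\<sigma> v) = \<tau> (f v)" if v: "v \<in> verts G" for v
    using comm[of "Inl v"] v \<sigma>V[OF v] by (simp add: f_def twist_Inl)
  show ci: "core_iso P Ms \<tau> G f \<sigma>"
    by standard (rule S, rule \<tau>, rule G, rule fI, rule \<sigma>, rule f\<sigma>)
  have finj: "inj_on f (verts G)" using fI by (auto simp: graph_iso_def bij_betw_def)
  show "\<sigma> = pull_back (verts G) f (\<tau> \<circ> f)"
  proof
    fix v show "\<sigma> v = pull_back (verts G) f (\<tau> \<circ> f) v"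
    proof (cases "v \<in> verts G")
      case True
      have "pull_back (verts G) f (\<tau> \<circ> f) v = inv_into (verts G) f (f (\<sigma> v))"
        using True f\<sigma> by (simp add: pull_back_def)
      then show ?thesis using finj \<sigma>V[OF True] by simp
    next
      case False
      then show ?thesis using \<sigma>_simps(1) by (simp add: pull_back_def permutes_not_in)
    qed
  qed
  have funpow: "\<beta> ((tw ^^ i) d) = (\<tau> ^^ i) (\<beta> d)" if "d \<in> verts (fst X)" for i d
  proof (induction i)
    case (Suc i)
    have "tw ` verts (fst X) \<subseteq> verts (fst X)"
      using graph_AutD(5)[OF pair_AutD(2)[OF twist_Aut]] by (simp only: bij_betw_def)
    then have "(tw ^^ i) d \<in> verts (fst X)" using that by (rule funpow_in)
    then show ?case using Suc comm by simp
  qed simp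
  show \<phi>I: "\<phi> C \<in> network_isos (fst (\<nu> C)) (core_part P f C)" if C: "C \<in> edge_cycles G \<sigma>" for C
  proof -
    have "network_iso (\<beta> \<circ> gm (root C)) (fst (\<nu> C)) (core_part P f C)"
      using iso_glueD[OF wf iso edge_cyclesD(3)[OF C]] AB_verts[OF edge_cyclesD(3)[OF C]]
      by (simp add: edge_cyclesD(4)[OF C] edge_index_root(2,3)[OF C] core_part_def f_def)
    then show ?thesis
      unfolding network_isos_def \<phi>_def using network_iso_restrict[OF net\<nu>[OF C]] by simp
  qed
  show "snd (\<nu> C) = pull_back (verts (hat (fst (\<nu> C)))) (\<phi> C) ((\<tau> ^^ card C) \<circ> \<phi> C)"
    if C: "C \<in> edge_cycles G \<sigma>" for C
  proof
    fix u
    let ?V = "verts (hat (fst (\<nu> C)))"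
    show "snd (\<nu> C) u = pull_back ?V (\<phi> C) ((\<tau> ^^ card C) \<circ> \<phi> C) u"
    proof (cases "u \<in> ?V")
      case True
      have inj: "inj_on (\<phi> C) ?V"
        using \<phi>I[OF C] by (auto simp: network_isos_def network_iso_def graph_iso_def bij_betw_def)
      have "gm (root C) u \<in> verts (fst X)"
        using gm_verts[OF edge_cyclesD(3)[OF C], of u] True
            by (simp add: edge_cyclesD(4)[OF C] del: glue_simps)
      then have "(\<tau> ^^ card C) (\<phi> C u) = \<phi> C (snd (\<nu> C) u)"
        using funpow[of "gm (root C) u" "card C"] twist_return[OF C True] True sym_verts[OF C True]
        by (simp add: \<phi>_def del: glue_simps)
      then have "pull_back ?V (\<phi> C) ((\<tau> ^^ card C) \<circ> \<phi> C) u = inv_into ?V (\<phi> C) (\<phi> C (snd (\<nu> C) u))"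
        using True by (simp add: pull_back_def)
      then show ?thesis using inj sym_verts[OF C True] by simp
    next
      case False
      then show ?thesis using graph_AutD(1)[OF sym_in[OF C]] by (simp add: pull_back_def permutes_not_in)
    qed
  qed
  show "restrict (assemble \<tau> \<sigma> f \<phi>) (verts (fst (cycle_glue G \<sigma> \<nu>))) = \<beta>"
    unfolding cycle_glue_eq
  proof (rule extensionalityI[OF restrict_extensional ext])
    fix d assume d: "d \<in> verts (fst X)"
    consider v where "v \<in> verts G" "d = Inl v" | e u where "e \<in> edges G" "u \<in> internal (Ns e)"
        "d = Inr (e, u)"
      using d by auto
    then have "assemble \<tau> \<sigma> f \<phi> d = \<beta> d"
    proof cases
      case 1
      then show ?thesis by (simp add: assemble_def f_def)
    next
      case 2
      note C = cyc_in[OF 2(1)]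
      have uV: "u \<in> verts (hat (Ns e))" using 2(2) by (simp add: internal_def)
      have "gm (root (cyc e)) u \<in> verts (fst X)"
        using gm_verts[OF edge_cyclesD(3)[OF C], of u] uV
            by (simp add: edge_cyclesD(4)[OF C] del: glue_simps)
      then have "(\<tau> ^^ edge_index \<sigma> e) (\<beta> (gm (root (cyc e)) u))
          = \<beta> ((tw ^^ edge_index \<sigma> e) (gm (root (cyc e)) u))"
        by (rule funpow[symmetric])
      also have "(tw ^^ edge_index \<sigma> e) (gm (root (cyc e)) u) = gm ((\<sigma> ^^ edge_index \<sigma> e) ` root (cyc e)) u"
        by (rule twist_funpow[OF C uV edge_index(1)[OF 2(1)]])
      also have "\<dots> = d" using edge_index(2)[OF 2(1)] gm_simps(3)[OF 2(2)] 2(3) by simp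
      finally show ?thesis using uV 2(3) by (simp add: assemble_def \<phi>_def)
    qed
    then show "restrict (assemble \<tau> \<sigma> f \<phi>) (verts (fst X)) d = \<beta> d" using d by simp
  qed
qed

end

section \<open>The two marginal sums of the double count\<close>

locale species_pair =
  fixes \<G> :: "'v :: infinite graph set" and \<N> :: "'v network set"
  assumes \<G>: "graph_species \<G>" and \<N>: "network_species \<N>" and sym\<N>: "symmetric_species \<N>"
begin

lemma simple_species: "H \<in> \<G> \<Longrightarrow> simple_graph H"
  using \<G> by (simp add: graph_species_def)

lemma wf_species: "P \<in> \<G> \<up> \<N> \<Longrightarrow> wf_pair P"
  using edge_substitution_iff[OF \<G> \<N>] substituted_wf by blast

sublocale graphs: equivalence_on graphs_isomorphic \<G>
  by (rule equivalence_on_graphs[OF simple_species])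

sublocale pairs: equivalence_on pairs_isomorphic "\<G> \<up> \<N>"
  by (rule equivalence_on_pairs[OF wf_species])

lemma core_index_cycle_gluing:
  assumes "((G, \<sigma>), \<nu>) \<in> core_index \<G> \<N>"
  shows "cycle_gluing G \<sigma> \<nu>" "G \<in> \<G>" "\<And>C. C \<in> edge_cycles G \<sigma> \<Longrightarrow> fst (\<nu> C) \<in> \<N>"
proof -
  have G: "G \<in> representatives graphs_isomorphic \<G>" "\<sigma> \<in> graph_Aut G"
    and \<nu>: "\<And>C. C \<in> edge_cycles G \<sigma> \<Longrightarrow> \<nu> C \<in> network_index (cylindrical \<sigma> C) \<N>"
    using assms by (auto simp: core_index_def graph_index_def)
  show mem: "G \<in> \<G>" using G(1) graphs.representatives_subset by blast
  have rep: "fst (\<nu> C) \<in> representatives networks_isomorphic (signed_species (cylindrical \<sigma> C) \<N>)"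
    "snd (\<nu> C) \<in> network_syms (cylindrical \<sigma> C) (fst (\<nu> C))" if "C \<in> edge_cycles G \<sigma>" for C
    using \<nu>[OF that] by (auto simp: network_index_def)
  show "cycle_gluing G \<sigma> \<nu>"
    by standard (use G(2) simple_species[OF mem] rep representatives_networks(3)[OF \<N>] in blast)+
  show "fst (\<nu> C) \<in> \<N>" if "C \<in> edge_cycles G \<sigma>" for C
    using representatives_networks(3)[OF \<N> rep(1)[OF that]] by blast
qed

lemma finite_pair_index: "finite {x \<in> pair_index (\<G> \<up> \<N>). weight (fst (fst x)) (snd x) = m}"
  using locally_finiteD[OF Walsh_pairs_eq(2)[OF wf_species], where m = m] by (simp add: case_prod_unfold)

lemma finite_core_index: "finite {y \<in> core_index \<G> \<N>. core_monomial y = m}"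
  by (rule locally_finiteD[OF Walsh_subst_eq(2)[OF \<G> \<N>]])

lemma card_pair_Aut_pos: "wf_pair P \<Longrightarrow> card (pair_Aut P) > 0"
proof -
  assume P: "wf_pair P"
  have "id \<in> pair_Aut P" by (rule pair_AutI[OF P]) (simp_all add: pair_iso_def graph_iso_id)
  then show ?thesis using finite_pair_Aut[OF P] by (auto simp: card_gt_0_iff)
qed

text \<open>Only the representative p isomorphic to the glued pair admits realizations, and over all
  \<tau> they number |Aut p|. Restricting the sum to equal weights loses nothing, by
  \<open>realization_weight\<close>.\<close>

lemma sum_over_pairs:
  assumes y: "y \<in> core_index \<G> \<N>"
  shows "(\<Sum>x | x \<in> pair_index (\<G> \<up> \<N>) \<and> weight (fst (fst x)) (snd x) = core_monomial y.
    1 / of_nat (card (pair_Aut (fst x))) * of_nat (card (realizations x y))) = (1 :: rat)"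
proof -
  obtain G \<sigma> \<nu> where y': "y = ((G, \<sigma>), \<nu>)" by (metis prod.collapse)
  note cg = core_index_cycle_gluing[OF y[unfolded y']]
  interpret cycle_gluing G \<sigma> \<nu> by (rule cg(1))
  obtain P0 h0 where P0: "P0 \<in> \<G> \<up> \<N>" "pair_iso h0 X P0"
    using glue_representative[OF \<G> \<N> sym\<N> infinite_UNIV cg(2,3)] by blast
  obtain p where p: "p \<in> representatives pairs_isomorphic (\<G> \<up> \<N>)" "pairs_isomorphic p P0"
    using pairs.representatives_ex[OF P0(1)] by blast
  have pm: "p \<in> \<G> \<up> \<N>" using p(1) pairs.representatives_subset by blast
  note wfp = wf_species[OF pm]
  obtain k where "pair_iso k p P0" using p(2) unfolding pairs_isomorphic_iff by blast
  then have h: "pair_iso (inv_into (verts (fst p)) k \<circ> h0) X p"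
    using pair_iso_comp[OF P0(2)] pair_iso_inv[OF wfp] by blast
  let ?A = "{x. x \<in> pair_index (\<G> \<up> \<N>) \<and> weight (fst (fst x)) (snd x) = core_monomial y}"
  let ?B = "(\<lambda>\<tau>. (p, \<tau>)) ` pair_Aut p"
  let ?t = "\<lambda>x. 1 / of_nat (card (pair_Aut (fst x))) * of_nat (card (realizations x y)) :: rat"
  have "sum ?t ?A = sum ?t ?B"
  proof (rule sum.mono_neutral_cong)
    show "finite ?A" using finite_pair_index by simp
    show "finite ?B" using finite_pair_Aut[OF wfp] by simp
    show "?t x = 0" if x: "x \<in> ?A - ?B" for x
    proof -
      obtain P \<tau> where x': "x = (P, \<tau>)" by (cases x)
      have P: "P \<in> representatives pairs_isomorphic (\<G> \<up> \<N>)" "\<tau> \<in> pair_Aut P" "P \<noteq> p"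
        using x x' by (auto simp: pair_index_def)
      have "realizations x y = {}"
      proof (rule ccontr)
        assume "realizations x y \<noteq> {}"
        then obtain \<beta> where "pair_iso \<beta> X P"
          unfolding x' y' realizations_eq pair_isos_def by blast
        then have "pair_iso (\<beta> \<circ> inv_into (verts (fst X)) (inv_into (verts (fst p)) k \<circ> h0)) p P"
          by (rule pair_iso_comp[OF pair_iso_inv[OF wf_glue h]])
        then have "pairs_isomorphic p P" unfolding pairs_isomorphic_iff by blast
        then show False using pairs.representatives_unique[OF p(1) P(1)] P(3) by simp
      qed
      then show ?thesis by simp
    qed
    show "?t x = 0" if x: "x \<in> ?B - ?A" for x
    proof -
      obtain \<tau> where \<tau>: "\<tau> \<in> pair_Aut p" "x = (p, \<tau>)" using x by blast
      have "x \<in> pair_index (\<G> \<up> \<N>)" using \<tau> p(1) by (simp add: pair_index_def)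
      then have "core_monomial y \<noteq> weight (fst p) \<tau>" using x \<tau>(2) by auto
      then have "realizations x y = {}" using realization_weight[OF \<tau>(1)] unfolding \<tau>(2) y' by blast
      then show ?thesis by simp
    qed
  qed simp
  also have "\<dots> = (\<Sum>\<tau>\<in>pair_Aut p. 1 / of_nat (card (pair_Aut p)) * of_nat (card (realizations (p, \<tau>) y)))"
    by (subst sum.reindex) (auto simp: inj_on_def)
  also have "\<dots> = 1 / of_nat (card (pair_Aut p)) * of_nat (\<Sum>\<tau>\<in>pair_Aut p. card (realizations (p, \<tau>) y))"
    by (simp only: sum_distrib_left of_nat_sum)
  also have "\<dots> = 1"
    using sum_card_realizations[OF wfp h] card_pair_Aut_pos[OF wfp] unfolding y' by simp
  finally show ?thesis .
qed

text \<open>The realizations of (P, \<tau>) by all terms correspond to pairs (f, \<phi>): f maps the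
  representative g onto the core, and \<phi> C maps the representative of a root network onto it.
  There are |Aut g| choices of f, and for each of them \<phi> has as many choices as the product of
  the numbers of symmetries; the coefficient of the term is the reciprocal of the total.\<close>

lemma sum_over_cores:
  assumes x: "(P, \<tau>) \<in> pair_index (\<G> \<up> \<N>)"
  shows "(\<Sum>y | y \<in> core_index \<G> \<N> \<and> core_monomial y = weight (fst P) \<tau>.
    core_coeff y * of_nat (card (realizations (P, \<tau>) y))) = 1"
proof -
  have P: "P \<in> \<G> \<up> \<N>" and \<tau>: "\<tau> \<in> pair_Aut P"
    using x pairs.representatives_subset by (auto simp: pair_index_def)
  obtain Ms where S: "substituted P Ms" and Ms: "\<And>e. e \<in> edges (snd P) \<Longrightarrow> Ms e \<in> \<N>" and core: "snd P \<in> \<G>"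
    using P edge_substitution_iff[OF \<G> \<N>] by blast
  note wf = substituted_wf[OF S]
  obtain g where g: "g \<in> representatives graphs_isomorphic \<G>" "graphs_isomorphic g (snd P)"
    using graphs.representatives_ex[OF core] by blast
  have simple: "simple_graph g" using g(1) graphs.representatives_subset simple_species by blast
  have part\<N>: "part P a b \<in> \<N>" if "{a, b} \<in> edges (snd P)" for a b
    using substituted_part_cases[OF S that] Ms[OF that] sym\<N> by (auto simp: symmetric_species_def)
  \<comment> \<open>The term is forced by (f, \<phi>): its automorphism is \<tau> conjugated by f,
    its network on C the representative of the root network, and the symmetry a full round of \<tau>
    conjugated by \<phi> C.\<close>
  define sg where "sg f = pull_back (verts g) f (\<tau> \<circ> f)" for f
  define K where "K f = edge_cycles g (sg f)" for f
  define R where "R f C = representatives networks_isomorphic (signed_species (cylindrical (sg f) C)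
      \<N>)" for f C
  define n where "n f C = (SOME N. N \<in> R f C \<and> networks_isomorphic N (core_part P f C))" for f C
  define nu where "nu f \<phi> = (\<lambda>C\<in>K f. (n f C, pull_back (verts (hat (n f C))) (\<phi> C) ((\<tau> ^^ card C) \<circ> \<phi>
      C)))" for f \<phi>
  define I where "I f = PiE (K f) (\<lambda>C. network_isos (n f C) (core_part P f C))" for f
  have ci: "core_iso P Ms \<tau> g f (sg f)" if fm: "f \<in> graph_isos g (snd P)" for f
  proof -
    have fI: "graph_iso f g (snd P)" using fm by (simp add: graph_isos_def)
    have "graph_iso (\<tau> \<circ> f) g (snd P)"
      by (rule graph_iso_comp[OF fI]) (use pair_AutD(1)[OF \<tau>] in \<open>simp add: pair_iso_def\<close>)
    note pb = pull_back_graph_Aut[OF simple fI this]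
    show ?thesis
      by standard (use S \<tau> simple fI pb in \<open>simp_all add: sg_def\<close>)
  qed
  have n: "n f C \<in> R f C" "networks_isomorphic (n f C) (core_part P f C)" "is_network (n f C)"
    if fm: "f \<in> graph_isos g (snd P)" and C: "C \<in> K f" for f C
  proof -
    interpret core_iso P Ms \<tau> g f "sg f" by (rule ci[OF fm])
    note C' = C[unfolded K_def]
    have "core_part P f C \<in> \<N>"
      using part\<N>[OF core_part_network(2)[OF C']] by (simp add: core_part_def)
    then have "core_part P f C \<in> signed_species (cylindrical (sg f) C) \<N>"
      by (rule core_part_tau[OF C' \<N>])
    then have "\<exists>N. N \<in> R f C \<and> networks_isomorphic N (core_part P f C)"
      using equivalence_on.representatives_ex[OF representatives_networks(1)[OF \<N>]] unfolding R_def by blast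
    then have *: "n f C \<in> R f C \<and> networks_isomorphic (n f C) (core_part P f C)"
      unfolding n_def by (rule someI_ex)
    then show "n f C \<in> R f C" "networks_isomorphic (n f C) (core_part P f C)" by blast+
    show "is_network (n f C)" using * representatives_networks(3)[OF \<N>] unfolding R_def by blast
  qed
  \<comment> \<open>\<Theta> assembles a term together with a realization, \<Xi> restricts a
    realization to the core and the root copies; they will be shown to be mutually inverse.\<close>
  define \<Theta> where "\<Theta> = (\<lambda>(f, \<phi>). (((g, sg f), nu f \<phi>),
    restrict (assemble \<tau> (sg f) f \<phi>) (verts (fst (cycle_glue g (sg f) (nu f \<phi>))))))"
  define \<Xi> :: "(('v graph \<times> ('v \<Rightarrow> 'v)) \<times> ('v set set \<Rightarrow> 'v network \<times> ('v \<Rightarrow> 'v))) \<times> ('v + 'v set \<times> 'v \<Rightarrow>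
      'v) \<Rightarrow> ('v \<Rightarrow> 'v) \<times> ('v set set \<Rightarrow> 'v \<Rightarrow> 'v)"
    where "\<Xi> = (\<lambda>(((G, \<sigma>), \<nu>), \<beta>). (restrict (\<beta> \<circ> Inl) (verts G),
      \<lambda>C\<in>edge_cycles G \<sigma>. restrict (\<beta> \<circ> glue_map (head \<sigma>) (tail \<sigma>) (\<lambda>e. fst (\<nu> (orbit (image \<sigma>) e)))
          (root C))
        (verts (hat (fst (\<nu> C))))))"
  let ?S = "Sigma (graph_isos g (snd P)) I"
  let ?Y = "{y. y \<in> core_index \<G> \<N> \<and> core_monomial y = weight (fst P) \<tau>}"
  let ?T = "SIGMA y:?Y. realizations (P, \<tau>) y"
  have fwd: "\<Theta> (f, \<phi>) \<in> ?T" "\<Xi> (\<Theta> (f, \<phi>)) = (f, \<phi>)"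
    if fm: "f \<in> graph_isos g (snd P)" and \<phi>: "\<phi> \<in> I f" for f \<phi>
  proof -
    interpret core_iso P Ms \<tau> g f "sg f" by (rule ci[OF fm])
    have \<nu>: "nu f \<phi> C = (n f C, pull_back (verts (hat (n f C))) (\<phi> C) ((\<tau> ^^ card C) \<circ> \<phi> C))"
      if "C \<in> edge_cycles g (sg f)" for C using that by (simp add: nu_def K_def)
    have \<phi>': "\<phi> C \<in> network_isos (n f C) (core_part P f C)" if "C \<in> edge_cycles g (sg f)" for C
      using \<phi> that by (auto simp: I_def K_def)
    have \<phi>'': "network_iso (\<phi> C) (fst (nu f \<phi> C)) (core_part P f C)" if "C \<in> edge_cycles g (sg f)" for C
      using \<phi>'[OF that] \<nu>[OF that] by (simp add: network_isos_def)
    have net: "is_network (fst (nu f \<phi> C))" if "C \<in> edge_cycles g (sg f)" for C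
      using n(3)[OF fm] that \<nu>[OF that] by (simp add: K_def)
    have snd\<nu>: "snd (nu f \<phi> C) = pull_back (verts (hat (fst (nu f \<phi> C)))) (\<phi> C) ((\<tau> ^^ card C) \<circ> \<phi> C)"
      if "C \<in> edge_cycles g (sg f)" for C using \<nu>[OF that] by simp
    note ar = assemble_realization[OF net \<phi>'' snd\<nu>]
    interpret cg: cycle_gluing g "sg f" "nu f \<phi>" by (rule ar(1))
    let ?\<beta> = "restrict (assemble \<tau> (sg f) f \<phi>) (verts (fst (cycle_glue g (sg f) (nu f \<phi>))))"
    have "nu f \<phi> \<in> PiE (edge_cycles g (sg f)) (\<lambda>C. network_index (cylindrical (sg f) C) \<N>)"
    proof (rule PiE_I)
      fix C assume C: "C \<in> edge_cycles g (sg f)"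
      then have "fst (nu f \<phi> C) \<in> R f C" using n(1)[OF fm] \<nu>[OF C] by (simp add: K_def)
      then have "(fst (nu f \<phi> C), snd (nu f \<phi> C)) \<in> network_index (cylindrical (sg f) C) \<N>"
        using cg.sym\<nu>[OF C] unfolding network_index_def R_def by blast
      then show "nu f \<phi> C \<in> network_index (cylindrical (sg f) C) \<N>" by simp
    qed (simp add: nu_def K_def)
    then have "((g, sg f), nu f \<phi>) \<in> core_index \<G> \<N>"
      using g(1) \<sigma>Aut by (simp add: core_index_def graph_index_def)
    then show "\<Theta> (f, \<phi>) \<in> ?T"
      using ar(2) cg.realization_weight[OF \<tau> ar(2)] by (simp add: \<Theta>_def)
    have "restrict (?\<beta> \<circ> Inl) (verts g) = f"
      by (rule extensionalityI[OF restrict_extensional])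
        (use fm in \<open>auto simp: graph_isos_def assemble_def cg.cycle_glue_eq\<close>)
    moreover have "restrict (?\<beta> \<circ> cg.gm (root C)) (verts (hat (fst (nu f \<phi> C)))) = \<phi> C"
      if C: "C \<in> edge_cycles g (sg f)" for C
    proof (rule extensionalityI[OF restrict_extensional])
      show "\<phi> C \<in> extensional (verts (hat (fst (nu f \<phi> C))))"
        using \<phi>'[OF C] \<nu>[OF C] by (simp add: network_isos_def)
      fix u assume u: "u \<in> verts (hat (fst (nu f \<phi> C)))"
      have "cg.gm (root C) u \<in> verts (fst cg.X)"
        using cg.gm_verts[OF edge_cyclesD(3)[OF C], of u] u
            by (simp add: edge_cyclesD(4)[OF C] del: glue_simps)
      then show "restrict (?\<beta> \<circ> cg.gm (root C)) (verts (hat (fst (nu f \<phi> C)))) u = \<phi> C u"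
        using u ar(3)[OF _ _ _ C u] by (simp add: cg.cycle_glue_eq del: glue_simps)
    qed
    moreover have "\<phi> \<in> extensional (edge_cycles g (sg f))" using \<phi> by (simp add: I_def K_def PiE_def)
    ultimately show "\<Xi> (\<Theta> (f, \<phi>)) = (f, \<phi>)"
      unfolding \<Xi>_def \<Theta>_def prod.case prod.inject
      by (intro conjI) (simp, rule extensionalityI[OF restrict_extensional], simp_all)
  qed
  have bwd: "\<Xi> t \<in> ?S" "\<Theta> (\<Xi> t) = t" if t: "t \<in> ?T" for t
  proof -
    obtain G \<sigma> \<nu> \<beta> where t': "t = (((G, \<sigma>), \<nu>), \<beta>)" by (metis prod.collapse)
    have y: "((G, \<sigma>), \<nu>) \<in> core_index \<G> \<N>" and \<beta>: "\<beta> \<in> realizations (P, \<tau>) ((G, \<sigma>), \<nu>)"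
      using t t' by auto
    interpret cycle_gluing G \<sigma> \<nu> by (rule core_index_cycle_gluing(1)[OF y])
    define f where "f = restrict (\<beta> \<circ> Inl) (verts G)"
    define \<phi> where "\<phi> C = restrict (\<beta> \<circ> gm (root C)) (verts (hat (fst (\<nu> C))))" for C
    note rc = realization_core_iso[OF S \<tau> \<beta>, folded f_def, folded \<phi>_def]
    have fI: "graph_iso f G (snd P)" by (rule core_iso.f[OF rc(1)])
    have GR: "G \<in> representatives graphs_isomorphic \<G>" using y by (simp add: core_index_def graph_index_def)
    have "graphs_isomorphic G (snd P)" using fI unfolding graphs_isomorphic_def by blast
    moreover have "graphs_isomorphic (snd P) g"
      by (rule graphs.sym[OF _ core g(2)]) (use g(1) graphs.representatives_subset in blast)
    ultimately have "graphs_isomorphic G g"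
      using graphs.trans[OF core_index_cycle_gluing(2)[OF y] core] g(1) graphs.representatives_subset
          by blast
    then have Gg: "G = g" by (rule graphs.representatives_unique[OF GR g(1)])
    have \<sigma>': "\<sigma> = sg f" using rc(5) by (simp add: sg_def Gg)
    have fm: "f \<in> graph_isos g (snd P)" using fI Gg by (simp add: graph_isos_def f_def)
    have \<nu>E: "\<nu> \<in> PiE (K f) (\<lambda>C. network_index (cylindrical \<sigma> C) \<N>)"
      using y by (simp add: core_index_def K_def Gg \<sigma>')
    \<comment> \<open>Both networks are representatives for the same sign and isomorphic to the same
      part of P, hence equal.\<close>
    have n': "fst (\<nu> C) = n f C" if C: "C \<in> K f" for C
    proof -
      have C': "C \<in> edge_cycles G \<sigma>" using C by (simp add: K_def Gg \<sigma>')
      have "\<nu> C \<in> network_index (cylindrical (sg f) C) \<N>" using PiE_mem[OF \<nu>E C] by (simp only: \<sigma>')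
      then have \<nu>R: "fst (\<nu> C) \<in> R f C" by (auto simp: network_index_def R_def)
      have "networks_isomorphic (fst (\<nu> C)) (core_part P f C)"
        using rc(2)[OF C'] unfolding network_isos_def networks_isomorphic_def by blast
      interpret nets: equivalence_on networks_isomorphic "signed_species (cylindrical (sg f) C) \<N>"
        by (rule representatives_networks(1)[OF \<N>])
      obtain k1 where k1: "network_iso k1 (fst (\<nu> C)) (core_part P f C)"
        using rc(2)[OF C'] unfolding network_isos_def by blast
      obtain k2 where k2: "network_iso k2 (n f C) (core_part P f C)"
        using n(2)[OF fm C] unfolding networks_isomorphic_def by blast
      have "networks_isomorphic (fst (\<nu> C)) (n f C)"
        using network_iso_comp[OF k1 network_iso_inv[OF n(3)[OF fm C] k2]]
            unfolding networks_isomorphic_def by blast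
      then show ?thesis
        by (rule nets.representatives_unique[OF \<nu>R[unfolded R_def] n(1)[OF fm C, unfolded R_def]])
    qed
    let ?\<phi> = "restrict \<phi> (K f)"
    have Kf: "K f = edge_cycles G \<sigma>" unfolding K_def Gg \<sigma>'[symmetric] ..
    have \<Xi>t: "\<Xi> t = (f, ?\<phi>)"
      unfolding Kf by (simp only: \<Xi>_def t' prod.case f_def \<phi>_def[abs_def])
    have \<phi>I: "?\<phi> \<in> I f"
      unfolding I_def
    proof (rule restrict_PiE_iff[THEN iffD2], rule ballI)
      fix C assume C: "C \<in> K f"
      then show "\<phi> C \<in> network_isos (n f C) (core_part P f C)"
        using rc(2)[of C] unfolding Kf n'[OF C] by blast
    qed
    show "\<Xi> t \<in> ?S" using \<Xi>t fm \<phi>I by simp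
    have nuf: "nu f ?\<phi> = \<nu>"
    proof (rule extensionalityI[of _ "K f"])
      show "nu f ?\<phi> \<in> extensional (K f)" by (simp add: nu_def)
      show "\<nu> \<in> extensional (K f)" using \<nu>E by (simp add: PiE_def)
      fix C assume C: "C \<in> K f"
      have "nu f ?\<phi> C = (fst (\<nu> C), snd (\<nu> C))"
        using C rc(3)[of C] n'[OF C] Kf by (simp add: nu_def)
      then show "nu f ?\<phi> C = \<nu> C" by simp
    qed
    have "restrict (assemble \<tau> \<sigma> f ?\<phi>) (verts (fst (cycle_glue G \<sigma> \<nu>)))
        = restrict (assemble \<tau> \<sigma> f \<phi>) (verts (fst (cycle_glue G \<sigma> \<nu>)))"
    proof (rule restrict_ext)
      fix d assume "d \<in> verts (fst (cycle_glue G \<sigma> \<nu>))"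
      then show "assemble \<tau> \<sigma> f ?\<phi> d = assemble \<tau> \<sigma> f \<phi> d"
        using cyc_in unfolding cycle_glue_eq Kf by (auto simp: assemble_def)
    qed
    then show "\<Theta> (\<Xi> t) = t"
      unfolding \<Xi>t using rc(4) by (simp add: \<Theta>_def nuf t' Gg \<sigma>'[symmetric])
  qed
  have bij: "bij_betw \<Theta> ?S ?T"
  proof (rule bij_betw_byWitness[where f' = \<Xi>])
    show "\<forall>s\<in>?S. \<Xi> (\<Theta> s) = s" using fwd(2) by (simp add: split_paired_Ball_Sigma)
    show "\<forall>t\<in>?T. \<Theta> (\<Xi> t) = t" by (rule ballI) (rule bwd(2))
    show "\<Theta> ` ?S \<subseteq> ?T" by (rule image_subsetI, erule SigmaE) (simp only: fwd(1))
    show "\<Xi> ` ?T \<subseteq> ?S" by (rule image_subsetI) (rule bwd(1))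
  qed
  have finY: "finite ?Y" using finite_core_index by simp
  have finR: "finite (realizations (P, \<tau>) y)" if "y \<in> ?Y" for y
  proof -
    obtain G \<sigma> \<nu> where y': "y = ((G, \<sigma>), \<nu>)" by (metis prod.collapse)
    interpret cycle_gluing G \<sigma> \<nu>
      by (rule core_index_cycle_gluing(1)) (use that y' in simp)
    show ?thesis unfolding y' realizations_eq using finite_pair_isos[OF wf] by simp
  qed
  have card_g: "card (graph_isos g (snd P)) = card (graph_Aut g)"
    using card_graph_isos[OF simple] g(2) unfolding graphs_isomorphic_def by blast
  have "id \<in> graph_Aut g" by (rule graph_AutI[OF simple]) (simp_all add: graph_iso_id)
  then have card_g_pos: "card (graph_Aut g) > 0"
      using finite_graph_Aut[OF simple] by (auto simp: card_gt_0_iff)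
  \<comment> \<open>The set of symmetries of the required sign contains a conjugate of a full round
    of \<tau>. Being nonempty, it is as large as the group of pole-fixing symmetries, which counts
    the isomorphisms.\<close>
  have card_n: "card (network_isos (n f C) (core_part P f C))
      = card (network_syms (cylindrical (sg f) C) (n f C))"
    "card (network_syms (cylindrical (sg f) C) (n f C)) > 0"
    if fm: "f \<in> graph_isos g (snd P)" and C: "C \<in> K f" for f C
  proof -
    interpret core_iso P Ms \<tau> g f "sg f" by (rule ci[OF fm])
    obtain k where k: "network_iso k (n f C) (core_part P f C)"
      using n(2)[OF fm C] unfolding networks_isomorphic_def by blast
    note sym = pull_back_network_syms(1)[OF n(3)[OF fm C] k core_part_return[OF C[unfolded K_def]]]
    show "card (network_isos (n f C) (core_part P f C))
        = card (network_syms (cylindrical (sg f) C) (n f C))"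
      using card_network_isos[OF n(3)[OF fm C] k] card_network_syms[OF n(3)[OF fm C] sym] by simp
    show "card (network_syms (cylindrical (sg f) C) (n f C)) > 0"
      using sym finite_network_syms[OF n(3)[OF fm C]] unfolding card_gt_0_iff by blast
  qed
  have finK: "finite (K f)" if fm: "f \<in> graph_isos g (snd P)" for f
  proof -
    interpret core_iso P Ms \<tau> g f "sg f" by (rule ci[OF fm])
    show ?thesis using finite_edge_cycles by (simp add: K_def)
  qed
  \<comment> \<open>Infinite sets have cardinality 0, so the positive cardinalities just found yield
    finiteness.\<close>
  have finI: "finite (I f)" if fm: "f \<in> graph_isos g (snd P)" for f
    unfolding I_def
    by (intro finite_PiE finK fm card_ge_0_finite) (use card_n[OF fm] in simp)
  have "(\<Sum>y\<in>?Y. core_coeff y * of_nat (card (realizations (P, \<tau>) y)))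
      = (\<Sum>y\<in>?Y. \<Sum>\<beta>\<in>realizations (P, \<tau>) y. core_coeff y)"
    by (simp add: mult.commute)
  also have "\<dots> = (\<Sum>t\<in>?T. core_coeff (fst t))"
    using sum.Sigma[OF finY, of "realizations (P, \<tau>)" "\<lambda>y \<beta>. core_coeff y"] finR
        by (simp add: case_prod_unfold)
  also have "\<dots> = (\<Sum>s\<in>?S. core_coeff (fst (\<Theta> s)))"
    by (rule sum.reindex_bij_betw[OF bij, symmetric])
  also have "\<dots> = (\<Sum>f\<in>graph_isos g (snd P). \<Sum>\<phi>\<in>I f. core_coeff (fst (\<Theta> (f, \<phi>))))"
  proof -
    have fin: "finite (graph_isos g (snd P))"
      by (rule card_ge_0_finite) (simp only: card_g card_g_pos)
    show ?thesis using sum.Sigma[OF fin, of I "\<lambda>f \<phi>. core_coeff (fst (\<Theta> (f, \<phi>)))"] finI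
        by (simp add: case_prod_unfold)
  qed
  also have "\<dots> = (\<Sum>f\<in>graph_isos g (snd P). 1 / of_nat (card (graph_Aut g)))"
  proof (rule sum.cong[OF refl])
    fix f assume fm: "f \<in> graph_isos g (snd P)"
    let ?s = "\<lambda>C. of_nat (card (network_syms (cylindrical (sg f) C) (n f C))) :: rat"
    have "core_coeff (fst (\<Theta> (f, \<phi>))) = 1 / of_nat (card (graph_Aut g)) * (\<Prod>C\<in>K f. 1 / ?s C)" for \<phi>
      by (simp add: \<Theta>_def core_coeff_def nu_def K_def cong: prod.cong)
    then have "(\<Sum>\<phi>\<in>I f. core_coeff (fst (\<Theta> (f, \<phi>))))
        = of_nat (card (I f)) * (1 / of_nat (card (graph_Aut g)) * (\<Prod>C\<in>K f. 1 / ?s C))"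
      by simp
    also have "of_nat (card (I f)) = (\<Prod>C\<in>K f. ?s C)"
      unfolding I_def card_PiE[OF finK[OF fm]] using card_n(1)[OF fm] by (simp cong: prod.cong)
    also have "(\<Prod>C\<in>K f. ?s C) * (1 / of_nat (card (graph_Aut g)) * (\<Prod>C\<in>K f. 1 / ?s C))
        = 1 / of_nat (card (graph_Aut g)) * (\<Prod>C\<in>K f. ?s C * (1 / ?s C))"
      by (simp only: prod.distrib ac_simps)
    also have "(\<Prod>C\<in>K f. ?s C * (1 / ?s C)) = 1"
      by (rule prod.neutral) (use card_n(2)[OF fm] in auto)
    finally show "(\<Sum>\<phi>\<in>I f. core_coeff (fst (\<Theta> (f, \<phi>)))) = 1 / of_nat (card (graph_Aut g))" by simp
  qed
  also have "\<dots> = 1" using card_g card_g_pos by simp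
  finally show ?thesis .
qed

end

theorem theorem3:
  fixes \<G> :: "('v :: infinite) graph set"
    and \<N> :: "'v network set"
  assumes "graph_species \<G>"
    and "network_species \<N>"
    and "symmetric_species \<N>"
  shows "Walsh_pairs (\<G> \<up> \<N>) =
    mps_subst (Walsh \<G>) (\<lambda>x. case x of
        VA k \<Rightarrow> mps_var (VA k)
      | VB k \<Rightarrow> dilate k (Walsh_plus \<N>)
      | VC k \<Rightarrow> dilate k (Walsh_minus \<N>))"
proof -
  interpret species_pair \<G> \<N> by standard (rule assms)+
  have W: "Walsh_pairs (\<G> \<up> \<N>) = series_of (pair_index (\<G> \<up> \<N>))
      (\<lambda>(P, \<sigma>). 1 / of_nat (card (pair_Aut P))) (\<lambda>(P, \<sigma>). weight (fst P) \<sigma>)"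
    using Walsh_pairs_eq(1)[of "\<G> \<up> \<N>"] wf_species by blast
  show ?thesis
    unfolding W Walsh_subst_eq(1)[OF \<G> \<N>]
  proof (rule mps_eqI)
    fix m
    let ?A = "{x. x \<in> pair_index (\<G> \<up> \<N>) \<and> weight (fst (fst x)) (snd x) = m}"
    let ?Y = "{y. y \<in> core_index \<G> \<N> \<and> core_monomial y = m}"
    let ?c = "\<lambda>x. 1 / of_nat (card (pair_Aut (fst x))) :: rat"
    let ?r = "\<lambda>x y. of_nat (card (realizations x y)) :: rat"
    \<comment> \<open>Each coefficient is multiplied by 1 in the form of
      \<open>sum_over_cores\<close>; after the exchange of the sums, the inner one is 1 by
      \<open>sum_over_pairs\<close>.\<close>
    have "(\<Sum>x\<in>?A. ?c x) = (\<Sum>x\<in>?A. ?c x * (\<Sum>y\<in>?Y. core_coeff y * ?r x y))"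
    proof (rule sum.cong[OF refl])
      fix x assume x: "x \<in> ?A"
      obtain P \<tau> where "x = (P, \<tau>)" by (cases x)
      then show "?c x = ?c x * (\<Sum>y\<in>?Y. core_coeff y * ?r x y)"
        using sum_over_cores[of P \<tau>] x by simp
    qed
    also have "\<dots> = (\<Sum>y\<in>?Y. core_coeff y * (\<Sum>x\<in>?A. ?c x * ?r x y))"
      unfolding sum_distrib_left by (subst sum.swap) (simp add: ac_simps)
    also have "\<dots> = (\<Sum>y\<in>?Y. core_coeff y)"
      by (rule sum.cong[OF refl]) (use sum_over_pairs in auto)
    finally show "mps_coeff (series_of (pair_index (\<G> \<up> \<N>)) (\<lambda>(P, \<sigma>). 1 / of_nat (card (pair_Aut P)) :: rat)
        (\<lambda>(P, \<sigma>). weight (fst P) \<sigma>)) m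
      = mps_coeff (series_of (core_index \<G> \<N>) core_coeff core_monomial) m"
      by (simp add: case_prod_unfold)
  qed
qed

end
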